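(* Let $p\equiv 3\pmod 4$ be a prime, let $t$ be a positive integer, and let $q=p^{2t}$. Write $q=u^2+2v^2$ with integers $u,v$ such that $u\equiv 3\pmod 4$ and, when $p\equiv 3\pmod 8$, $p\nmid u$. Let $\chi_4$ be a multiplicative character of order $4$ on $\mathbb{F}_q$. Then the number of cliques of order $4$ in the Peisert graph $P^\ast(q)$ is $$k_4(P^\ast(q))=\frac{q(q-1)}{3072}\left[2(q^2-20q+81)+2u(-p)^t+3q^2\cdot {}_3F_2\left(\begin{array}{ccc}\chi_4, & \chi_4, & \chi_4^3\\ & \varepsilon, & \varepsilon\end{array}\Big| 1\right)\right].$$
   Context: Let $g$ be a primitive element of $\mathbb{F}_q$. The Peisert graph $P^\ast(q)$ has vertex set $\mathbb{F}_q$, with $a\neq b$ adjacent iff $a-b\in\langle g^4\rangle\cup g\langle g^4\rangle$. A clique of order $m$ is a set of $m$ pairwise adjacent vertices; $k_m(G)$ is the number of such cliques in $G$. Multiplicative characters of $\mathbb{F}_q^\times$ are extended to $\mathbb{F}_q$ by $\chi(0)=0$ (including the trivial character $\varepsilon$). For characters $A,B$, $J(A,B)=\sum_{x\in\mathbb{F}_q}A(x)B(1-x)$ and ${A\choose B}=\frac{B(-1)}{q}J(A,\overline{B})$. Greene's finite field hypergeometric function is $${}_3F_2\left(\begin{array}{ccc}A_0, & A_1, & A_2\\ & B_1, & B_2\end{array}\Big| x\right)=\frac{q}{q-1}\sum_{\chi}{A_0\chi\choose \chi}{A_1\chi\choose B_1\chi}{A_2\chi\choose B_2\chi}\chi(x),$$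 the sum over all multiplicative characters $\chi$ of $\mathbb{F}_q$. *)

theory Defs
  imports
    Complex_Main
    "HOL-Library.Ramsey"
    "HOL-Library.Cardinality"
    "HOL-Computational_Algebra.Primes"
begin

text \<open>
  The finite field \<open>F\<^sub>q\<close> is rendered as an arbitrary type \<^typ>\<open>'a\<close> of sort
  \<open>{field, finite}\<close>, with \<open>q = CARD('a)\<close>.
\<close>

subsection \<open>Cliques and the Peisert graph\<close>

text \<open>A graph is given by its vertex set and its set of (unordered) edges, as for
  \<^const>\<open>clique\<close> in the library.\<close>

definition num_cliques :: "'v set \<Rightarrow> 'v set set \<Rightarrow> nat \<Rightarrow> nat" where
  "num_cliques V E m = card {K. K \<subseteq> V \<and> finite K \<and> card K = m \<and> clique K E}"

definition cyclic_subgroup :: "'a::field \<Rightarrow> 'a set" where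
  "cyclic_subgroup h = range (\<lambda>k::int. h powi k)"

definition primitive_element :: "'a::{field,finite} \<Rightarrow> bool" where
  "primitive_element g \<longleftrightarrow> cyclic_subgroup g = UNIV - {0}"

text \<open>If \<open>q\<close> is congruent to 1 modulo 8, then \<open>-1\<close> is a fourth power and the connection set
  is closed under negation, so the edge \<open>{a, b}\<close> is present iff \<open>a - b\<close> lies in it, for either
  order of \<open>a\<close> and \<open>b\<close>. For other \<open>q\<close> the edge set is that of the symmetric closure.\<close>

definition peisert_connection_set :: "'a::{field,finite} \<Rightarrow> 'a set" where
  "peisert_connection_set g =
     cyclic_subgroup (g ^ 4) \<union> (\<lambda>x. g * x) ` cyclic_subgroup (g ^ 4)"

definition peisert_edges :: "'a::{field,finite} \<Rightarrow> 'a set set" where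
  "peisert_edges g = {{a, b} | a b. a \<noteq> b \<and> a - b \<in> peisert_connection_set g}"

subsection \<open>Multiplicative characters\<close>

definition mult_char :: "('a::{field,finite} \<Rightarrow> complex) \<Rightarrow> bool" where
  "mult_char \<chi> \<longleftrightarrow> \<chi> 0 = 0 \<and> \<chi> 1 = 1 \<and> (\<forall>x y. \<chi> (x * y) = \<chi> x * \<chi> y)"

definition trivial_char :: "'a::{field,finite} \<Rightarrow> complex" where
  "trivial_char x = (if x = 0 then 0 else 1)"

definition char_mult ::
    "('a::{field,finite} \<Rightarrow> complex) \<Rightarrow> ('a \<Rightarrow> complex) \<Rightarrow> 'a \<Rightarrow> complex" where
  "char_mult A B = (\<lambda>x. A x * B x)"

definition char_power :: "('a::{field,finite} \<Rightarrow> complex) \<Rightarrow> nat \<Rightarrow> 'a \<Rightarrow> complex" where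
  "char_power A n = (char_mult A ^^ n) trivial_char"

definition char_conj :: "('a::{field,finite} \<Rightarrow> complex) \<Rightarrow> 'a \<Rightarrow> complex" where
  "char_conj A = (\<lambda>x. cnj (A x))"

definition mult_char_of_order :: "nat \<Rightarrow> ('a::{field,finite} \<Rightarrow> complex) \<Rightarrow> bool" where
  "mult_char_of_order n \<chi> \<longleftrightarrow> mult_char \<chi> \<and> 0 < n \<and> char_power \<chi> n = trivial_char \<and>
     (\<forall>m. 0 < m \<and> m < n \<longrightarrow> char_power \<chi> m \<noteq> trivial_char)"

subsection \<open>Greene's hypergeometric function\<close>

definition jacobi_sum ::
    "('a::{field,finite} \<Rightarrow> complex) \<Rightarrow> ('a \<Rightarrow> complex) \<Rightarrow> complex" where
  "jacobi_sum A B = (\<Sum>x\<in>UNIV. A x * B (1 - x))"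

definition char_binom ::
    "('a::{field,finite} \<Rightarrow> complex) \<Rightarrow> ('a \<Rightarrow> complex) \<Rightarrow> complex" where
  "char_binom A B = B (-1) / of_nat CARD('a) * jacobi_sum A (char_conj B)"

definition greene_3F2 ::
    "('a::{field,finite} \<Rightarrow> complex) \<Rightarrow> ('a \<Rightarrow> complex) \<Rightarrow> ('a \<Rightarrow> complex) \<Rightarrow>
     ('a \<Rightarrow> complex) \<Rightarrow> ('a \<Rightarrow> complex) \<Rightarrow> 'a \<Rightarrow> complex" where
  "greene_3F2 A0 A1 A2 B1 B2 x =
     of_nat CARD('a) / (of_nat CARD('a) - 1) *
     (\<Sum>\<chi> | mult_char \<chi>.
        char_binom (char_mult A0 \<chi>) \<chi> *
        char_binom (char_mult A1 \<chi>) (char_mult B1 \<chi>) *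
        char_binom (char_mult A2 \<chi>) (char_mult B2 \<chi>) * \<chi> x)"

text \<open>The sum over all characters is a genuine finite sum.\<close>

lemma mult_char_power: "mult_char \<chi> \<Longrightarrow> \<chi> (x ^ n) = \<chi> x ^ n"
  by (induction n) (auto simp: mult_char_def)

lemma finite_mult_chars: "finite {\<chi> :: 'a::{field,finite} \<Rightarrow> complex. mult_char \<chi>}"
proof -
  have "\<exists>n>0. x ^ n = 1" if "x \<noteq> 0" for x :: 'a
  proof -
    have "\<not> inj (\<lambda>k::nat. x ^ k)"
      using finite_imageD[of "\<lambda>k::nat. x ^ k" UNIV] by auto
    then obtain i j :: nat where "x ^ i = x ^ j" "i \<noteq> j"
      by (auto simp: inj_on_def)
    then obtain i j :: nat where ij: "x ^ i = x ^ j" "i < j"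
      by (metis linorder_neqE_nat)
    then have "x ^ i * x ^ (j - i) = x ^ i * 1"
      by (metis less_imp_le mult_1_right le_add_diff_inverse power_add)
    then show ?thesis
      using ij that by (intro exI[of _ "j - i"]) auto
  qed
  then obtain n where n: "\<And>x::'a. x \<noteq> 0 \<Longrightarrow> n x > 0 \<and> x ^ n x = 1"
    by metis
  define R where "R x = (if x = 0 then {0} else {z::complex. z ^ n x = 1})" for x :: 'a
  have "finite (R x)" for x
    using n[of x] finite_roots_unity[of "n x", where 'a = complex] by (auto simp: R_def)
  then have "finite (Pi\<^sub>E UNIV R)"
    by (intro finite_PiE) auto
  moreover have "{\<chi>. mult_char \<chi>} \<subseteq> Pi\<^sub>E UNIV R"
  proof (clarsimp simp: PiE_UNIV_domain Pi_def)
    fix \<chi> :: "'a \<Rightarrow> complex" and x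
    assume \<chi>: "mult_char \<chi>"
    then show "\<chi> x \<in> R x"
      using n[of x] mult_char_power[OF \<chi>, of x "n x"] by (auto simp: R_def mult_char_def)
  qed
  ultimately show ?thesis
    by (rule finite_subset[rotated])
qed

end

(* Write chi for the quartic character, phi = chi^2, and B for the function that is 1 on the
   connection set, -1 on the other nonzero elements and 0 at 0.  The matrix B(a - b) is that of a
   conference graph, so all products of B over proper subgraphs of the tetrahedron sum to explicit
   polynomials in q, and only the sum K over the full tetrahedron remains.  Since B is a linear
   combination of chi and its conjugate, K is a combination of 64 sums indexed by signs on the six
   edges.  Scaling by g kills half of them; up to permuting the vertices the others are the sum P over
   a Hamiltonian path, which is q^2 times the hypergeometric value, and one sum F.

   F is evaluated by multiplying it with J^2, where J is the Jacobi sum of chi and phi, and recognising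
   J^2 times the summand as a sum over the coefficients of a conic.  Counting points on that conic
   factors F as R * J.  As chi is conjugated by Frobenius, J and R are real; J^2 = q and a congruence
   modulo 4 give J = -(-p)^t, while R = 2 u follows from R^2 + 2 a^2 = 4 q, a congruence modulo 8, and,
   for p = 3 (mod 8), the nonvanishing of R modulo p. *)

theory Submission
  imports Defs "HOL-Number_Theory.Residues" "HOL-Combinatorics.Multiset_Permutations"
begin

subsection \<open>The quartic character and Frobenius\<close>

text \<open>The condition p = 3 (mod 4) enters through Frobenius: raising to the power p conjugates
  \<chi>, and nonzero elements of the prime field are fourth powers. So \<open>J\<close> and
  \<open>R\<close>, a priori in Z[i], are rational integers, and constants such as 2 and -1
  disappear from character arguments. Knowing J^2, or a norm form of R, leaves open a sign and
  possibly the choice of a representation. The congruences modulo 4 and 8 settle the sign. The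
  choice depends on p modulo 8: for p = 7 the prime is inert in Z[sqrt(-2)] and u^2 = q is forced,
  while for p = 3 it splits and q also has representations with p dividing u, such as v = 0;
  excluding them takes the nonvanishing of \<open>R\<close> modulo p. The constants: 3072 = 2 * 24 *
  2^6, with 24 orderings of a clique, six doubled edge indicators and the denominator 2 of
  \<open>K_eq\<close>. Further q^2 - 20 q + 81 = (q - 5)(q - 15) + 6, where q - 5 and q - 15 are the
  main terms for extending an edge and a triangle, and the 6 comes from the three edges of a
  triangle.\<close>

lemma minus_one_dvd_power_minus_one: "(a::nat) - 1 dvd a ^ n - 1"
proof (cases "a = 0")
  case False
  show ?thesis
  proof (induction n)
    case (Suc n)
    have "a ^ Suc n - 1 = a * (a ^ n - 1) + (a - 1)"
      using False by (simp add: diff_mult_distrib2)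
    then show ?case using Suc by (metis dvd_add dvd_mult dvd_refl)
  qed auto
qed (auto simp: power_0_left)

locale quartic_character =
  fixes \<chi> :: "'a::{field,finite} \<Rightarrow> complex" and g :: 'a and p t :: nat
  assumes prime_p: "prime p" and p_mod_4: "p mod 4 = 3" and t_pos: "t > 0"
    and card_field: "CARD('a) = p ^ (2 * t)"
    and primitive: "primitive_element g"
    and order_4: "mult_char_of_order 4 \<chi>"
begin

lemma chi_0 [simp]: "\<chi> 0 = 0" and chi_1 [simp]: "\<chi> 1 = 1"
  and chi_mult: "\<chi> (x * y) = \<chi> x * \<chi> y"
  using order_4 by (auto simp: mult_char_of_order_def mult_char_def)

lemma chi_power: "\<chi> (x ^ n) = \<chi> x ^ n"
  using order_4 mult_char_power by (auto simp: mult_char_of_order_def)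

lemma char_power_chi: "n > 0 \<Longrightarrow> char_power \<chi> n x = \<chi> x ^ n"
proof (induction n rule: nat_induct_non_zero)
  case 1
  then show ?case by (simp add: char_power_def char_mult_def trivial_char_def)
next
  case (Suc n)
  then show ?case by (simp add: char_power_def char_mult_def)
qed

lemma chi_power_4: "x \<noteq> 0 \<Longrightarrow> \<chi> x ^ 4 = 1"
  using order_4 char_power_chi[of 4 x] by (auto simp: mult_char_of_order_def trivial_char_def)

lemma chi_eq_0_iff [simp]: "\<chi> x = 0 \<longleftrightarrow> x = 0"
  using chi_power_4[of x] by (cases "x = 0") auto

lemma chi_cases: "x \<noteq> 0 \<Longrightarrow> \<chi> x = 1 \<or> \<chi> x = -1 \<or> \<chi> x = \<i> \<or> \<chi> x = -\<i>"
proof -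
  assume "x \<noteq> 0"
  have "(\<chi> x - 1) * (\<chi> x + 1) * (\<chi> x - \<i>) * (\<chi> x + \<i>) = \<chi> x ^ 4 - 1"
    by (simp add: algebra_simps power4_eq_xxxx)
  also have "\<dots> = 0" using chi_power_4[OF \<open>x \<noteq> 0\<close>] by simp
  finally show ?thesis by (auto simp: eq_neg_iff_add_eq_0)
qed

lemma chi_cnj_mult [simp]: "x \<noteq> 0 \<Longrightarrow> \<chi> x * cnj (\<chi> x) = 1"
  and chi_cnj_mult' [simp]: "x \<noteq> 0 \<Longrightarrow> cnj (\<chi> x) * \<chi> x = 1"
  using chi_cases[of x] by auto

lemma chi_cube: "\<chi> x ^ 3 = cnj (\<chi> x)"
  using chi_cases[of x] by (cases "x = 0") (auto simp: power3_eq_cube)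

lemma chi_inverse: "\<chi> (inverse x) = cnj (\<chi> x)"
proof (cases "x = 0")
  case False
  have "\<chi> (inverse x) = (\<chi> (inverse x) * \<chi> x) * cnj (\<chi> x)"
    using False by (simp add: mult.assoc)
  also have "\<chi> (inverse x) * \<chi> x = 1"
    using False by (simp flip: chi_mult)
  finally show ?thesis by simp
qed auto

lemma chi_divide: "\<chi> (x / y) = \<chi> x * cnj (\<chi> y)"
  by (simp add: divide_inverse chi_mult chi_inverse)

lemma power_card_minus_1:
  fixes x :: 'a
  assumes "x \<noteq> 0"
  shows "x ^ (CARD('a) - 1) = 1"
proof -
  have "(\<Prod>y\<in>UNIV - {0}. x * y) = \<Prod>(UNIV - {0})"
    by (rule prod.reindex_bij_witness[where i = "\<lambda>y. y / x" and j = "\<lambda>y. x * y"])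
       (use assms in auto)
  then have "x ^ (CARD('a) - 1) * \<Prod>(UNIV - {0}) = \<Prod>(UNIV - {0 :: 'a})"
    by (simp add: prod.distrib)
  moreover have "\<Prod>(UNIV - {0 :: 'a}) \<noteq> 0" by simp
  ultimately show ?thesis by (metis mult_cancel_right1)
qed

lemma card_gt_1: "CARD('a) > 1"
  unfolding card_field using prime_p t_pos by (intro one_less_power prime_gt_1_nat) auto

lemma g_nonzero [simp]: "g \<noteq> 0"
proof
  assume "g = 0"
  have "g powi 1 \<in> cyclic_subgroup g" by (auto simp only: cyclic_subgroup_def)
  with \<open>g = 0\<close> show False using primitive by (auto simp: primitive_element_def)
qed

text \<open>\<open>cyclic_subgroup\<close> uses integer exponents; this brings them to natural ones
  below q - 1.\<close>

lemma powi_eq_power_mod: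
  fixes x :: 'a
  assumes "x \<noteq> 0"
  shows "x powi k = x ^ nat (k mod int (CARD('a) - 1))"
proof -
  define m where "m = CARD('a) - 1"
  have m: "m > 0" using card_gt_1 by (simp add: m_def)
  have 1: "x powi int m = 1" using power_card_minus_1[OF assms] by (simp only: m_def power_int_of_nat)
  have "x powi k = x powi (int m * (k div int m) + k mod int m)" by simp
  also have "\<dots> = (x powi int m) powi (k div int m) * x powi (k mod int m)"
    unfolding power_int_mult[symmetric] by (rule power_int_add) (use assms in simp)
  also have "\<dots> = x powi (k mod int m)" unfolding 1 by simp
  also have "\<dots> = x ^ nat (k mod int m)"
    using m by (simp add: power_int_def)
  finally show ?thesis by (simp add: m_def)
qed

lemma discrete_log:
  fixes x :: 'a
  assumes "x \<noteq> 0"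
  obtains k where "k < CARD('a) - 1" "x = g ^ k"
proof -
  have "x \<in> cyclic_subgroup g" using primitive assms by (auto simp: primitive_element_def)
  then obtain k where "x = g powi k" by (auto simp: cyclic_subgroup_def)
  then show ?thesis
    using that[of "nat (k mod int (CARD('a) - 1))"] card_gt_1 powi_eq_power_mod[of g k]
    by (simp add: nat_less_iff)
qed

lemma bij_betw_power_g: "bij_betw (\<lambda>k. g ^ k) {..<CARD('a) - 1} (UNIV - {0})"
proof -
  have "(\<lambda>k. g ^ k) ` {..<CARD('a) - 1} = UNIV - {0}"
  proof (intro equalityI subsetI)
    fix x :: 'a assume "x \<in> UNIV - {0}"
    then show "x \<in> (\<lambda>k. g ^ k) ` {..<CARD('a) - 1}" using discrete_log[of x] by blast
  qed auto
  then show ?thesis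
    by (auto simp: bij_betw_def intro!: eq_card_imp_inj_on)
qed

lemma power_g_eq_1_iff: "g ^ k = 1 \<longleftrightarrow> (CARD('a) - 1) dvd k"
proof
  assume "(CARD('a) - 1) dvd k"
  then show "g ^ k = 1" using power_card_minus_1[of g] by (auto simp: power_mult)
next
  assume *: "g ^ k = 1"
  define m where "m = CARD('a) - 1"
  have m: "m > 0" using card_gt_1 by (simp add: m_def)
  have "g ^ (k mod m) = g ^ (m * (k div m)) * g ^ (k mod m)"
    using power_card_minus_1[of g] by (simp add: power_mult m_def)
  also have "\<dots> = 1" using * by (simp flip: power_add)
  finally have "g ^ (k mod m) = g ^ 0" by simp
  then have "k mod m = 0"
    using bij_betw_power_g m unfolding bij_betw_def inj_on_def m_def by auto
  then show "(CARD('a) - 1) dvd k" by (auto simp: m_def)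
qed

text \<open>If \<chi> g were 1 or -1, then \<chi>^2 would be trivial on all powers of g, against
  order 4.\<close>

lemma chi_g_cases: "\<chi> g = \<i> \<or> \<chi> g = -\<i>"
proof -
  have "\<chi> g ^ 2 \<noteq> 1"
  proof
    assume *: "\<chi> g ^ 2 = 1"
    have "char_power \<chi> 2 = trivial_char"
    proof
      fix x
      show "char_power \<chi> 2 x = trivial_char x"
      proof (cases "x = 0")
        case False
        then obtain k where "x = g ^ k" by (rule discrete_log)
        then have "\<chi> x ^ 2 = 1" using * by (simp add: chi_power flip: power_mult) (simp add: power_mult mult.commute[of k])
        then show ?thesis using False by (simp add: char_power_chi trivial_char_def)
      qed (simp add: char_power_chi trivial_char_def)
    qed
    then show False using order_4 by (simp add: mult_char_of_order_def)
  qed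
  then show ?thesis using chi_cases[of g] by auto
qed

lemma p_odd: "odd p"
  using p_mod_4 by presburger

lemma p_squared_mod_8: "p\<^sup>2 mod 8 = 1"
proof -
  have "p mod 8 = 3 \<or> p mod 8 = 7" using p_mod_4 by presburger
  moreover have "p\<^sup>2 mod 8 = (p mod 8)\<^sup>2 mod 8" by (simp add: power_mod)
  ultimately show ?thesis by auto
qed

lemma card_mod_8: "CARD('a) mod 8 = 1"
proof -
  have "CARD('a) mod 8 = (p\<^sup>2 mod 8) ^ t mod 8"
    by (simp only: card_field power_mult power_mod)
  then show ?thesis by (simp add: p_squared_mod_8)
qed

text \<open>Exponent of the quartic residue symbol: \<open>x ^ m\<close> is the counterpart of
  \<chi> x inside the field.\<close>

definition m where "m = (CARD('a) - 1) div 4"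

lemma card_eq: "CARD('a) = 4 * m + 1" and m_even: "even m" and m_pos: "m > 0"
proof -
  have "8 dvd CARD('a) - 1" using card_mod_8 card_gt_1
    by (metis dvd_minus_mod)
  then obtain n where n: "CARD('a) - 1 = 8 * n" by auto
  then have "m = 2 * n" by (simp add: m_def)
  then show "CARD('a) = 4 * m + 1" "even m" "m > 0" using n card_gt_1 by auto
qed

text \<open>Quartic Euler criterion: for x = g^k both sides say that 4 divides k, since \<chi> g has
  order 4 and g has order 4 m.\<close>

lemma chi_eq_1_iff:
  assumes "x \<noteq> 0"
  shows "\<chi> x = 1 \<longleftrightarrow> x ^ m = 1"
proof -
  obtain k where k: "x = g ^ k" using assms by (rule discrete_log)
  have "\<chi> g ^ k = 1 \<longleftrightarrow> 4 dvd k"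
  proof -
    have "\<chi> g ^ k = \<chi> g ^ (4 * (k div 4) + k mod 4)" by simp
    also have "\<dots> = \<chi> g ^ (k mod 4)"
      unfolding power_add power_mult using chi_power_4[of g] by simp
    finally have eq: "\<chi> g ^ k = \<chi> g ^ (k mod 4)" .
    have "k mod 4 \<in> {0, 1, 2, 3}" by auto
    then show ?thesis
      unfolding eq using chi_g_cases
      by (elim disjE) (auto simp: power3_eq_cube power2_eq_square dvd_eq_mod_eq_0 complex_eq_iff
        simp del: complex_i_not_one)
  qed
  moreover have "x ^ m = 1 \<longleftrightarrow> 4 * m dvd k * m"
    using power_g_eq_1_iff[of "k * m"] by (simp add: k power_mult card_eq)
  ultimately show ?thesis using m_pos by (simp add: k chi_power)
qed

lemma CHAR_eq: "CHAR('a) = p"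
proof -
  have "CHAR('a) dvd p ^ (2 * t)" using CHAR_dvd_CARD[where ?'a = 'a] by (simp add: card_field)
  moreover have "prime CHAR('a)" by (intro prime_CHAR_semidom finite_imp_CHAR_pos) simp
  ultimately show ?thesis using prime_p prime_dvd_power primes_dvd_imp_eq by blast
qed

lemma frob_add: "(x + y :: 'a) ^ p = x ^ p + y ^ p"
  by (rule freshmans_dream) (simp_all add: CHAR_eq prime_p)

lemma frob_minus: "(- x :: 'a) ^ p = - (x ^ p)"
  using p_odd by (simp add: power_minus_odd)

lemma frob_diff: "(x - y :: 'a) ^ p = x ^ p - y ^ p"
  using frob_add[of x "-y"] frob_minus by simp

lemma bij_frob: "bij (\<lambda>x :: 'a. x ^ p)"
proof -
  have "inj (\<lambda>x :: 'a. x ^ p)"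
  proof (rule injI)
    fix x y :: 'a
    assume "x ^ p = y ^ p"
    then have "(x - y) ^ p = 0" by (simp add: frob_diff)
    then show "x = y" by simp
  qed
  then show ?thesis by (simp add: bij_def finite_UNIV_inj_surj)
qed

text \<open>p = 3 (mod 4) turns \<chi>^p into \<chi>^3, the inverse of \<chi>. The reality of
  \<open>J\<close> and \<open>R\<close> and the shape of \<open>S g\<close> rest on this.\<close>

lemma chi_frob: "\<chi> (x ^ p) = cnj (\<chi> x)"
proof (cases "x = 0")
  case False
  have "p = 4 * (p div 4) + 3" using p_mod_4 by presburger
  then have "\<chi> (x ^ p) = (\<chi> x ^ 4) ^ (p div 4) * \<chi> x ^ 3"
    by (metis chi_power power_add power_mult)
  then show ?thesis using False by (simp add: chi_power_4 chi_cube)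
qed (use prime_p in \<open>auto simp: prime_gt_0_nat\<close>)

lemma chi_prime_field:
  assumes "c \<noteq> 0" and "c ^ p = c"
  shows "\<chi> c = 1"
proof -
  have "c ^ p = c ^ (p - 1) * c"
    using prime_gt_0_nat[OF prime_p] by (metis Suc_pred' power_Suc2)
  then have 1: "c ^ (p - 1) = 1" using assms by simp
  have "p - 1 dvd m"
  proof -
    have "4 dvd p + 1" using p_mod_4 by presburger
    then obtain k where k: "p + 1 = 4 * k" by auto
    have "p\<^sup>2 - 1 dvd (p\<^sup>2) ^ t - 1"
      by (rule minus_one_dvd_power_minus_one)
    then obtain r where "CARD('a) - 1 = (p\<^sup>2 - 1) * r" by (auto simp: card_field power_mult)
    moreover have "p\<^sup>2 - 1 = (p - 1) * (p + 1)" by (simp add: power2_eq_square algebra_simps)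
    ultimately have "4 * m = (p - 1) * (4 * k) * r" by (simp only: card_eq k)
    then have "m = (p - 1) * (k * r)" by simp
    then show ?thesis by simp
  qed
  then have "c ^ m = 1" using 1 by (auto simp: power_mult)
  then show ?thesis using chi_eq_1_iff assms by simp
qed

lemma two_neq_0: "(2 :: 'a) \<noteq> 0"
proof
  assume "(2 :: 'a) = 0"
  then have "of_nat 2 = (0 :: 'a)" by simp
  then have "p dvd 2" unfolding of_nat_eq_0_iff_char_dvd CHAR_eq .
  then have "p \<le> 2" by (simp add: dvd_imp_le)
  then show False using p_mod_4 by simp
qed

lemma chi_2 [simp]: "\<chi> 2 = 1"
  using two_neq_0 frob_add[of 1 1] by (intro chi_prime_field) auto

lemma chi_numeral_4 [simp]: "\<chi> 4 = 1"
  using chi_mult[of 2 2] by simp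

lemma chi_minus [simp]: "\<chi> (- x) = \<chi> x"
proof -
  have "\<chi> (-1) = 1" by (rule chi_prime_field) (use p_odd in auto)
  then show ?thesis using chi_mult[of "-1" x] by simp
qed

subsection \<open>Quadratic and quartic character sums\<close>

lemma sum_scale: "c \<noteq> 0 \<Longrightarrow> (\<Sum>x\<in>UNIV. f (c * x)) = (\<Sum>x\<in>UNIV. f (x :: 'a))" for f :: "'a \<Rightarrow> 'b::comm_monoid_add"
  by (rule sum.reindex_bij_witness[where i = "\<lambda>x. x / c" and j = "\<lambda>x. c * x"]) auto

lemma sum_shift: "(\<Sum>x\<in>UNIV. f (x + c)) = (\<Sum>x\<in>UNIV. f (x :: 'a))" for f :: "'a \<Rightarrow> 'b::comm_monoid_add"
  by (rule sum.reindex_bij_witness[where i = "\<lambda>x. x - c" and j = "\<lambda>x. x + c"]) auto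

lemma sum_scale2:
  fixes f :: "'a \<Rightarrow> 'a \<Rightarrow> 'b::comm_monoid_add"
  assumes "c \<noteq> 0" "d \<noteq> 0"
  shows "(\<Sum>x\<in>UNIV. \<Sum>y\<in>UNIV. f (c * x) (d * y)) = (\<Sum>x\<in>UNIV. \<Sum>y\<in>UNIV. f x y)"
  using sum_scale[OF assms(1), of "\<lambda>x. \<Sum>y\<in>UNIV. f x y"] by (simp add: sum_scale[OF assms(2)])

lemma sum_shift2: "(\<Sum>x\<in>UNIV. \<Sum>y\<in>UNIV. f (x + c) (y + d)) = (\<Sum>x\<in>UNIV. \<Sum>y\<in>UNIV. f x (y :: 'a))"
  for f :: "'a \<Rightarrow> 'a \<Rightarrow> 'b::comm_monoid_add"
  using sum_shift[of "\<lambda>x. \<Sum>y\<in>UNIV. f x y" c] by (simp add: sum_shift)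

lemma sum_reflect: "(\<Sum>x\<in>UNIV. f (c - x)) = (\<Sum>x\<in>UNIV. f (x :: 'a))" for f :: "'a \<Rightarrow> 'b::comm_monoid_add"
  by (rule sum.reindex_bij_witness[where i = "\<lambda>x. c - x" and j = "\<lambda>x. c - x"]) auto

lemma sum_inverse: "(\<Sum>x\<in>UNIV. f (inverse x)) = (\<Sum>x\<in>UNIV. f (x :: 'a))" for f :: "'a \<Rightarrow> 'b::comm_monoid_add"
  by (rule sum.reindex_bij_witness[where i = inverse and j = inverse]) auto

lemma sum_frob: "(\<Sum>x\<in>UNIV. f (x ^ p)) = (\<Sum>x\<in>UNIV. f (x :: 'a))" for f :: "'a \<Rightarrow> 'b::comm_monoid_add"
  by (rule sum.reindex_bij_betw[OF bij_frob])

lemma sum_eq_0_by_scaling: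
  fixes f :: "'a \<Rightarrow> complex"
  assumes "c \<noteq> 0" "k \<noteq> 1" "\<And>x. f (c * x) = k * f x"
  shows "(\<Sum>x\<in>UNIV. f x) = 0"
proof -
  have "(\<Sum>x\<in>UNIV. f x) = k * (\<Sum>x\<in>UNIV. f x)"
    using sum_scale[of c f] assms by (simp add: sum_distrib_left)
  then show ?thesis using assms(2) by simp
qed

lemma real_sum:
  fixes f :: "'a \<Rightarrow> complex"
  assumes "\<And>x. cnj (f x) = f (x ^ p)"
  shows "cnj (\<Sum>x\<in>UNIV. f x) = (\<Sum>x\<in>UNIV. f x)"
  using assms sum_frob[of f] by simp

definition \<phi> :: "'a \<Rightarrow> complex" where "\<phi> x = \<chi> x ^ 2"

lemma phi_0 [simp]: "\<phi> 0 = 0" and phi_1 [simp]: "\<phi> 1 = 1"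
  and phi_minus [simp]: "\<phi> (- x) = \<phi> x"
  and phi_2 [simp]: "\<phi> 2 = 1" and phi_4 [simp]: "\<phi> 4 = 1"
  and phi_mult: "\<phi> (x * y) = \<phi> x * \<phi> y"
  by (simp_all add: \<phi>_def chi_mult power_mult_distrib)

lemma phi_cases: "x \<noteq> 0 \<Longrightarrow> \<phi> x = 1 \<or> \<phi> x = -1"
  using chi_cases[of x] by (auto simp: \<phi>_def)

lemma phi_square [simp]: "x \<noteq> 0 \<Longrightarrow> \<phi> x * \<phi> x = 1"
  using phi_cases[of x] by auto

lemma phi_square_left [simp]: "x \<noteq> 0 \<Longrightarrow> \<phi> x * (\<phi> x * z) = z"
  using phi_cases[of x] by auto

lemma phi_eq_0_iff [simp]: "\<phi> x = 0 \<longleftrightarrow> x = 0"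
  by (simp add: \<phi>_def)

lemma cnj_phi [simp]: "cnj (\<phi> x) = \<phi> x"
  using phi_cases[of x] by (cases "x = 0") auto

lemma phi_inverse: "\<phi> (inverse x) = \<phi> x"
  by (metis \<phi>_def chi_inverse cnj_phi complex_cnj_power)

lemma phi_divide: "\<phi> (x / y) = \<phi> x * \<phi> y"
  by (simp add: divide_inverse phi_mult phi_inverse)

lemma phi_diff_commute: "\<phi> (x - y) = \<phi> (y - x)"
  using phi_minus[of "x - y"] by simp

lemma chi_mult_chi: "\<chi> x * \<chi> x = \<phi> x"
  by (simp add: \<phi>_def power2_eq_square)

lemma chi_square: "\<chi> (x ^ 2) = \<phi> x"
  by (simp add: chi_power \<phi>_def)

lemma phi_power2: "x \<noteq> 0 \<Longrightarrow> \<phi> (x ^ 2) = 1"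
  by (simp add: power2_eq_square phi_mult)

lemma phi_mult_chi: "\<phi> x * \<chi> x = cnj (\<chi> x)"
  using chi_cube[of x] by (simp add: \<phi>_def power3_eq_cube power2_eq_square)

lemma phi_mult_cnj_chi: "\<phi> x * cnj (\<chi> x) = \<chi> x"
  using chi_cases[of x] by (cases "x = 0") (auto simp: \<phi>_def)

lemma phi_g: "\<phi> g = -1"
  using chi_g_cases by (auto simp: \<phi>_def)

lemma phi_eq_1_iff:
  assumes "x \<noteq> 0"
  shows "\<phi> x = 1 \<longleftrightarrow> (\<exists>y. x = y\<^sup>2)"
proof
  assume *: "\<phi> x = 1"
  obtain k where k: "x = g ^ k" using assms by (rule discrete_log)
  have "\<phi> x = \<phi> g ^ k"
    by (simp add: k \<phi>_def chi_power mult.commute flip: power_mult)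
  then have "\<phi> x = (- 1) ^ k" by (simp add: phi_g)
  then have "even k" using * by (cases "even k") auto
  then obtain j where "k = 2 * j" by auto
  then have "x = (g ^ j)\<^sup>2" by (simp add: k power_mult mult.commute flip: power_mult)
  then show "\<exists>y. x = y\<^sup>2" ..
qed (use assms phi_power2 in auto)

lemma card_sqrt: "of_nat (card {x. x\<^sup>2 = z}) = 1 + \<phi> z"
proof (cases "z = 0")
  case False
  show ?thesis
  proof (cases "\<exists>y. z = y\<^sup>2")
    case True
    then obtain y where y: "z = y\<^sup>2" by auto
    then have "{x. x\<^sup>2 = z} = {y, -y}" by (auto simp: power2_eq_iff)
    moreover have "y \<noteq> - y" using y False two_neq_0
      by (metis add.right_inverse eq_neg_iff_add_eq_0 mult_2 mult_eq_0_iff power_zero_numeral)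
    ultimately have "card {x. x\<^sup>2 = z} = 2" by simp
    then show ?thesis using phi_eq_1_iff[OF False] True by simp
  next
    case no: False
    then have "{x. x\<^sup>2 = z} = {}" by auto
    then show ?thesis using phi_eq_1_iff[OF False] phi_cases[OF False] no by auto
  qed
qed auto

lemma sum_squares:
  fixes f :: "'a \<Rightarrow> complex"
  shows "(\<Sum>x\<in>UNIV. f (x\<^sup>2)) = (\<Sum>z\<in>UNIV. f z * (1 + \<phi> z))"
proof -
  have "(\<Sum>x\<in>UNIV. f (x\<^sup>2)) = (\<Sum>z\<in>UNIV. \<Sum>x | x \<in> UNIV \<and> x\<^sup>2 = z. f (x\<^sup>2))"
    by (rule sum.group[symmetric]) auto
  also have "\<dots> = (\<Sum>z\<in>UNIV. of_nat (card {x. x\<^sup>2 = z}) * f z)"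
    by (intro sum.cong refl) simp
  finally show ?thesis by (simp add: card_sqrt mult.commute)
qed

text \<open>For given v the equation y + 1/y = v is y^2 - v y + 1 = 0, which has discriminant v^2 -
  4 and never the root 0; so it has 1 + \<phi> (v^2 - 4) solutions.\<close>

lemma sum_plus_inverse:
  fixes f :: "'a \<Rightarrow> complex"
  shows "(\<Sum>y | y \<noteq> 0. f (y + inverse y)) = (\<Sum>v\<in>UNIV. f v * (1 + \<phi> (v\<^sup>2 - 4)))"
proof -
  have "(\<Sum>y | y \<noteq> 0. f (y + inverse y))
    = (\<Sum>v\<in>UNIV. \<Sum>y | y \<in> {y. y \<noteq> 0} \<and> y + inverse y = v. f (y + inverse y))"
    by (rule sum.group[symmetric]) auto
  also have "\<dots> = (\<Sum>v\<in>UNIV. of_nat (card {y. y \<noteq> 0 \<and> y + inverse y = v}) * f v)"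
    by (intro sum.cong refl) simp
  also have "\<dots> = (\<Sum>v\<in>UNIV. of_nat (card {x. x\<^sup>2 = v\<^sup>2 - 4}) * f v)"
  proof (intro sum.cong refl, rule arg_cong[where f = "\<lambda>n. of_nat n * _"])
    fix v :: 'a
    \<comment> \<open>Completing the square: 2 y - v is the square root of the discriminant that
      belongs to the root y.\<close>
    have "bij_betw (\<lambda>y. 2 * y - v) {y. y \<noteq> 0 \<and> y + inverse y = v} {x. x\<^sup>2 = v\<^sup>2 - 4}"
    proof (rule bij_betw_byWitness[where f' = "\<lambda>x. (x + v) / 2"])
      show "(\<lambda>y. 2 * y - v) ` {y. y \<noteq> 0 \<and> y + inverse y = v} \<subseteq> {x. x\<^sup>2 = v\<^sup>2 - 4}"
      proof clarify
        fix y :: 'a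
        assume "y \<noteq> 0"
        have "(2 * y - (y + inverse y))\<^sup>2 = (y + inverse y)\<^sup>2 - 4 * (y * inverse y)"
          by (simp add: power2_eq_square algebra_simps)
        then show "(2 * y - (y + inverse y))\<^sup>2 = (y + inverse y)\<^sup>2 - 4"
          using \<open>y \<noteq> 0\<close> by simp
      qed
      show "(\<lambda>x. (x + v) / 2) ` {x. x\<^sup>2 = v\<^sup>2 - 4} \<subseteq> {y. y \<noteq> 0 \<and> y + inverse y = v}"
      proof clarify
        fix x :: 'a
        assume x: "x\<^sup>2 = v\<^sup>2 - 4"
        have "(x + v) * (v - x) = v\<^sup>2 - x\<^sup>2" by (simp add: power2_eq_square algebra_simps)
        then have prod: "(x + v) * (v - x) = 2 * 2" by (simp add: x)
        then have nz: "x + v \<noteq> 0" using two_neq_0 by (metis mult_eq_0_iff)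
        then have "inverse ((x + v) / 2) = (v - x) / 2"
          using prod two_neq_0 by (simp add: field_simps)
        then have "(x + v) / 2 + inverse ((x + v) / 2) = (2 * v) / 2"
          by (simp add: add_divide_distrib diff_divide_distrib)
        then show "(x + v) / 2 \<noteq> 0 \<and> (x + v) / 2 + inverse ((x + v) / 2) = v"
          using nz two_neq_0 by simp
      qed
    qed (use two_neq_0 in \<open>auto simp del: distrib_left_numeral\<close>)
    then show "card {y. y \<noteq> 0 \<and> y + inverse y = v} = card {x. x\<^sup>2 = v\<^sup>2 - 4}"
      by (rule bij_betw_same_card)
  qed
  finally show ?thesis by (simp add: card_sqrt mult.commute)
qed

lemma sum_chi: "(\<Sum>x\<in>UNIV. \<chi> x) = 0"
  by (rule sum_eq_0_by_scaling[of g "\<chi> g"]) (use chi_g_cases in \<open>auto simp: chi_mult complex_eq_iff\<close>)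

lemma sum_phi: "(\<Sum>x\<in>UNIV. \<phi> x) = 0"
  by (rule sum_eq_0_by_scaling[of g "\<phi> g"]) (auto simp: phi_mult phi_g)

lemma sum_cnj_chi: "(\<Sum>x\<in>UNIV. cnj (\<chi> x)) = 0"
  using sum_chi by (metis cnj_sum complex_cnj_zero)

lemma sum_chi_linear: "k \<noteq> 0 \<Longrightarrow> (\<Sum>x\<in>UNIV. \<chi> (a - k * x)) = 0"
  using sum_scale[of k "\<lambda>x. \<chi> (a - x)"] sum_reflect[of \<chi> a] sum_chi by simp

text \<open>z / (z + s) is a Moebius map sending -s to infinity and infinity to 1; on the affine
  line the value 1 is therefore missed.\<close>

lemma sum_ratio:
  fixes f :: "'a \<Rightarrow> complex"
  assumes "s \<noteq> 0" "f 0 = 0"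
  shows "(\<Sum>z\<in>UNIV. f (z / (z + s))) = (\<Sum>v\<in>UNIV. f v) - f 1"
proof -
  \<comment> \<open>At z = -s the quotient is 0 by the convention for division by zero, and f
    vanishes at 0.\<close>
  have "(\<Sum>z\<in>UNIV. f (z / (z + s))) = (\<Sum>z\<in>UNIV - {-s}. f (z / (z + s)))"
    using assms(2) by (intro sum.mono_neutral_right) auto
  also have "\<dots> = (\<Sum>v\<in>UNIV - {1}. f v)"
  proof (intro sum.reindex_bij_witness[where j = "\<lambda>z. z / (z + s)" and i = "\<lambda>v. s * v / (1 - v)"])
    fix z assume "z \<in> UNIV - {-s}"
    then have z: "z + s \<noteq> 0" by (simp add: eq_neg_iff_add_eq_0)
    then have "1 - z / (z + s) = s / (z + s)" by (simp add: field_simps)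
    then show "s * (z / (z + s)) / (1 - z / (z + s)) = z" "z / (z + s) \<in> UNIV - {1}"
      using z assms(1) by auto
  next
    fix v :: 'a assume "v \<in> UNIV - {1}"
    then have v: "1 - v \<noteq> 0" by simp
    then have "s * v / (1 - v) + s = s / (1 - v)" by (simp add: field_simps)
    then show "s * v / (1 - v) / (s * v / (1 - v) + s) = v" "s * v / (1 - v) \<in> UNIV - {-s}"
      using v assms(1) by (auto simp: eq_neg_iff_add_eq_0)
  qed auto
  also have "\<dots> = (\<Sum>v\<in>UNIV. f v) - f 1"
    by (subst sum_diff1) auto
  finally show ?thesis .
qed

lemma sum_chi_cnj_shift: "s \<noteq> 0 \<Longrightarrow> (\<Sum>z\<in>UNIV. \<chi> z * cnj (\<chi> (z + s))) = -1"
  using sum_ratio[of s \<chi>] by (simp add: chi_divide sum_chi)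

lemma sum_phi_shift: "s \<noteq> 0 \<Longrightarrow> (\<Sum>z\<in>UNIV. \<phi> z * \<phi> (z + s)) = -1"
  using sum_ratio[of s \<phi>] by (simp add: phi_divide sum_phi)

section \<open>The Jacobi sum of the quartic and the quadratic character\<close>

definition J where "J = (\<Sum>x\<in>UNIV. \<chi> (1 - x\<^sup>2))"

lemma J_altdef: "J = (\<Sum>z\<in>UNIV. \<chi> (1 - z) * \<phi> z)"
  using sum_squares[of "\<lambda>z. \<chi> (1 - z)"] sum_reflect[of \<chi> 1] sum_chi
  by (simp add: J_def ring_distribs sum.distrib)

lemma cnj_J [simp]: "cnj J = J"
proof -
  have "\<chi> (1 - (x ^ p)\<^sup>2) = \<chi> ((1 - x\<^sup>2) ^ p)" for x
    by (simp add: frob_diff mult.commute flip: power_mult)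
  then show ?thesis unfolding J_def by (intro real_sum) (simp add: chi_frob)
qed

text \<open>Replacing w by z w pulls out \<phi> z * \<chi> z, the conjugate of \<chi> z. Thus
  convolution with \<phi> maps \<chi> to J times its conjugate.\<close>

lemma sum_chi_phi: "(\<Sum>w\<in>UNIV. \<chi> (z - w) * \<phi> w) = cnj (\<chi> z) * J"
proof (cases "z = 0")
  case True
  have "(\<Sum>w\<in>UNIV. \<chi> w * \<phi> w) = (\<Sum>w\<in>UNIV. cnj (\<chi> w))"
    by (intro sum.cong refl) (metis mult.commute phi_mult_chi)
  then show ?thesis using True sum_cnj_chi by simp
next
  case False
  have "(\<Sum>w\<in>UNIV. \<chi> (z - w) * \<phi> w) = (\<Sum>w\<in>UNIV. \<chi> (z - z * w) * \<phi> (z * w))"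
    using sum_scale[OF False, of "\<lambda>w. \<chi> (z - w) * \<phi> w"] by simp
  also have "\<dots> = (\<Sum>w\<in>UNIV. (\<phi> z * \<chi> z) * (\<chi> (1 - w) * \<phi> w))"
  proof (intro sum.cong refl)
    fix w
    have "z - z * w = z * (1 - w)" by (simp add: algebra_simps)
    then show "\<chi> (z - z * w) * \<phi> (z * w) = (\<phi> z * \<chi> z) * (\<chi> (1 - w) * \<phi> w)"
      by (simp only: chi_mult phi_mult) (simp add: mult_ac)
  qed
  finally show ?thesis by (simp add: phi_mult_chi J_altdef sum_distrib_left)
qed

lemma sum_chi_phi': "(\<Sum>w\<in>UNIV. cnj (\<chi> (z - w)) * \<phi> w) = \<chi> z * J"
  using arg_cong[OF sum_chi_phi[of z], of cnj] by simp

text \<open>Convolving \<chi> twice with \<phi> multiplies it by J^2. But \<phi> convolved with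
  itself is q times the delta at 0 minus the constant 1, and the constant annihilates \<chi>;
  evaluation at 1 gives q.\<close>

lemma J_mult_J: "J * J = of_nat CARD('a)"
proof -
  have 1: "(\<Sum>z\<in>UNIV. \<phi> z * \<phi> (c - z)) = (if c = 0 then of_nat CARD('a) - 1 else -1)" for c
  proof (cases "c = 0")
    case True
    have "(\<Sum>z\<in>UNIV. \<phi> z * \<phi> z) = (\<Sum>z\<in>UNIV - {0}. \<phi> z * \<phi> z)"
      by (intro sum.mono_neutral_right) auto
    then show ?thesis using True card_gt_1 by (simp add: of_nat_diff)
  next
    case False
    then show ?thesis using sum_phi_shift[of "- c"] phi_diff_commute[of c] by simp
  qed
  have "J * J = (\<Sum>z\<in>UNIV. cnj (\<chi> (1 - z)) * \<phi> z * J)"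
    using sum_chi_phi'[of 1] by (simp flip: sum_distrib_right)
  also have "\<dots> = (\<Sum>z\<in>UNIV. \<phi> z * (\<Sum>w\<in>UNIV. \<chi> (1 - z - w) * \<phi> w))"
    unfolding sum_chi_phi by (simp add: mult_ac)
  also have "\<dots> = (\<Sum>z\<in>UNIV. \<phi> z * (\<Sum>c\<in>UNIV. \<chi> (1 - c) * \<phi> (c - z)))"
  proof (intro sum.cong refl)
    fix z
    show "\<phi> z * (\<Sum>w\<in>UNIV. \<chi> (1 - z - w) * \<phi> w) = \<phi> z * (\<Sum>c\<in>UNIV. \<chi> (1 - c) * \<phi> (c - z))"
      using sum_shift[of "\<lambda>c. \<chi> (1 - c) * \<phi> (c - z)" z] by (simp add: algebra_simps)
  qed
  also have "\<dots> = (\<Sum>c\<in>UNIV. \<chi> (1 - c) * (\<Sum>z\<in>UNIV. \<phi> z * \<phi> (c - z)))"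
    unfolding sum_distrib_left by (subst sum.swap) (simp add: mult_ac)
  also have "\<dots> = (\<Sum>c\<in>UNIV. (if c = 0 then of_nat CARD('a) else 0) - \<chi> (1 - c))"
    by (intro sum.cong refl) (simp add: 1)
  also have "\<dots> = of_nat CARD('a)"
    using sum_reflect[of \<chi> 1] sum_chi by (simp add: sum_subtractf)
  finally show ?thesis .
qed

lemma J_nonzero [simp]: "J \<noteq> 0"
  using J_mult_J by auto

text \<open>Centring at d = c / 2 and scaling by d turns k (c - k) into d^2 (1 - x^2), and \<chi>
  (d^2) = \<phi> d = \<phi> c.\<close>

lemma sum_chi_chi: "(\<Sum>k\<in>UNIV. \<chi> k * \<chi> (c - k)) = \<phi> c * J"
proof (cases "c = 0")
  case True
  then show ?thesis using sum_phi by (simp add: chi_mult_chi)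
next
  case False
  define d where "d = c / 2"
  have d: "c = 2 * d" "d \<noteq> 0" using False two_neq_0 by (auto simp: d_def)
  have "(\<Sum>k\<in>UNIV. \<chi> k * \<chi> (c - k)) = (\<Sum>x\<in>UNIV. \<chi> (x + d) * \<chi> (c - (x + d)))"
    using sum_shift[of "\<lambda>k. \<chi> k * \<chi> (c - k)" d] by simp
  also have "\<dots> = (\<Sum>x\<in>UNIV. \<chi> (d * x + d) * \<chi> (c - (d * x + d)))"
    using sum_scale[OF d(2), of "\<lambda>x. \<chi> (x + d) * \<chi> (c - (x + d))"] by simp
  also have "\<dots> = (\<Sum>x\<in>UNIV. \<chi> (d\<^sup>2 * (1 - x\<^sup>2)))"
    by (intro sum.cong refl, subst chi_mult[symmetric], rule arg_cong[where f = \<chi>])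
       (simp add: d power2_eq_square algebra_simps)
  also have "\<dots> = \<phi> c * J"
    by (simp add: chi_mult[of "d\<^sup>2"] chi_square J_def sum_distrib_left d phi_mult)
  finally show ?thesis .
qed

text \<open>Each of the two summations yields a factor J and a conjugation of \<chi>; two of them
  give J^2 = q and restore \<chi>.\<close>

lemma sum_chi_quadratic_form:
  assumes "k \<noteq> 0" "l \<noteq> 0"
  shows "(\<Sum>x\<in>UNIV. \<Sum>y\<in>UNIV. \<chi> (D - k * x\<^sup>2 - l * y\<^sup>2)) = of_nat CARD('a) * \<phi> (k * l) * \<chi> D"
proof -
  have inner: "(\<Sum>y\<in>UNIV. \<chi> (E - c * y\<^sup>2)) = \<phi> c * cnj (\<chi> E) * J" if "c \<noteq> 0" for c E
  proof -
    have "(\<Sum>y\<in>UNIV. \<chi> (E - c * y\<^sup>2)) = (\<Sum>w\<in>UNIV. \<chi> (E - c * w) * \<phi> w)"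
      using sum_squares[of "\<lambda>w. \<chi> (E - c * w)"] sum_chi_linear[OF that, of E]
      by (simp add: ring_distribs sum.distrib)
    also have "\<dots> = (\<Sum>w\<in>UNIV. \<chi> (E - c * w) * \<phi> (c * (c * w)))"
      using that by (simp add: phi_mult)
    also have "\<dots> = (\<Sum>w\<in>UNIV. \<chi> (E - w) * \<phi> (c * w))"
      by (rule sum_scale[OF that])
    also have "\<dots> = \<phi> c * (\<Sum>w\<in>UNIV. \<chi> (E - w) * \<phi> w)"
      by (simp add: phi_mult sum_distrib_left mult_ac)
    finally show ?thesis by (simp add: sum_chi_phi)
  qed
  have "(\<Sum>x\<in>UNIV. \<Sum>y\<in>UNIV. \<chi> (D - k * x\<^sup>2 - l * y\<^sup>2))
      = \<phi> l * J * cnj (\<Sum>x\<in>UNIV. \<chi> (D - k * x\<^sup>2))"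
    unfolding inner[OF assms(2)] by (simp add: sum_distrib_left mult_ac)
  also have "\<dots> = (J * J) * \<phi> (k * l) * \<chi> D"
    by (simp add: inner assms phi_mult mult_ac)
  finally show ?thesis by (simp add: J_mult_J)
qed

subsection \<open>Factorization of \<open>F\<close>\<close>

text \<open>The cofactor of J in F. It is needed in three shapes: \<open>R_altdef\<close> for the
  congruence, \<open>R_mod_p\<close> for the reduction, and \<open>S 1\<close> for the norm
  equation.\<close>

definition R where "R = (\<Sum>y\<in>UNIV. \<chi> y * cnj (\<chi> (1 + y\<^sup>2)))"

text \<open>The tetrahedron sum with one conjugated edge, in coordinates where the ends of that edge
  lie at -1 and 1 and the other two vertices at x and -y (\<open>tetra01_one_minus\<close>).\<close>

definition F where
  "F = (\<Sum>x\<in>UNIV. \<Sum>y\<in>UNIV. \<chi> (1 - x\<^sup>2) * \<chi> (1 - y\<^sup>2) * \<chi> (x + y))"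

lemma cnj_R [simp]: "cnj R = R"
proof -
  have "1 + (x ^ p)\<^sup>2 = (1 + x\<^sup>2) ^ p" for x :: 'a
    by (simp add: frob_add mult.commute flip: power_mult)
  then show ?thesis unfolding R_def by (intro real_sum) (simp add: chi_frob)
qed

text \<open>With v = y + 1/y one has y (1 + y^2) = y^2 v and y (v + 2) = (y + 1)^2. So the summand
  is a function of v outside y = -1, and grouping by v leaves two convolutions of the conjugate of
  \<chi> with \<phi>, each equal to J.\<close>

lemma sum_chi_inverse_quartic: "(\<Sum>x\<in>UNIV. cnj (\<chi> x * \<chi> (1 + x\<^sup>2))) = 2 * J"
proof -
  have S1: "(\<Sum>v\<in>UNIV. cnj (\<chi> v) * \<phi> (v + 2)) = J" and S2: "(\<Sum>v\<in>UNIV. cnj (\<chi> v) * \<phi> (v - 2)) = J"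
  proof -
    have "(\<Sum>v\<in>UNIV. cnj (\<chi> v) * \<phi> (v - 2)) = (\<Sum>v\<in>UNIV. cnj (\<chi> (2 - v)) * \<phi> v)"
      using sum_reflect[of "\<lambda>v. cnj (\<chi> v) * \<phi> (v - 2)" 2] by simp
    then show 2: "(\<Sum>v\<in>UNIV. cnj (\<chi> v) * \<phi> (v - 2)) = J" by (simp add: sum_chi_phi')
    have "\<phi> (- v - 2) = \<phi> (v + 2)" for v
      using phi_minus[of "v + 2"] by simp
    then show "(\<Sum>v\<in>UNIV. cnj (\<chi> v) * \<phi> (v + 2)) = J"
      using sum_reflect[of "\<lambda>v. cnj (\<chi> v) * \<phi> (v - 2)" 0] 2 by simp
  qed
  have "(\<Sum>x\<in>UNIV. cnj (\<chi> x * \<chi> (1 + x\<^sup>2))) = (\<Sum>y | y \<noteq> 0. cnj (\<chi> y * \<chi> (1 + y\<^sup>2)))"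
    by (intro sum.mono_neutral_right) auto
  \<comment> \<open>At y = -1 the new factor \<phi> (v + 2) is 0 although \<phi> y = 1; the lost
    term is 1.\<close>
  also have "\<dots> = (\<Sum>y | y \<noteq> 0. \<phi> (y + inverse y + 2) * cnj (\<chi> (y + inverse y)) + (if y = -1 then 1 else 0))"
  proof (intro sum.cong refl)
    fix y :: 'a assume "y \<in> {y. y \<noteq> 0}"
    then have y: "y \<noteq> 0" by simp
    then have 1: "1 + y\<^sup>2 = y * (y + inverse y)" by (simp add: power2_eq_square algebra_simps)
    have "cnj (\<chi> y * \<chi> (1 + y\<^sup>2)) = \<phi> y * cnj (\<chi> (y + inverse y))"
      by (metis 1 chi_mult chi_mult_chi cnj_phi complex_cnj_mult mult.assoc)
    moreover have "\<phi> y = \<phi> (y + inverse y + 2)" if "y \<noteq> -1"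
    proof -
      have "y + inverse y + 2 = (y + 1)\<^sup>2 / y"
        using y by (simp add: field_simps power2_eq_square)
      then show ?thesis using that y by (simp add: phi_divide phi_power2 eq_neg_iff_add_eq_0)
    qed
    ultimately show "cnj (\<chi> y * \<chi> (1 + y\<^sup>2)) =
        \<phi> (y + inverse y + 2) * cnj (\<chi> (y + inverse y)) + (if y = -1 then 1 else 0)"
      by (cases "y = -1") (use chi_minus[of 2] in auto)
  qed
  also have "\<dots> = 1 + (\<Sum>v\<in>UNIV. (\<phi> (v + 2) * cnj (\<chi> v)) * (1 + \<phi> (v\<^sup>2 - 4)))"
    using sum_plus_inverse[of "\<lambda>v. \<phi> (v + 2) * cnj (\<chi> v)"] by (simp add: sum.distrib)
  \<comment> \<open>\<phi> (v + 2) squares to 1 except at v = -2; the correction there cancels the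
    one from y = -1.\<close>
  also have "\<dots> = 1 + (\<Sum>v\<in>UNIV. cnj (\<chi> v) * \<phi> (v + 2) + (cnj (\<chi> v) * \<phi> (v - 2) - (if v = -2 then 1 else 0)))"
  proof (intro arg_cong2[where f = "(+)"] sum.cong refl)
    fix v :: 'a
    show "\<phi> (v + 2) * cnj (\<chi> v) * (1 + \<phi> (v\<^sup>2 - 4)) =
        cnj (\<chi> v) * \<phi> (v + 2) + (cnj (\<chi> v) * \<phi> (v - 2) - (if v = -2 then 1 else 0))"
    proof (cases "v = -2")
      case True
      have "-2 - 2 = (-4 :: 'a)" by simp
      then show ?thesis using phi_minus[of 4] chi_minus[of 2] True by simp
    next
      case False
      then have "v + 2 \<noteq> 0" by (simp add: eq_neg_iff_add_eq_0)
      moreover have "v\<^sup>2 - 4 = (v + 2) * (v - 2)" by (simp add: power2_eq_square algebra_simps)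
      then have "\<phi> (v\<^sup>2 - 4) = \<phi> (v + 2) * \<phi> (v - 2)" by (simp only: phi_mult)
      ultimately have "\<phi> (v + 2) * \<phi> (v\<^sup>2 - 4) = \<phi> (v - 2)" by simp
      moreover have "\<phi> (v + 2) * cnj (\<chi> v) * (1 + \<phi> (v\<^sup>2 - 4))
        = cnj (\<chi> v) * \<phi> (v + 2) + cnj (\<chi> v) * (\<phi> (v + 2) * \<phi> (v\<^sup>2 - 4))"
        by (simp add: ring_distribs mult_ac)
      ultimately show ?thesis using False by simp
    qed
  qed
  also have "\<dots> = 2 * J" by (simp add: sum.distrib sum_subtractf S1 S2)
  finally show ?thesis .
qed

text \<open>Opens a product of three values of \<chi> into a sum with a single value at a linear
  combination of a, b and c; this is what creates the conic. If none of them is 0, scaling k by c/a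
  and l by c/b pulls the characters out, and two convolutions with value J remain. If one is 0 the
  sum vanishes, by \<open>sum_cnj_chi\<close> or, for c = 0, by scaling k and l with g.\<close>

lemma sum_chi_three_linear:
  "(\<Sum>k\<in>UNIV. \<Sum>l\<in>UNIV. cnj (\<chi> k * \<chi> l * \<chi> (k * a + l * b + c))) = \<chi> a * \<chi> b * \<chi> c * J\<^sup>2"
proof -
  consider "a = 0" | "b = 0" | "a \<noteq> 0" "b \<noteq> 0" "c = 0" | "a \<noteq> 0" "b \<noteq> 0" "c \<noteq> 0" by blast
  then show ?thesis
  proof cases
    case 1
    then show ?thesis
      by (subst sum.swap) (simp add: sum_cnj_chi flip: sum_distrib_right)
  next
    case 2
    then show ?thesis
      by (simp add: sum_cnj_chi flip: sum_distrib_left sum_distrib_right)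
  next
    case 3
    define f where "f k l = cnj (\<chi> k * \<chi> l * \<chi> (k * a + l * b))" for k l
    have "f (g * k) (g * l) = \<chi> g * f k l" for k l
    proof -
      have "g * k * a + g * l * b = g * (k * a + l * b)" by (simp add: algebra_simps)
      moreover have "cnj (\<chi> g) * (cnj (\<chi> g) * cnj (\<chi> g)) = \<chi> g"
        using chi_cube[of g] by (metis complex_cnj_cnj complex_cnj_mult power3_eq_cube mult.assoc)
      ultimately show ?thesis by (simp add: f_def chi_mult mult_ac)
    qed
    then have "(\<Sum>l\<in>UNIV. f (g * k) l) = \<chi> g * (\<Sum>l\<in>UNIV. f k l)" for k
      using sum_scale[of g "f (g * k)"] by (simp add: sum_distrib_left)
    then have "(\<Sum>k\<in>UNIV. \<Sum>l\<in>UNIV. f k l) = 0"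
      using chi_g_cases by (intro sum_eq_0_by_scaling[of g "\<chi> g"]) (auto simp: complex_eq_iff)
    then show ?thesis using 3 by (simp add: f_def)
  next
    case 4
    define s where "s k l = cnj (\<chi> k * \<chi> l * \<chi> (k * a + l * b + c))" for k l
    have "s (c / a * k) (c / b * l) = \<chi> a * \<chi> b * \<chi> c * cnj (\<chi> k * \<chi> l * \<chi> (k + l + 1))" for k l
    proof -
      have "c / a * k * a + c / b * l * b + c = c * (k + l + 1)" using 4 by (simp add: field_simps)
      moreover have "cnj (\<chi> c) * (cnj (\<chi> c) * cnj (\<chi> c)) = \<chi> c"
        using chi_cube[of c] by (metis complex_cnj_cnj complex_cnj_mult power3_eq_cube mult.assoc)
      then have cube: "cnj (\<chi> c) * (cnj (\<chi> c) * (cnj (\<chi> c) * z)) = \<chi> c * z" for z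
        by (metis mult.assoc)
      ultimately show ?thesis
        by (simp only: s_def chi_mult complex_cnj_mult chi_divide complex_cnj_cnj) (simp only: mult_ac cube)
    qed
    moreover have "(\<Sum>k\<in>UNIV. \<Sum>l\<in>UNIV. s k l) = (\<Sum>k\<in>UNIV. \<Sum>l\<in>UNIV. s (c / a * k) (c / b * l))"
    proof -
      have "(\<Sum>l\<in>UNIV. s k (c / b * l)) = (\<Sum>l\<in>UNIV. s k l)" for k
        by (rule sum_scale) (use 4 in auto)
      then show ?thesis using sum_scale[of "c / a" "\<lambda>k. \<Sum>l\<in>UNIV. s k l"] 4 by simp
    qed
    moreover have "(\<Sum>k\<in>UNIV. \<Sum>l\<in>UNIV. cnj (\<chi> k * \<chi> l * \<chi> (k + l + 1))) = J\<^sup>2"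
    proof -
      have "(\<Sum>k\<in>UNIV. \<Sum>l\<in>UNIV. cnj (\<chi> k * \<chi> l * \<chi> (k + l + 1)))
        = (\<Sum>k\<in>UNIV. \<Sum>c\<in>UNIV. cnj (\<chi> k * \<chi> (c - k) * \<chi> (c + 1)))"
      proof (rule sum.cong[OF refl])
        fix k
        show "(\<Sum>l\<in>UNIV. cnj (\<chi> k * \<chi> l * \<chi> (k + l + 1))) = (\<Sum>c\<in>UNIV. cnj (\<chi> k * \<chi> (c - k) * \<chi> (c + 1)))"
          using sum_shift[of "\<lambda>c. cnj (\<chi> k * \<chi> (c - k) * \<chi> (c + 1))" k] by (simp add: add_ac)
      qed
      also have "\<dots> = (\<Sum>c\<in>UNIV. cnj (\<chi> (c + 1)) * cnj (\<Sum>k\<in>UNIV. \<chi> k * \<chi> (c - k)))"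
        by (subst sum.swap) (simp add: sum_distrib_left mult_ac)
      also have "\<dots> = J * (\<Sum>c\<in>UNIV. cnj (\<chi> (c + 1)) * \<phi> c)"
        by (simp add: sum_chi_chi sum_distrib_left mult_ac)
      also have "(\<Sum>c\<in>UNIV. cnj (\<chi> (c + 1)) * \<phi> c) = J"
        using sum_reflect[of "\<lambda>c. cnj (\<chi> (c + 1)) * \<phi> c" 0] sum_chi_phi'[of 1] by simp
      finally show ?thesis by (simp add: power2_eq_square)
    qed
    ultimately show ?thesis by (simp add: s_def flip: sum_distrib_left)
  qed
qed

text \<open>Shifting x by 1/(2k) and y by 1/(2l) completes the squares. The constant k + l + 1/(4k)
  + 1/(4l) that appears factors as (k + l)(1 + 4kl) / (4kl), and the factorization of F rests on
  this.\<close>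

lemma sum_chi_conic:
  assumes "k \<noteq> 0" "l \<noteq> 0"
  shows "(\<Sum>x\<in>UNIV. \<Sum>y\<in>UNIV. \<chi> (k * (1 - x\<^sup>2) + l * (1 - y\<^sup>2) + (x + y)))
    = of_nat CARD('a) * (\<phi> (k * l) * (\<chi> (k + l) * \<chi> (1 + 4 * k * l) * cnj (\<chi> (k * l))))"
proof -
  define a b where "a = inverse (2 * k)" and "b = inverse (2 * l)"
  have ab: "2 * k * a = 1" "2 * l * b = 1" using assms two_neq_0 by (auto simp: a_def b_def)
  define D where "D = k + l + k * a\<^sup>2 + l * b\<^sup>2"
  have 1: "c * (1 - (z + d)\<^sup>2) + (z + d) = c + c * d\<^sup>2 - c * z\<^sup>2" if "2 * c * d = 1" for c d z :: 'a
  proof -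
    have "c * (1 - (z + d)\<^sup>2) + (z + d) = c + c * d\<^sup>2 - c * z\<^sup>2 + (1 - 2 * c * d) * (z + d)"
      by (simp add: power2_eq_square algebra_simps)
    then show ?thesis using that by simp
  qed
  have "k * (1 - (x + a)\<^sup>2) + l * (1 - (y + b)\<^sup>2) + (x + a + (y + b)) = D - k * x\<^sup>2 - l * y\<^sup>2" for x y
  proof -
    have "k * (1 - (x + a)\<^sup>2) + l * (1 - (y + b)\<^sup>2) + (x + a + (y + b))
      = (k * (1 - (x + a)\<^sup>2) + (x + a)) + (l * (1 - (y + b)\<^sup>2) + (y + b))"
      by (simp only: add_ac)
    then show ?thesis by (simp add: 1 ab D_def)
  qed
  then have "(\<Sum>x\<in>UNIV. \<Sum>y\<in>UNIV. \<chi> (k * (1 - x\<^sup>2) + l * (1 - y\<^sup>2) + (x + y)))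
    = (\<Sum>x\<in>UNIV. \<Sum>y\<in>UNIV. \<chi> (D - k * x\<^sup>2 - l * y\<^sup>2))"
    using sum_shift2[of "\<lambda>x y. \<chi> (k * (1 - x\<^sup>2) + l * (1 - y\<^sup>2) + (x + y))" a b] by simp
  also have "\<dots> = of_nat CARD('a) * \<phi> (k * l) * \<chi> D"
    by (rule sum_chi_quadratic_form[OF assms])
  also have "D = (k + l) * (1 + 4 * k * l) / (4 * (k * l))"
  proof -
    have "4 * (k * l) * D = (k + l) * (1 + 4 * k * l)"
    proof -
      have "4 * (k * l) * D = 4 * k * l * (k + l) + (2 * k * a) * (2 * k * a) * l + (2 * l * b) * (2 * l * b) * k"
        by (simp add: D_def power2_eq_square algebra_simps)
      also have "\<dots> = (k + l) * (1 + 4 * k * l)"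
        by (simp only: ab) (simp add: algebra_simps)
      finally show ?thesis .
    qed
    moreover have "4 * (k * l) \<noteq> 0" using assms two_neq_0 by (metis mult_eq_0_iff numeral_Bit0_eq_double)
    ultimately show ?thesis by (simp add: eq_divide_eq mult.commute)
  qed
  finally show ?thesis by (simp only: chi_divide chi_mult) (simp add: chi_mult mult_ac)
qed

text \<open>y = x m separates the factor at 1 + m from a sum \<open>h m\<close> over x. The
  substitution x -> 1/(m x) shows \<phi> m * h m = h m, so only squares m = n^2 contribute; there n
  can be scaled out of \<open>h\<close>, leaving 2 J by \<open>sum_chi_inverse_quartic\<close>, and
  the sum over n is R.\<close>

lemma sum_symmetric_eq_R_J:
  "(\<Sum>x\<in>UNIV. \<Sum>y\<in>UNIV. \<phi> (x * y) * cnj (\<chi> (x + y) * \<chi> (1 + x * y))) = R * J"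
proof -
  define h where "h m = (\<Sum>x\<in>UNIV. cnj (\<chi> x * \<chi> (1 + m * x\<^sup>2)))" for m
  define f where "f m = cnj (\<chi> (1 + m)) * h m" for m
  have phi_h: "\<phi> m * h m = h m" for m
  proof (cases "m = 0")
    case False
    have "h m = (\<Sum>x\<in>UNIV. cnj (\<chi> (inverse x) * \<chi> (1 + m * (inverse x)\<^sup>2)))"
      unfolding h_def by (rule sum_inverse[symmetric])
    also have "\<dots> = (\<Sum>x\<in>UNIV. cnj (\<chi> (inverse (m * x)) * \<chi> (1 + m * (inverse (m * x))\<^sup>2)))"
      using sum_scale[OF False, of "\<lambda>x. cnj (\<chi> (inverse x) * \<chi> (1 + m * (inverse x)\<^sup>2))"] by simp
    also have "\<dots> = (\<Sum>x\<in>UNIV. \<phi> m * cnj (\<chi> x * \<chi> (1 + m * x\<^sup>2)))"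
    proof (intro sum.cong refl)
      fix x
      show "cnj (\<chi> (inverse (m * x)) * \<chi> (1 + m * (inverse (m * x))\<^sup>2)) = \<phi> m * cnj (\<chi> x * \<chi> (1 + m * x\<^sup>2))"
      proof (cases "x = 0")
        case x: False
        have "1 + m * (inverse (m * x))\<^sup>2 = (1 + m * x\<^sup>2) / (m * x\<^sup>2)"
          using x False by (simp add: field_simps power2_eq_square)
        then have "cnj (\<chi> (inverse (m * x)) * \<chi> (1 + m * (inverse (m * x))\<^sup>2))
          = (\<chi> m * \<chi> m) * ((\<phi> x * \<chi> x) * cnj (\<chi> (1 + m * x\<^sup>2)))"
          by (simp add: chi_divide chi_inverse chi_mult chi_square mult_ac)
        then show ?thesis by (simp add: phi_mult_chi chi_mult_chi)
      qed auto
    qed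
    also have "\<dots> = \<phi> m * h m" by (simp only: h_def sum_distrib_left)
    finally show "\<phi> m * h m = h m" by simp
  qed (use sum_cnj_chi in \<open>simp add: h_def\<close>)
  have "(\<Sum>x\<in>UNIV. \<Sum>y\<in>UNIV. \<phi> (x * y) * cnj (\<chi> (x + y) * \<chi> (1 + x * y)))
    = (\<Sum>x\<in>UNIV. \<Sum>m\<in>UNIV. \<phi> m * cnj (\<chi> (1 + m) * (\<chi> x * \<chi> (1 + m * x\<^sup>2))))"
  proof (rule sum.cong[OF refl])
    fix x
    show "(\<Sum>y\<in>UNIV. \<phi> (x * y) * cnj (\<chi> (x + y) * \<chi> (1 + x * y)))
      = (\<Sum>m\<in>UNIV. \<phi> m * cnj (\<chi> (1 + m) * (\<chi> x * \<chi> (1 + m * x\<^sup>2))))"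
    proof (cases "x = 0")
      case False
      have "\<phi> (x * (x * m)) * cnj (\<chi> (x + x * m) * \<chi> (1 + x * (x * m)))
        = \<phi> m * cnj (\<chi> (1 + m) * (\<chi> x * \<chi> (1 + m * x\<^sup>2)))" for m
      proof -
        have "x + x * m = x * (1 + m)" "x * (x * m) = m * x\<^sup>2"
          by (simp_all add: power2_eq_square algebra_simps)
        then show ?thesis using False
          by (simp only: chi_mult phi_mult) (simp add: phi_power2 mult_ac)
      qed
      then show ?thesis
        using sum_scale[OF False, of "\<lambda>y. \<phi> (x * y) * cnj (\<chi> (x + y) * \<chi> (1 + x * y))"] by simp
    qed auto
  qed
  also have "\<dots> = (\<Sum>m\<in>UNIV. \<phi> m * f m)"
    by (subst sum.swap) (simp add: f_def h_def sum_distrib_left mult_ac)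
  also have "\<dots> = (\<Sum>m\<in>UNIV. f m * (1 + \<phi> m)) / 2"
  proof -
    have "\<phi> m * f m = f m" for m using phi_h[of m] by (simp add: f_def mult.left_commute)
    then have "f m * (1 + \<phi> m) = 2 * (\<phi> m * f m)" for m by (simp add: ring_distribs mult.commute)
    then have "(\<Sum>m\<in>UNIV. f m * (1 + \<phi> m)) = (\<Sum>m\<in>UNIV. 2 * (\<phi> m * f m))"
      by (intro sum.cong refl)
    also have "\<dots> = 2 * (\<Sum>m\<in>UNIV. \<phi> m * f m)" by (simp only: sum_distrib_left)
    finally show ?thesis by simp
  qed
  also have "\<dots> = (\<Sum>n\<in>UNIV. f (n\<^sup>2)) / 2" by (simp add: sum_squares)
  also have "(\<Sum>n\<in>UNIV. f (n\<^sup>2)) = (\<Sum>n\<in>UNIV. \<chi> n * cnj (\<chi> (1 + n\<^sup>2)) * (2 * J))"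
  proof (intro sum.cong refl)
    fix n
    show "f (n\<^sup>2) = \<chi> n * cnj (\<chi> (1 + n\<^sup>2)) * (2 * J)"
    proof (cases "n = 0")
      case False
      have "h (n\<^sup>2) = (\<Sum>x\<in>UNIV. \<chi> n * cnj (\<chi> (n * x) * \<chi> (1 + (n * x)\<^sup>2)))"
        using False by (simp add: h_def chi_mult power_mult_distrib flip: mult.assoc)
      also have "\<dots> = \<chi> n * (2 * J)"
        using sum_scale[OF False, of "\<lambda>x. cnj (\<chi> x * \<chi> (1 + x\<^sup>2))"] sum_chi_inverse_quartic
        by (simp flip: sum_distrib_left)
      finally show ?thesis by (simp add: f_def mult_ac)
    qed (use phi_h[of 0] in \<open>auto simp: f_def\<close>)
  qed
  also have "\<dots> / 2 = R * J" by (simp add: R_def flip: sum_distrib_right)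
  finally show ?thesis .
qed

text \<open>In the expanded F * J^2 the sums over x and y are moved inside, where
  \<open>sum_chi_conic\<close> evaluates them; terms with k l = 0 vanish. The factor q produced this
  way is J^2 again and cancels.\<close>

lemma F_eq: "F = R * J"
proof -
  let ?q = "of_nat CARD('a) :: complex"
  have "F * J\<^sup>2 = (\<Sum>x\<in>UNIV. \<Sum>y\<in>UNIV. \<Sum>k\<in>UNIV. \<Sum>l\<in>UNIV.
      cnj (\<chi> k * \<chi> l * \<chi> (k * (1 - x\<^sup>2) + l * (1 - y\<^sup>2) + (x + y))))"
    unfolding sum_chi_three_linear F_def by (simp add: sum_distrib_right)
  also have "\<dots> = (\<Sum>k\<in>UNIV. \<Sum>l\<in>UNIV. \<Sum>x\<in>UNIV. \<Sum>y\<in>UNIV.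
      cnj (\<chi> k * \<chi> l * \<chi> (k * (1 - x\<^sup>2) + l * (1 - y\<^sup>2) + (x + y))))"
    (is "_ = (\<Sum>k\<in>_. \<Sum>l\<in>_. \<Sum>x\<in>_. \<Sum>y\<in>_. ?f k l x y)")
  proof -
    have "(\<Sum>x\<in>UNIV. \<Sum>y\<in>UNIV. \<Sum>k\<in>UNIV. \<Sum>l\<in>UNIV. ?f k l x y)
      = (\<Sum>x\<in>UNIV. \<Sum>k\<in>UNIV. \<Sum>y\<in>UNIV. \<Sum>l\<in>UNIV. ?f k l x y)"
      by (intro sum.cong refl sum.swap)
    also have "\<dots> = (\<Sum>k\<in>UNIV. \<Sum>x\<in>UNIV. \<Sum>y\<in>UNIV. \<Sum>l\<in>UNIV. ?f k l x y)"
      by (rule sum.swap)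
    also have "\<dots> = (\<Sum>k\<in>UNIV. \<Sum>x\<in>UNIV. \<Sum>l\<in>UNIV. \<Sum>y\<in>UNIV. ?f k l x y)"
      by (intro sum.cong refl sum.swap)
    also have "\<dots> = (\<Sum>k\<in>UNIV. \<Sum>l\<in>UNIV. \<Sum>x\<in>UNIV. \<Sum>y\<in>UNIV. ?f k l x y)"
      by (intro sum.cong refl sum.swap)
    finally show ?thesis .
  qed
  also have "\<dots> = (\<Sum>k\<in>UNIV. \<Sum>l\<in>UNIV. ?q * (\<phi> (k * l) * cnj (\<chi> (k + l) * \<chi> (1 + 4 * k * l))))"
  proof (intro sum.cong refl)
    fix k l :: 'a
    show "(\<Sum>x\<in>UNIV. \<Sum>y\<in>UNIV. ?f k l x y) = ?q * (\<phi> (k * l) * cnj (\<chi> (k + l) * \<chi> (1 + 4 * k * l)))"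
    proof (cases "k = 0 \<or> l = 0")
      case False
      have "(\<Sum>x\<in>UNIV. \<Sum>y\<in>UNIV. ?f k l x y) = cnj (\<chi> (k * l) *
          (\<Sum>x\<in>UNIV. \<Sum>y\<in>UNIV. \<chi> (k * (1 - x\<^sup>2) + l * (1 - y\<^sup>2) + (x + y))))"
        by (simp add: sum_distrib_left chi_mult mult_ac)
      also have "\<dots> = cnj ((\<chi> (k * l) * cnj (\<chi> (k * l))) * (?q * (\<phi> (k * l) * (\<chi> (k + l) * \<chi> (1 + 4 * k * l)))))"
        using False by (simp add: sum_chi_conic mult_ac)
      finally show ?thesis using False by simp
    qed auto
  qed
  \<comment> \<open>Writing the summand in 2 k and 2 l absorbs the 4, and \<chi> 2 = 1 leaves no
    other trace.\<close>
  also have "\<dots> = ?q * (\<Sum>k\<in>UNIV. \<Sum>l\<in>UNIV. \<phi> (2 * k * (2 * l)) * cnj (\<chi> (2 * k + 2 * l) * \<chi> (1 + 2 * k * (2 * l))))"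
  proof -
    have "\<phi> (2 * k * (2 * l)) * cnj (\<chi> (2 * k + 2 * l) * \<chi> (1 + 2 * k * (2 * l)))
      = \<phi> (k * l) * cnj (\<chi> (k + l) * \<chi> (1 + 4 * k * l))" for k l
    proof -
      have "2 * k + 2 * l = 2 * (k + l)" "2 * k * (2 * l) = 4 * k * l" by (simp_all add: algebra_simps)
      then show ?thesis by (simp only: chi_mult phi_mult) simp
    qed
    then show ?thesis by (simp add: sum_distrib_left)
  qed
  also have "\<dots> = ?q * (R * J)"
    unfolding sum_scale2[OF two_neq_0 two_neq_0, of "\<lambda>k l. \<phi> (k * l) * cnj (\<chi> (k + l) * \<chi> (1 + k * l))"]
      sum_symmetric_eq_R_J ..
  also have "\<dots> = (R * J) * J\<^sup>2"
    using J_mult_J by (simp add: power2_eq_square)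
  finally show ?thesis by simp
qed

end

subsection \<open>Determination of \<open>J\<close> and \<open>R\<close>\<close>

text \<open>\<open>f x\<close> stands for the orbit of x, below under z -> 1/z or under the group
  generated by w -> -w and w -> 1/w.\<close>

lemma dvd_card_of_orbits:
  assumes "finite S" and "\<And>x. x \<in> S \<Longrightarrow> f x \<subseteq> S \<and> x \<in> f x \<and> card (f x) = n"
    and "\<And>x y. x \<in> S \<Longrightarrow> y \<in> f x \<Longrightarrow> f y = f x"
  shows "n dvd card S"
proof -
  have "\<Union>(f ` S) = S" using assms(2) by auto
  moreover have "n dvd card (\<Union>(f ` S))"
  proof (rule dvd_partition)
    show "\<forall>c1\<in>f ` S. \<forall>c2\<in>f ` S. c1 \<noteq> c2 \<longrightarrow> c1 \<inter> c2 = {}"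
    proof (intro ballI impI)
      fix c1 c2 assume "c1 \<in> f ` S" "c2 \<in> f ` S" "c1 \<noteq> c2"
      then obtain x y where xy: "x \<in> S" "y \<in> S" "c1 = f x" "c2 = f y" by auto
      have False if "z \<in> f x" "z \<in> f y" for z
        using assms(3)[OF xy(1) that(1)] assms(3)[OF xy(2) that(2)] \<open>c1 \<noteq> c2\<close> xy by simp
      then show "c1 \<inter> c2 = {}" using xy by auto
    qed
    show "finite (\<Union>(f ` S))" using assms(1) \<open>\<Union>(f ` S) = S\<close> by simp
    show "\<forall>c\<in>f ` S. n dvd card c" using assms(2) by simp
  qed
  ultimately show ?thesis by simp
qed

text \<open>If n divides the number of negative terms, the sum is known modulo 2 n.\<close>

lemma sum_signs:
  fixes s :: "'b \<Rightarrow> complex"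
  assumes "finite A" "\<And>x. x \<in> A \<Longrightarrow> s x = 1 \<or> s x = -1"
  shows "(\<Sum>x\<in>A. s x) = of_int (int (card A) - 2 * int (card {x \<in> A. s x = -1}))"
proof -
  have "(\<Sum>x\<in>A. s x) = (\<Sum>x\<in>A. 1 - (if s x = -1 then 2 else 0))"
    using assms(2) by (intro sum.cong refl) fastforce
  also have "\<dots> = of_nat (card A) - (\<Sum>x\<in>{x \<in> A. s x = -1}. 2)"
    using assms(1) by (subst sum.inter_filter) (simp_all add: sum_subtractf)
  also have "\<dots> = of_nat (card A) - of_nat (card {x \<in> A. s x = -1}) * 2"
    by (simp only: sum_constant)
  finally show ?thesis by simp
qed

context quartic_character
begin

lemma one_neq_minus_one: "(1 :: 'a) \<noteq> -1"
  using two_neq_0 by (metis add.right_inverse one_add_one)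

lemma card_phi_eq_1: "card {x. \<phi> x = 1} = 2 * m"
proof -
  let ?P = "{x. \<phi> x = 1}" and ?N = "{x. \<phi> x = -1}"
  have U: "(UNIV :: 'a set) = insert 0 (?P \<union> ?N)" using phi_cases by auto
  have "CARD('a) = Suc (card (?P \<union> ?N))"
    by (subst U, subst card_insert_disjoint) auto
  also have "card (?P \<union> ?N) = card ?P + card ?N" by (intro card_Un_disjoint) auto
  finally have 1: "4 * m = card ?P + card ?N" by (simp add: card_eq)
  have "0 = (\<Sum>x\<in>?P \<union> ?N. \<phi> x)"
    using sum_phi by (subst (asm) U, subst (asm) sum.insert) auto
  also have "\<dots> = of_nat (card ?P) - of_nat (card ?N)"
    by (subst sum.union_disjoint) auto
  finally have "card ?P = card ?N" by simp
  with 1 show ?thesis by simp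
qed

text \<open>S equals its real part, and \<chi> x is purely imaginary where \<phi> x = -1. What
  remains is a sum over the squares, where \<chi> is a sign, so that terms can be counted in
  orbits.\<close>

lemma real_part_sum:
  assumes "S = (\<Sum>x\<in>UNIV. \<chi> x * s x)" "cnj S = S" "\<And>x. cnj (s x) = s x"
  shows "S = (\<Sum>x | \<phi> x = 1. \<chi> x * s x)"
proof -
  have "2 * S = S + cnj S" by (simp add: assms(2))
  also have "\<dots> = (\<Sum>x\<in>UNIV. (\<chi> x + cnj (\<chi> x)) * s x)"
    by (simp add: assms(1,3) ring_distribs sum.distrib)
  also have "\<dots> = (\<Sum>x\<in>{x. \<phi> x = 1}. (\<chi> x + cnj (\<chi> x)) * s x)"
  proof (rule sum.mono_neutral_right)
    show "\<forall>x\<in>UNIV - {x. \<phi> x = 1}. (\<chi> x + cnj (\<chi> x)) * s x = 0"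
    proof
      fix x assume "x \<in> UNIV - {x. \<phi> x = 1}"
      then show "(\<chi> x + cnj (\<chi> x)) * s x = 0"
        using chi_cases[of x] by (cases "x = 0") (auto simp: \<phi>_def)
    qed
  qed auto
  also have "\<dots> = (\<Sum>x\<in>{x. \<phi> x = 1}. 2 * (\<chi> x * s x))"
  proof (intro sum.cong refl)
    fix x assume "x \<in> {x. \<phi> x = 1}"
    then have "cnj (\<chi> x) = \<chi> x" using phi_mult_chi[of x] by simp
    then show "(\<chi> x + cnj (\<chi> x)) * s x = 2 * (\<chi> x * s x)" by simp
  qed
  also have "\<dots> = 2 * (\<Sum>x\<in>{x. \<phi> x = 1}. \<chi> x * s x)" by (simp only: sum_distrib_left)
  finally show ?thesis by simp
qed

lemma chi_sign: "\<phi> x = 1 \<Longrightarrow> \<chi> x = 1 \<or> \<chi> x = -1"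
  by (simp add: \<phi>_def power2_eq_1_iff)

lemma chi_inverse_sign: "\<phi> x = 1 \<Longrightarrow> \<chi> (inverse x) = \<chi> x"
  using chi_sign[of x] by (auto simp: chi_inverse)

lemma minus_p_power_mod_4: "(- int p) ^ t mod 4 = 1"
proof -
  have "(- int p) mod 4 = 1" using p_mod_4 by presburger
  then have "[- int p = 1] (mod 4)" by (simp add: cong_def)
  then have "[(- int p) ^ t = 1 ^ t] (mod 4)" by (rule cong_pow)
  then show ?thesis by (simp add: cong_def)
qed

lemma card_eq_minus_p_power: "int CARD('a) = ((- int p) ^ t)\<^sup>2"
  by (simp add: card_field power_mult mult.commute[of t] flip: power_mult)

text \<open>J is a sum of 2 m - 1 signs, and inversion pairs off the negative ones. As m is even, J
  is 3 modulo 4; since (-p)^t is 1 modulo 4, this selects the root -(-p)^t of J^2 = q.\<close>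

lemma J_eq: "J = - ((- of_nat p) ^ t)"
proof -
  define A where "A = {z. \<phi> z = 1} - {1}"
  define s where "s z = \<chi> z * \<phi> (1 - z)" for z
  define N where "N = {z \<in> A. s z = -1}"
  have "J = (\<Sum>z\<in>UNIV. \<chi> z * \<phi> (1 - z))"
    using sum_reflect[of "\<lambda>z. \<chi> (1 - z) * \<phi> z" 1] by (simp add: J_altdef)
  then have "J = (\<Sum>z | \<phi> z = 1. s z)"
    unfolding s_def by (rule real_part_sum) auto
  also have "\<dots> = (\<Sum>z\<in>A. s z)"
    by (rule sum.mono_neutral_right) (auto simp: A_def s_def)
  also have "\<dots> = of_int (int (card A) - 2 * int (card N))"
    unfolding N_def
  proof (rule sum_signs)
    fix z assume "z \<in> A"
    then show "s z = 1 \<or> s z = -1"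
      using chi_sign[of z] phi_cases[of "1 - z"] by (auto simp: A_def s_def)
  qed auto
  finally have J: "J = of_int (int (card A) - 2 * int (card N))" .
  have "card A = 2 * m - 1" by (simp add: A_def card_phi_eq_1)
  moreover have "2 dvd card N"
  proof (rule dvd_card_of_orbits)
    fix z assume z: "z \<in> N"
    then have phi: "\<phi> z = 1" "z \<noteq> 0" "z \<noteq> 1" by (auto simp: N_def A_def)
    \<comment> \<open>-1 is the fixed point of inversion other than 1; its term is \<phi> 2 = 1, so
      it is not a negative one.\<close>
    have "z \<noteq> -1" using z by (auto simp: N_def s_def)
    then have "inverse z \<noteq> z" using phi by (metis inverse_eq_imp_eq left_inverse mult.right_neutral power2_eq_1_iff power2_eq_square)
    moreover have "inverse z \<in> N"
    proof -
      have "1 - inverse z = - ((1 - z) / z)" using phi by (simp add: field_simps)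
      then have "\<phi> (1 - inverse z) = \<phi> (1 - z)" using phi by (simp add: phi_divide)
      then show ?thesis using z phi chi_inverse_sign[OF phi(1)]
        by (auto simp: N_def A_def s_def phi_inverse)
    qed
    ultimately show "{z, inverse z} \<subseteq> N \<and> z \<in> {z, inverse z} \<and> card {z, inverse z} = 2"
      using z by auto
  qed auto
  ultimately have "(int (card A) - 2 * int (card N)) mod 4 = 3"
    using m_even m_pos by presburger
  then obtain j :: int where j: "J = of_int j" "j mod 4 = 3" using J by metis
  have "of_int (j * j) = (of_int (int CARD('a)) :: complex)" using J_mult_J by (simp add: j)
  then have "j\<^sup>2 = ((- int p) ^ t)\<^sup>2"
    unfolding of_int_eq_iff card_eq_minus_p_power power2_eq_square .
  then have "j = (- int p) ^ t \<or> j = - ((- int p) ^ t)" by (simp add: power2_eq_iff)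
  then have "j = - ((- int p) ^ t)" using j(2) minus_p_power_mod_4 by auto
  then show ?thesis by (simp add: j)
qed

text \<open>A square root of -1 in the field, to which \<i> reduces up to sign.\<close>

definition I where "I = g ^ m"

lemma I_squared: "I\<^sup>2 = -1"
proof -
  have "(I\<^sup>2)\<^sup>2 = 1"
    using power_g_eq_1_iff[of "4 * m"] by (simp add: I_def card_eq mult.commute flip: power_mult)
  moreover have "I\<^sup>2 \<noteq> 1"
  proof
    assume "I\<^sup>2 = 1"
    then have "g ^ (2 * m) = 1" by (simp add: I_def mult.commute flip: power_mult)
    then have "4 * m dvd 2 * m" unfolding power_g_eq_1_iff by (simp add: card_eq)
    then show False using m_pos by (auto dest!: dvd_imp_le)
  qed
  ultimately show ?thesis by (metis power2_eq_1_iff)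
qed

text \<open>As 1 + y^2 = y (y + 1/y), the summand of R depends on y + 1/y only, so
  \<open>sum_plus_inverse\<close> applies; v = 2 w normalises the discriminant. The result has the
  shape that \<open>real_part_sum\<close> requires.\<close>

lemma R_altdef: "R = (\<Sum>w\<in>UNIV. \<chi> w * \<phi> (w\<^sup>2 - 1))"
proof -
  have "R = (\<Sum>y | y \<noteq> 0. \<chi> y * cnj (\<chi> (1 + y\<^sup>2)))"
    unfolding R_def by (rule sum.mono_neutral_right) auto
  also have "\<dots> = (\<Sum>y | y \<noteq> 0. cnj (\<chi> (y + inverse y)))"
  proof (intro sum.cong refl)
    fix y :: 'a assume "y \<in> {y. y \<noteq> 0}"
    then have "1 + y\<^sup>2 = y * (y + inverse y)" "y \<noteq> 0" by (simp_all add: power2_eq_square algebra_simps)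
    then show "\<chi> y * cnj (\<chi> (1 + y\<^sup>2)) = cnj (\<chi> (y + inverse y))"
      by (simp add: chi_mult flip: mult.assoc)
  qed
  also have "\<dots> = (\<Sum>v\<in>UNIV. cnj (\<chi> v) * (1 + \<phi> (v\<^sup>2 - 4)))"
    by (rule sum_plus_inverse)
  also have "\<dots> = (\<Sum>v\<in>UNIV. cnj (\<chi> v) * \<phi> (v\<^sup>2 - 4))"
    by (simp add: ring_distribs sum.distrib sum_cnj_chi)
  also have "\<dots> = (\<Sum>w\<in>UNIV. cnj (\<chi> (2 * w)) * \<phi> ((2 * w)\<^sup>2 - 4))"
    by (rule sum_scale[OF two_neq_0, symmetric])
  also have "\<dots> = (\<Sum>w\<in>UNIV. cnj (\<chi> w) * \<phi> (w\<^sup>2 - 1))"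
  proof (intro sum.cong refl)
    fix w :: 'a
    have "(2 * w)\<^sup>2 - 4 = 4 * (w\<^sup>2 - 1)" by (simp add: power2_eq_square algebra_simps)
    then show "cnj (\<chi> (2 * w)) * \<phi> ((2 * w)\<^sup>2 - 4) = cnj (\<chi> w) * \<phi> (w\<^sup>2 - 1)"
      by (simp only: chi_mult phi_mult) simp
  qed
  finally have "cnj R = (\<Sum>w\<in>UNIV. \<chi> w * \<phi> (w\<^sup>2 - 1))" by simp
  then show ?thesis by simp
qed

text \<open>On squares the summand of \<open>R_altdef\<close> is invariant under w -> -w and w ->
  1/w. The orbits have four elements except those of 1, where the summand is 0, and of I.\<close>

lemma R_eq_of_int: obtains r where "R = of_int r" "r mod 8 = 6"
proof -
  define A where "A = {w. \<phi> w = 1} - {1, -1}"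
  define s where "s w = \<chi> w * \<phi> (w\<^sup>2 - 1)" for w
  define N where "N = {w \<in> A. s w = -1}"
  define E where "E = {I, -I}"
  have "R = (\<Sum>w | \<phi> w = 1. s w)"
    unfolding s_def by (rule real_part_sum[OF R_altdef]) auto
  also have "\<dots> = (\<Sum>w\<in>A. s w)"
    by (rule sum.mono_neutral_right) (auto simp: A_def s_def)
  also have "\<dots> = of_int (int (card A) - 2 * int (card N))"
    unfolding N_def
  proof (rule sum_signs)
    fix w assume "w \<in> A"
    then show "s w = 1 \<or> s w = -1"
      using chi_sign[of w] phi_cases[of "w\<^sup>2 - 1"] by (auto simp: A_def s_def power2_eq_1_iff)
  qed auto
  finally have R: "R = of_int (int (card A) - 2 * int (card N))" .
  have cA: "card A = 2 * m - 2"
    using one_neq_minus_one by (simp add: A_def card_Diff_subset card_phi_eq_1)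
  have I: "I \<noteq> 0" "I \<noteq> -I" "I \<noteq> 1" "I \<noteq> -1" "- I \<noteq> 1" "- I \<noteq> -1"
  proof -
    show "I \<noteq> 0" by (simp add: I_def)
    then show "I \<noteq> -I" using two_neq_0 by (metis add.right_inverse mult_2 mult_eq_0_iff)
    have "I\<^sup>2 \<noteq> 1" using I_squared one_neq_minus_one by metis
    then show "I \<noteq> 1" "I \<noteq> -1" "- I \<noteq> 1" "- I \<noteq> -1"
      by (metis power2_eq_1_iff, metis power2_eq_1_iff, metis minus_minus power2_eq_1_iff,
          metis neg_equal_iff_equal power2_eq_1_iff)
  qed
  have chi_I: "\<chi> I = (-1) ^ (m div 2)"
  proof -
    obtain n where n: "m = 2 * n" using m_even by auto
    have "\<chi> I = (\<phi> g) ^ n" by (simp add: I_def chi_power n power_mult \<phi>_def)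
    then show ?thesis by (simp add: phi_g n)
  qed
  then have phi_I: "\<phi> I = 1" by (simp add: \<phi>_def flip: power_mult)
  have EA: "E \<subseteq> A" using I phi_I by (auto simp: E_def A_def)
  \<comment> \<open>Here w^2 - 1 = -2, on which \<phi> is 1.\<close>
  have sE: "s w = \<chi> I" if "w \<in> E" for w
  proof -
    have w: "w\<^sup>2 = -1" "\<chi> w = \<chi> I" using that I_squared by (auto simp: E_def)
    have "\<phi> (- 1 - 1) = 1" using phi_minus[of 2] by simp
    then show ?thesis by (simp only: s_def w mult_1_right)
  qed
  have four: "4 dvd card (N - E)"
  proof (rule dvd_card_of_orbits)
    let ?f = "\<lambda>w. {w, -w, inverse w, - inverse w}"
    have phi: "\<phi> w = 1" "w \<noteq> 0" "w \<noteq> 1" "w \<noteq> -1" if "w \<in> N" for w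
      using that by (auto simp: N_def A_def)
    have inv: "inverse w \<in> N - E" if "w \<in> N - E" for w
    proof -
      note phi = phi[of w]
      have "(inverse w)\<^sup>2 - 1 = - ((w\<^sup>2 - 1) / w\<^sup>2)" using phi that by (simp add: field_simps)
      then have "\<phi> ((inverse w)\<^sup>2 - 1) = \<phi> (w\<^sup>2 - 1)"
        using phi that by (simp add: phi_divide phi_power2)
      moreover have "inverse w \<noteq> 1" "inverse w \<noteq> -1"
        using phi that by (metis Diff_iff inverse_1 inverse_inverse_eq inverse_minus_eq)+
      moreover have "inverse w \<notin> E"
      proof
        assume "inverse w \<in> E"
        moreover have "inverse I = - I"
          using I_squared by (intro inverse_unique) (simp add: power2_eq_square)
        ultimately have "w \<in> E" unfolding E_def
          by (metis inverse_inverse_eq inverse_minus_eq insert_iff minus_minus singletonD)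
        then show False using that by simp
      qed
      moreover have "\<phi> w = 1" "s w = -1" using that phi by (auto simp: N_def)
      moreover have "\<chi> (inverse w) = \<chi> w" "\<phi> (inverse w) = 1"
        using \<open>\<phi> w = 1\<close> by (simp_all only: chi_inverse_sign phi_inverse)
      ultimately show ?thesis by (simp add: N_def A_def s_def)
    qed
    have neg: "- w \<in> N - E" if "w \<in> N - E" for w
    proof -
      have "- w \<notin> E" using that unfolding E_def by (metis Diff_iff insert_iff minus_minus singletonD)
      moreover have "- w \<noteq> 1" "- w \<noteq> -1" using phi that by (auto simp: minus_equation_iff)
      ultimately show ?thesis using that by (simp add: N_def A_def s_def)
    qed
    fix w assume w: "w \<in> N - E"
    have "w \<noteq> 0" using phi w by auto
    have "w \<noteq> -w" using \<open>w \<noteq> 0\<close> two_neq_0 by (metis add.right_inverse mult_2 mult_eq_0_iff)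
    moreover have "w \<noteq> inverse w"
    proof
      assume "w = inverse w"
      then have "w\<^sup>2 = 1" using \<open>w \<noteq> 0\<close> by (metis power2_eq_square right_inverse)
      then show False using phi w by (auto simp: power2_eq_1_iff)
    qed
    moreover have "w \<noteq> - inverse w"
    proof
      assume "w = - inverse w"
      then have "w * w = w * - inverse w" by simp
      then have "w\<^sup>2 = I\<^sup>2" using \<open>w \<noteq> 0\<close> I_squared by (simp add: power2_eq_square)
      then show False using w by (auto simp: power2_eq_iff E_def)
    qed
    moreover from calculation have "inverse w \<noteq> - inverse w" "-w \<noteq> inverse w" "-w \<noteq> - inverse w"
      by (metis inverse_eq_iff_eq inverse_minus_eq, metis minus_minus, metis minus_minus)
    ultimately have "card (?f w) = 4" by simp
    then show "?f w \<subseteq> N - E \<and> w \<in> ?f w \<and> card (?f w) = 4"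
      using w inv neg by auto
  qed auto
  have cE: "card E = 2" using I by (simp add: E_def)
  \<comment> \<open>The orbit of I is negative exactly when m / 2 is odd. Then 2 m = 4 (mod 8) and N
    has 2 modulo 4 elements; otherwise both are 0. Either way 2 m - 2 - 2 |N| is 6 modulo 8.\<close>
  have "(int (card A) - 2 * int (card N)) mod 8 = 6"
  proof (cases "even (m div 2)")
    case True
    then have "N - E = N" using sE chi_I by (auto simp: N_def)
    then show ?thesis using four cA m_even m_pos True by simp presburger
  next
    case False
    then have "E \<subseteq> N" using sE chi_I EA by (auto simp: N_def)
    then have "card N = card (N - E) + 2"
      using cE by (metis card_Diff_subset card_mono finite le_add_diff_inverse2)
    then show ?thesis using four cA m_even m_pos False by presburger
  qed
  then show ?thesis using R that by blast
qed

end

section \<open>Central binomial coefficients modulo p\<close>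

text \<open>One step of Legendre's formula: the multiples of p up to p M contribute p^M times M!,
  and all other factors are prime to p.\<close>

lemma fact_mult_prime:
  assumes "prime (p::nat)"
  obtains c where "fact (p * M) = p ^ M * fact M * c" "\<not> p dvd c"
proof -
  have "\<exists>c. fact (p * M) = p ^ M * fact M * c \<and> \<not> p dvd c"
  proof (induction M)
    case 0
    show ?case using assms by (intro exI[of _ 1]) auto
  next
    case (Suc M)
    then obtain c where c: "fact (p * M) = p ^ M * fact M * c" "\<not> p dvd c" by auto
    define d where "d = (\<Prod>i\<in>{p * M + 1..<p * Suc M}. i)"
    have p: "p > 0" using assms by (simp add: prime_gt_0_nat)
    have "\<not> p dvd i" if "i \<in> {p * M + 1..<p * Suc M}" for i
    proof
      assume "p dvd i"
      then obtain k where i: "i = p * k" ..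
      have "p * M < i" "i < p * Suc M" using that by (auto simp: Suc_le_eq)
      then have "p * M < p * k" "p * k < p * Suc M" by (simp_all only: i)
      then have "M < k" "k < Suc M" using p by (simp_all only: mult_less_cancel1)
      then show False by simp
    qed
    then have "\<not> p dvd d" unfolding d_def prime_dvd_prod_iff[OF finite_atLeastLessThan assms]
      by blast
    have "{1..p * Suc M} = {1..p * M} \<union> insert (p * Suc M) {p * M + 1..<p * Suc M}"
      using p by auto
    then have "fact (p * Suc M) = \<Prod>({1..p * M} \<union> insert (p * Suc M) {p * M + 1..<p * Suc M})"
      by (simp only: fact_prod of_nat_id)
    also have "\<dots> = \<Prod>{1..p * M} * \<Prod>(insert (p * Suc M) {p * M + 1..<p * Suc M})"
      using p by (intro prod.union_disjoint) auto
    also have "\<dots> = fact (p * M) * (p * Suc M * d)"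
      by (subst prod.insert) (auto simp: d_def fact_prod)
    finally have "fact (p * Suc M) = p ^ Suc M * fact (Suc M) * (c * d)"
      by (simp only: c(1)) (simp add: algebra_simps)
    moreover have "\<not> p dvd c * d" using c \<open>\<not> p dvd d\<close> assms by (simp add: prime_dvd_mult_iff)
    ultimately show ?case by blast
  qed
  then show ?thesis using that by blast
qed

lemma fact_mult_add_prime:
  assumes "prime (p::nat)" "r < p"
  obtains c where "fact (p * M + r) = p ^ M * fact M * c" "\<not> p dvd c"
proof -
  obtain c where c: "fact (p * M) = p ^ M * fact M * c" "\<not> p dvd c"
    using fact_mult_prime[OF assms(1)] by blast
  have "\<exists>c. fact (p * M + r) = p ^ M * fact M * c \<and> \<not> p dvd c"
    using assms(2)
  proof (induction r)
    case 0
    show ?case using c by auto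
  next
    case (Suc r)
    then obtain c where c: "fact (p * M + r) = p ^ M * fact M * c" "\<not> p dvd c" by auto
    have "\<not> p dvd (p * M + Suc r)"
      using Suc.prems by (auto simp: dvd_add_right_iff dest: dvd_imp_le simp del: add_Suc_right)
    then have "\<not> p dvd c * (p * M + Suc r)" using c assms(1) prime_dvd_mult_iff by blast
    moreover have "fact (p * M + Suc r) = p ^ M * fact M * (c * (p * M + Suc r))"
      using c(1) by (simp add: algebra_simps)
    ultimately show ?case by blast
  qed
  then show ?thesis using that by blast
qed

text \<open>The carry-free step of Kummer's theorem: as 2 r < p, removing the lowest digit r changes
  the coefficient only by factors prime to p, because the powers of p in the factorials
  cancel.\<close>

lemma prime_dvd_central_binomial_step:
  assumes "prime (p::nat)" "2 * r < p" "p dvd (2 * (p * M + r)) choose (p * M + r)"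
  shows "p dvd (2 * M) choose M"
proof -
  obtain c where c: "fact (p * M + r) = p ^ M * fact M * c" "\<not> p dvd c"
    using fact_mult_add_prime[OF assms(1), of r M] assms(2) by auto
  obtain d where d: "fact (p * (2 * M) + 2 * r) = p ^ (2 * M) * fact (2 * M) * d" "\<not> p dvd d"
    using fact_mult_add_prime[OF assms(1,2)] by blast
  have central: "fact (2 * n) = ((2 * n) choose n) * (fact n * fact n)" for n :: nat
    using binomial_fact_lemma[of n "2 * n"] by (simp add: mult_ac)
  have square: "p ^ (2 * M) = p ^ M * p ^ M" by (simp only: mult_2 power_add)
  have "p * (2 * M) + 2 * r = 2 * (p * M + r)" by simp
  then have "p ^ (2 * M) * (((2 * M) choose M) * (fact M * fact M)) * d
    = ((2 * (p * M + r)) choose (p * M + r)) * ((p ^ M * fact M * c) * (p ^ M * fact M * c))"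
    using d(1) central[of "p * M + r"] by (simp only: c(1) central[of M])
  then have "(p ^ (2 * M) * (fact M * fact M)) * (((2 * M) choose M) * d)
    = (p ^ (2 * M) * (fact M * fact M)) * (((2 * (p * M + r)) choose (p * M + r)) * (c * c))"
    using square by (simp only: mult_ac)
  then have "((2 * M) choose M) * d = ((2 * (p * M + r)) choose (p * M + r)) * (c * c)"
    using assms(1) by (auto simp: prime_gt_0_nat)
  then have "p dvd ((2 * M) choose M) * d" using assms(3) by simp
  then show ?thesis using assms(1) d(2) by (simp add: prime_dvd_mult_iff)
qed

text \<open>The digits of \<open>3 (p\<^bsup>2 t\<^esup> - 1) / 8\<close> in base \<open>p = 8 k + 3\<close> alternate between \<open>k\<close> and
  \<open>3 k + 1\<close>, so that doubling it produces no carries.\<close>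

lemma prime_not_dvd_central_binomial:
  assumes "prime p" "p mod 8 = 3" "8 * N = 3 * (p ^ (2 * t) - 1)"
  shows "\<not> p dvd (2 * N) choose N"
  using assms(3)
proof (induction t arbitrary: N)
  case 0
  then show ?case using assms(1) by auto
next
  case (Suc t)
  define k where "k = p div 8"
  have p: "p = 8 * k + 3" using assms(2) by (metis k_def mult_div_mod_eq)
  have "p\<^sup>2 mod 8 = 1" using assms(2) by (simp add: power_mod[symmetric, of p])
  then have "(p ^ (2 * t)) mod 8 = 1"
    by (metis power_mod power_mult power_one mod_less one_less_numeral_iff semiring_norm(76))
  then have "8 dvd p ^ (2 * t) - 1" by (metis dvd_minus_mod)
  then obtain L where L: "p ^ (2 * t) - 1 = 8 * L" by auto
  then have pL: "p ^ (2 * t) = 8 * L + 1" using assms(1) prime_gt_0_nat[of p] by (metis One_nat_def Suc_eq_plus1 Suc_pred' zero_less_power)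
  have "p ^ (2 * Suc t) = p * p * p ^ (2 * t)" by (simp add: power2_eq_square)
  \<comment> \<open>3 (p^2 - 1) / 8 = p (3 k + 1) + k, and both digits double to less than p = 8 k +
    3.\<close>
  then have "N = p * (p * (3 * L) + (3 * k + 1)) + k"
    using Suc.prems by (simp add: pL) (simp add: p algebra_simps)
  moreover have "\<not> p dvd (2 * (3 * L)) choose (3 * L)"
    by (rule Suc.IH) (use L in simp)
  ultimately show ?case
    using prime_dvd_central_binomial_step[OF assms(1), of k "p * (3 * L) + (3 * k + 1)"]
      prime_dvd_central_binomial_step[OF assms(1), of "3 * k + 1" "3 * L"] p by auto
qed

section \<open>Uniqueness of representations by the form u^2 + 2 v^2\<close>

text \<open>Composition gives q^2 = X^2 + 2 Y^2 with Y = u v' - e u' v for either sign e. The two Y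
  have product q (v'^2 - v^2), and p does not divide both, as it does not divide 2 u v'. So q
  divides one of them, which must then be 0, since otherwise 2 Y^2 > q^2.\<close>

lemma two_squares_form_unique:
  fixes u v u' v' :: int
  assumes p: "prime p" "odd p" and q: "q = p ^ n"
    and uv: "q = u\<^sup>2 + 2 * v\<^sup>2" "\<not> p dvd u" and uv': "q = u'\<^sup>2 + 2 * v'\<^sup>2" "\<not> p dvd u'"
  shows "u\<^sup>2 = u'\<^sup>2"
proof -
  have core: "u\<^sup>2 = u'\<^sup>2" if d: "q dvd u * v' - e * (u' * v)" and e: "e = 1 \<or> e = -1" for e :: int
  proof -
    have e2: "e * e = 1" using e by auto
    have "q * q = (u * u' + 2 * e * v * v')\<^sup>2 + 2 * (u * v' - e * (u' * v))\<^sup>2"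
    proof -
      have "q * q = (u\<^sup>2 + 2 * v\<^sup>2) * (u'\<^sup>2 + 2 * v'\<^sup>2)" using uv(1) uv'(1) by simp
      also have "\<dots> = (u * u' + 2 * e * v * v')\<^sup>2 + 2 * (u * v' - e * (u' * v))\<^sup>2"
        using e2 e by (auto simp: power2_eq_square algebra_simps)
      finally show ?thesis .
    qed
    moreover obtain s where s: "u * v' - e * (u' * v) = q * s" using d by auto
    moreover have q0: "q > 0" using p(1) q by (simp add: prime_gt_0_int)
    have "s = 0"
    proof (rule ccontr)
      assume "s \<noteq> 0"
      then have "1 \<le> s\<^sup>2" by (metis int_one_le_iff_zero_less zero_less_power2)
      then have "q\<^sup>2 * 2 \<le> 2 * (q * s)\<^sup>2" using q0 by (simp add: power_mult_distrib)
      then have "q * q * 2 \<le> q * q"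
        using calculation by (metis add_increasing order_refl power2_eq_square s zero_le_power2)
      then show False using q0 by (simp add: mult_le_0_iff)
    qed
    then have "u * v' = e * (u' * v)" using s by simp
    then have "(u * v') * (u * v') = (e * e) * ((u' * v) * (u' * v))" by (simp only: mult_ac)
    then have "u\<^sup>2 * v'\<^sup>2 = u'\<^sup>2 * v\<^sup>2" by (simp add: e2 power2_eq_square mult_ac)
    moreover have "u\<^sup>2 = q - 2 * v\<^sup>2" "u'\<^sup>2 = q - 2 * v'\<^sup>2" using uv uv' by auto
    ultimately have "q * v'\<^sup>2 = q * v\<^sup>2" by (simp add: algebra_simps)
    then have "v'\<^sup>2 = v\<^sup>2" using q0 by simp
    then show ?thesis using uv uv' by simp
  qed
  show ?thesis
  proof (cases "n = 0")
    case True
    then show ?thesis using core[of 1] q by simp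
  next
    case False
    then have pq: "p dvd q" using q by simp
    have pv': "\<not> p dvd v'"
    proof
      assume "p dvd v'"
      then have "p dvd q - 2 * v'\<^sup>2" using pq by (simp add: power2_eq_square)
      then have "p dvd u'\<^sup>2" using uv'(1) by simp
      then show False using uv'(2) p(1) prime_dvd_power by blast
    qed
    have "\<not> (p dvd u * v' - u' * v \<and> p dvd u * v' + u' * v)"
    proof
      assume "p dvd u * v' - u' * v \<and> p dvd u * v' + u' * v"
      then have "p dvd (u * v' - u' * v) + (u * v' + u' * v)" by (simp only: dvd_add)
      then have "p dvd 2 * (u * v')" by simp
      then have "p dvd 2" using p(1) uv(2) pv' by (simp add: prime_dvd_mult_iff)
      then have "p = 2" using p(1) using primes_dvd_imp_eq[of p 2] by simp
      then show False using p(2) by simp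
    qed
    then consider "coprime q (u * v' + u' * v)" | "coprime q (u * v' - u' * v)"
      using p(1) q by (metis coprime_power_left_iff prime_imp_coprime)
    moreover have prod: "q dvd (u * v' - u' * v) * (u * v' + u' * v)"
    proof -
      have "(u * v' - u' * v) * (u * v' + u' * v) = u\<^sup>2 * v'\<^sup>2 - u'\<^sup>2 * v\<^sup>2"
        by (simp add: power2_eq_square algebra_simps)
      also have "\<dots> = (q - 2 * v\<^sup>2) * v'\<^sup>2 - (q - 2 * v'\<^sup>2) * v\<^sup>2" using uv(1) uv'(1) by simp
      also have "\<dots> = q * (v'\<^sup>2 - v\<^sup>2)" by (simp add: algebra_simps)
      finally show ?thesis by simp
    qed
    ultimately show ?thesis
    proof cases
      case 1
      then have "q dvd u * v' - u' * v" using prod by (simp add: coprime_dvd_mult_left_iff)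
      then show ?thesis using core[of 1] by simp
    next
      case 2
      then have "q dvd u * v' + u' * v" using prod by (simp add: coprime_dvd_mult_right_iff)
      then show ?thesis using core[of "-1"] by simp
    qed
  qed
qed

context quartic_character
begin

section \<open>Reduction of R modulo p\<close>

lemma power_sum:
  assumes "k > 0"
  shows "(\<Sum>y\<in>UNIV. y ^ k) = (if (CARD('a) - 1) dvd k then -1 else (0 :: 'a))"
proof (cases "(CARD('a) - 1) dvd k")
  case True
  then obtain j where j: "k = (CARD('a) - 1) * j" by auto
  have "(\<Sum>y\<in>UNIV. y ^ k) = (\<Sum>y\<in>UNIV - {0}. y ^ k :: 'a)"
    using assms by (intro sum.mono_neutral_right) auto
  also have "\<dots> = (\<Sum>y\<in>UNIV - {0 :: 'a}. 1)"
    by (intro sum.cong refl) (simp only: j power_mult, simp add: power_card_minus_1[simplified])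
  also have "\<dots> = of_nat CARD('a) - 1" using card_gt_1 by (simp add: of_nat_diff)
  also have "of_nat CARD('a) = (0 :: 'a)"
    unfolding of_nat_eq_0_iff_char_dvd by (rule CHAR_dvd_CARD)
  finally show ?thesis using True by simp
next
  case False
  have "g ^ k * (\<Sum>y\<in>UNIV. y ^ k) = (\<Sum>y\<in>UNIV. y ^ k :: 'a)"
    using sum_scale[of g "\<lambda>y. y ^ k"] by (simp add: power_mult_distrib sum_distrib_left)
  then have "(g ^ k - 1) * (\<Sum>y\<in>UNIV. y ^ k) = 0" by (simp add: algebra_simps)
  then show ?thesis using False power_g_eq_1_iff[of k] by simp
qed

text \<open>Reduction modulo a prime above \<open>p\<close> turns \<open>\<chi> x\<close> into \<open>x\<^sup>m\<close>.\<close>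

lemma real_chi_sum_eq_power_sum:
  fixes f :: "'a \<Rightarrow> 'a"
  assumes "(\<Sum>y\<in>UNIV. \<chi> (f y)) = of_int r"
  shows "(\<Sum>y\<in>UNIV. f y ^ m) = of_int r"
proof -
  \<comment> \<open>On Z[i], \<theta> is a ring homomorphism to the field; the floors are exact
    there. The sign of i is chosen so that \<chi> g goes to g^m.\<close>
  define i where "i = (if \<chi> g = \<i> then I else - I)"
  define \<theta> where "\<theta> z = of_int \<lfloor>Re z\<rfloor> + of_int \<lfloor>Im z\<rfloor> * i" for z
  have i2: "i * i = -1" using I_squared by (auto simp: i_def power2_eq_square)
  have theta: "\<theta> (\<chi> x) = x ^ m" for x
  proof (cases "x = 0")
    case False
    then obtain k where "x = g ^ k" by (rule discrete_log)
    have "\<theta> (\<chi> (g ^ k)) = (g ^ k) ^ m"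
    proof (induction k)
      case 0
      show ?case by (simp add: \<theta>_def)
    next
      case (Suc k)
      have "\<theta> (\<chi> g * z) = I * \<theta> z" if "z \<in> {1, -1, \<i>, -\<i>}" for z
      proof -
        have "\<lfloor>- 1 :: real\<rfloor> = - 1" by linarith
        then show ?thesis using that chi_g_cases i2 by (auto simp: \<theta>_def i_def)
      qed
      then have "\<theta> (\<chi> (g ^ Suc k)) = I * \<theta> (\<chi> (g ^ k))"
        using chi_cases[of "g ^ k"] by (simp add: chi_mult)
      then show ?case using Suc by (simp add: I_def power_mult_distrib)
    qed
    then show ?thesis using \<open>x = g ^ k\<close> by simp
  qed (use m_pos in \<open>auto simp: \<theta>_def\<close>)
  have floor: "of_int \<lfloor>Re (\<chi> x)\<rfloor> = Re (\<chi> x)" "of_int \<lfloor>Im (\<chi> x)\<rfloor> = Im (\<chi> x)" for x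
  proof -
    have "\<chi> x \<in> {0, 1, -1, \<i>, -\<i>}" using chi_cases[of x] by (cases "x = 0") auto
    then have "Re (\<chi> x) \<in> \<int>" "Im (\<chi> x) \<in> \<int>" by auto
    then show "of_int \<lfloor>Re (\<chi> x)\<rfloor> = Re (\<chi> x)" "of_int \<lfloor>Im (\<chi> x)\<rfloor> = Im (\<chi> x)"
      by (metis Ints_cases floor_of_int)+
  qed
  have "(of_int (\<Sum>y\<in>UNIV. \<lfloor>Re (\<chi> (f y))\<rfloor>) :: real) = Re (of_int r)"
    by (simp add: floor flip: assms)
  then have re: "(\<Sum>y\<in>UNIV. \<lfloor>Re (\<chi> (f y))\<rfloor>) = r" by (simp only: complex_Re_of_int of_int_eq_iff)
  have "(of_int (\<Sum>y\<in>UNIV. \<lfloor>Im (\<chi> (f y))\<rfloor>) :: real) = Im (of_int r)"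
    by (simp add: floor flip: assms)
  then have im: "(\<Sum>y\<in>UNIV. \<lfloor>Im (\<chi> (f y))\<rfloor>) = 0" by (simp only: complex_Im_of_int of_int_eq_0_iff)
  have "(\<Sum>y\<in>UNIV. f y ^ m) = (\<Sum>y\<in>UNIV. \<theta> (\<chi> (f y)))" by (simp add: theta)
  also have "\<dots> = of_int (\<Sum>y\<in>UNIV. \<lfloor>Re (\<chi> (f y))\<rfloor>) + of_int (\<Sum>y\<in>UNIV. \<lfloor>Im (\<chi> (f y))\<rfloor>) * i"
    by (simp add: \<theta>_def sum.distrib sum_distrib_right)
  finally show ?thesis by (simp add: re im)
qed

text \<open>As the conjugate of \<chi> is its cube, R reduces to the sum of (y (1 + y^2)^3)^m. After
  expansion only exponents divisible by q - 1 = 4 m survive, with power sum -1. The exponents m + 2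
  j lie between m and 7 m, so only j = 3 m / 2 is left.\<close>

lemma R_mod_p:
  assumes "R = of_int r"
  shows "of_int r = - (of_nat ((3 * m) choose (3 * m div 2)) :: 'a)"
proof -
  have "R = (\<Sum>y\<in>UNIV. \<chi> (y * (1 + y\<^sup>2) ^ 3))"
    by (simp add: R_def chi_mult chi_cube[symmetric] chi_power)
  then have "of_int r = (\<Sum>y\<in>UNIV. (y * (1 + y\<^sup>2) ^ 3) ^ m :: 'a)"
    using real_chi_sum_eq_power_sum[of "\<lambda>y. y * (1 + y\<^sup>2) ^ 3" r] assms by simp
  also have "\<dots> = (\<Sum>y\<in>UNIV. \<Sum>j\<le>3 * m. of_nat ((3 * m) choose j) * y ^ (m + 2 * j))"
  proof (rule sum.cong[OF refl])
    fix y :: 'a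
    have "(y * (1 + y\<^sup>2) ^ 3) ^ m = y ^ m * (y\<^sup>2 + 1) ^ (3 * m)"
      by (simp add: power_mult_distrib power_mult add.commute)
    also have "\<dots> = (\<Sum>j\<le>3 * m. of_nat ((3 * m) choose j) * y ^ (m + 2 * j))"
    proof -
      have "y ^ (m + 2 * j) = y ^ m * (y\<^sup>2) ^ j" for j by (simp only: power_add power_mult)
      then show ?thesis unfolding binomial_ring sum_distrib_left by (simp add: mult_ac)
    qed
    finally show "(y * (1 + y\<^sup>2) ^ 3) ^ m = (\<Sum>j\<le>3 * m. of_nat ((3 * m) choose j) * y ^ (m + 2 * j))" .
  qed
  also have "\<dots> = (\<Sum>j\<le>3 * m. of_nat ((3 * m) choose j) * (\<Sum>y\<in>UNIV. y ^ (m + 2 * j)))"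
    by (subst sum.swap) (simp add: sum_distrib_left)
  also have "\<dots> = (\<Sum>j\<le>3 * m. if j = 3 * m div 2 then - of_nat ((3 * m) choose j) else 0)"
  proof (rule sum.cong[OF refl])
    fix j assume "j \<in> {..3 * m}"
    have "4 * m dvd m + 2 * j \<longleftrightarrow> j = 3 * m div 2"
    proof
      assume "4 * m dvd m + 2 * j"
      then obtain c where c: "m + 2 * j = 4 * m * c" ..
      have "m + 2 * j < 4 * m * 2" using \<open>j \<in> {..3 * m}\<close> m_pos by simp
      then have "c < 2" unfolding c using m_pos by simp
      moreover have "c \<noteq> 0" using c m_pos by (intro notI) simp
      ultimately have "c = 1" by simp
      then show "j = 3 * m div 2" using c by simp
    next
      assume "j = 3 * m div 2"
      then have "m + 2 * j = 4 * m" using m_even by auto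
      then show "4 * m dvd m + 2 * j" by simp
    qed
    then show "of_nat ((3 * m) choose j) * (\<Sum>y\<in>UNIV. y ^ (m + 2 * j) :: 'a)
      = (if j = 3 * m div 2 then - of_nat ((3 * m) choose j) else 0)"
      using m_pos by (simp add: power_sum card_eq)
  qed
  also have "\<dots> = - of_nat ((3 * m) choose (3 * m div 2))"
    by (subst sum.delta) auto
  finally show ?thesis .
qed

text \<open>For m = 2 n the coefficient in \<open>R_mod_p\<close> is central, and 3 n = 3 (q - 1) /
  8 is the number whose digits were determined above.\<close>

lemma p_not_dvd_R:
  assumes "R = of_int r" "p mod 8 = 3"
  shows "\<not> int p dvd r"
proof
  assume "int p dvd r"
  then have "(of_int r :: 'a) = 0" using CHAR_eq of_int_eq_0_iff_char_dvd[where 'a = 'a, of r] by simp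
  then have "of_nat ((3 * m) choose (3 * m div 2)) = (0 :: 'a)" using R_mod_p[OF assms(1)] by simp
  then have "p dvd (3 * m) choose (3 * m div 2)"
    unfolding of_nat_eq_0_iff_char_dvd CHAR_eq .
  moreover obtain n where n: "m = 2 * n" using m_even by auto
  have "8 * (3 * n) = 3 * (p ^ (2 * t) - 1)" using card_eq card_field n by simp
  then have "\<not> p dvd (2 * (3 * n)) choose (3 * n)"
    by (rule prime_not_dvd_central_binomial[OF prime_p assms(2)])
  ultimately show False by (simp add: n)
qed

section \<open>The norm equation for R\<close>

text \<open>Deforms R by a parameter c. For c nonzero, S c depends up to a unit only on the square
  class of c, so R = S 1 and S g represent the family.\<close>

definition S where "S c = (\<Sum>y\<in>UNIV. \<chi> y * cnj (\<chi> (1 + c * y\<^sup>2)))" for c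

lemma S_mult_square: "k \<noteq> 0 \<Longrightarrow> S (c * k\<^sup>2) = cnj (\<chi> k) * S c"
proof -
  assume k: "k \<noteq> 0"
  have "cnj (\<chi> k) * S c = cnj (\<chi> k) * (\<Sum>y\<in>UNIV. \<chi> (k * y) * cnj (\<chi> (1 + c * (k * y)\<^sup>2)))"
    unfolding S_def using sum_scale[OF k, of "\<lambda>y. \<chi> y * cnj (\<chi> (1 + c * y\<^sup>2))"] by simp
  also have "\<dots> = S (c * k\<^sup>2)"
    unfolding S_def sum_distrib_left using k
    by (intro sum.cong refl) (simp add: chi_mult power_mult_distrib mult.assoc flip: mult.assoc[of "cnj (\<chi> k)"])
  finally show ?thesis ..
qed

lemma S_1: "S 1 = R"
  by (simp add: S_def R_def)

lemma sum_linear_ratio: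
  assumes "a \<noteq> 0" "b \<noteq> 0"
  shows "(\<Sum>c\<in>UNIV. \<chi> (1 + c * b) * cnj (\<chi> (1 + c * a)))
    = \<chi> (b / a) * ((if a = b then of_nat CARD('a) else 0) - 1)"
proof -
  define s where "s = (a - b) / b"
  have "(\<Sum>c\<in>UNIV. \<chi> (1 + c * b) * cnj (\<chi> (1 + c * a)))
    = (\<Sum>u\<in>UNIV. \<chi> (b / a) * (\<chi> (u + s) * cnj (\<chi> u)))"
  proof (rule sum.reindex_bij_witness[where j = "\<lambda>c. 1 + c * a" and i = "\<lambda>u. (u - 1) / a"])
    fix c
    have "1 + c * b = b / a * (1 + c * a + s)" using assms by (simp add: s_def field_simps)
    then show "\<chi> (b / a) * (\<chi> (1 + c * a + s) * cnj (\<chi> (1 + c * a))) = \<chi> (1 + c * b) * cnj (\<chi> (1 + c * a))"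
      by (metis chi_mult mult.assoc)
  qed (use assms in auto)
  also have "\<dots> = \<chi> (b / a) * (\<Sum>u\<in>UNIV. \<chi> (u + s) * cnj (\<chi> u))" by (simp only: sum_distrib_left)
  also have "(\<Sum>u\<in>UNIV. \<chi> (u + s) * cnj (\<chi> u)) = (if a = b then of_nat CARD('a) else 0) - 1"
  proof (cases "a = b")
    case True
    have "(\<Sum>u\<in>UNIV. \<chi> u * cnj (\<chi> u)) = (\<Sum>u\<in>UNIV - {0}. \<chi> u * cnj (\<chi> u))"
      by (rule sum.mono_neutral_right) auto
    then show ?thesis using True card_gt_1 by (simp add: s_def of_nat_diff)
  next
    case False
    then have "s \<noteq> 0" using assms by (simp add: s_def)
    then have "cnj (\<Sum>u\<in>UNIV. \<chi> u * cnj (\<chi> (u + s))) = -1" using sum_chi_cnj_shift by simp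
    then show ?thesis using False by (simp add: mult.commute)
  qed
  finally show ?thesis .
qed

text \<open>Second moment of the family. Summing over c first leaves the pairs w = y and w = -y,
  with total 8 m q. On the other side, the norm of S c has one value on the 2 m nonzero squares and
  one on the 2 m nonsquares, and S 0 = 0.\<close>

lemma R_norm_S_norm: "R\<^sup>2 + S g * cnj (S g) = 4 * of_nat CARD('a)"
proof -
  let ?q = "of_nat CARD('a) :: complex"
  have "(\<Sum>c\<in>UNIV. S c * cnj (S c)) = (\<Sum>c\<in>UNIV. \<Sum>y\<in>UNIV. \<Sum>w\<in>UNIV.
      \<chi> y * cnj (\<chi> w) * (\<chi> (1 + c * w\<^sup>2) * cnj (\<chi> (1 + c * y\<^sup>2))))"
    by (simp add: S_def sum_product mult_ac)
  also have "\<dots> = (\<Sum>y\<in>UNIV. \<Sum>w\<in>UNIV. \<chi> y * cnj (\<chi> w) * (\<Sum>c\<in>UNIV. \<chi> (1 + c * w\<^sup>2) * cnj (\<chi> (1 + c * y\<^sup>2))))"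
    unfolding sum_distrib_left by (subst sum.swap, rule sum.cong[OF refl], rule sum.swap)
  also have "\<dots> = (\<Sum>y\<in>UNIV. \<Sum>w\<in>UNIV. cnj (\<chi> y) * \<chi> w * ((if w\<^sup>2 = y\<^sup>2 then ?q else 0) - 1))"
  proof (intro sum.cong refl)
    fix y w
    show "\<chi> y * cnj (\<chi> w) * (\<Sum>c\<in>UNIV. \<chi> (1 + c * w\<^sup>2) * cnj (\<chi> (1 + c * y\<^sup>2)))
      = cnj (\<chi> y) * \<chi> w * ((if w\<^sup>2 = y\<^sup>2 then ?q else 0) - 1)"
    proof (cases "y = 0 \<or> w = 0")
      case False
      then have "(\<Sum>c\<in>UNIV. \<chi> (1 + c * w\<^sup>2) * cnj (\<chi> (1 + c * y\<^sup>2)))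
        = \<phi> w * \<phi> y * ((if w\<^sup>2 = y\<^sup>2 then ?q else 0) - 1)"
        by (subst sum_linear_ratio) (auto simp: chi_divide chi_square)
      then have "\<chi> y * cnj (\<chi> w) * (\<Sum>c\<in>UNIV. \<chi> (1 + c * w\<^sup>2) * cnj (\<chi> (1 + c * y\<^sup>2)))
        = (\<phi> y * \<chi> y) * (\<phi> w * cnj (\<chi> w)) * ((if w\<^sup>2 = y\<^sup>2 then ?q else 0) - 1)"
        by (simp only: mult_ac)
      then show ?thesis by (simp only: phi_mult_chi phi_mult_cnj_chi)
    qed auto
  qed
  \<comment> \<open>The -1 drops out because \<chi> w sums to 0 over w.\<close>
  also have "\<dots> = (\<Sum>y\<in>UNIV. \<Sum>w\<in>UNIV. if w\<^sup>2 = y\<^sup>2 then ?q * (cnj (\<chi> y) * \<chi> w) else 0)"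
  proof (rule sum.cong[OF refl])
    fix y
    have "(\<Sum>w\<in>UNIV. cnj (\<chi> y) * \<chi> w * ((if w\<^sup>2 = y\<^sup>2 then ?q else 0) - 1))
      = (\<Sum>w\<in>UNIV. (if w\<^sup>2 = y\<^sup>2 then ?q * (cnj (\<chi> y) * \<chi> w) else 0) - cnj (\<chi> y) * \<chi> w)"
      by (intro sum.cong refl) (simp add: algebra_simps)
    then show "(\<Sum>w\<in>UNIV. cnj (\<chi> y) * \<chi> w * ((if w\<^sup>2 = y\<^sup>2 then ?q else 0) - 1))
      = (\<Sum>w\<in>UNIV. if w\<^sup>2 = y\<^sup>2 then ?q * (cnj (\<chi> y) * \<chi> w) else 0)"
      by (simp add: sum_subtractf sum_chi flip: sum_distrib_left)
  qed
  also have "\<dots> = (\<Sum>y\<in>(UNIV :: 'a set). if y = 0 then 0 else 2 * ?q)"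
  proof (rule sum.cong[OF refl])
    fix y
    have "(\<Sum>w\<in>UNIV. if w\<^sup>2 = y\<^sup>2 then ?q * (cnj (\<chi> y) * \<chi> w) else 0)
      = (\<Sum>w | w\<^sup>2 = y\<^sup>2. ?q * (cnj (\<chi> y) * \<chi> w))"
      by (simp add: sum.If_cases)
    also have "\<dots> = (\<Sum>w | w\<^sup>2 = y\<^sup>2. ?q * (cnj (\<chi> y) * \<chi> y))"
      by (intro sum.cong refl) (auto simp: power2_eq_iff)
    also have "\<dots> = (1 + \<phi> (y\<^sup>2)) * (?q * (cnj (\<chi> y) * \<chi> y))"
      by (simp only: sum_constant card_sqrt)
    also have "\<dots> = (if y = 0 then 0 else 2 * ?q)" by (simp add: phi_power2)
    finally show "(\<Sum>w\<in>UNIV. if w\<^sup>2 = y\<^sup>2 then ?q * (cnj (\<chi> y) * \<chi> w) else 0) = (if y = 0 then 0 else 2 * ?q)" .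
  qed
  also have "\<dots> = (\<Sum>y\<in>UNIV - {0 :: 'a}. 2 * ?q)"
    by (rule sum.mono_neutral_cong_right) auto
  also have "\<dots> = 2 * of_nat m * (4 * ?q)" by (simp add: card_eq)
  finally have 1: "(\<Sum>c\<in>UNIV. S c * cnj (S c)) = 2 * of_nat m * (4 * ?q)" .
  have sq: "S (d * k\<^sup>2) * cnj (S (d * k\<^sup>2)) = S d * cnj (S d)" if "k \<noteq> 0" for d k
  proof -
    have "S (d * k\<^sup>2) * cnj (S (d * k\<^sup>2)) = (\<chi> k * cnj (\<chi> k)) * (S d * cnj (S d))"
      by (simp only: S_mult_square[OF that] complex_cnj_mult complex_cnj_cnj mult_ac)
    then show ?thesis using that by simp
  qed
  \<comment> \<open>The coefficients are the indicators of squares and nonsquares, in a form that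
    can be summed with \<open>sum_phi\<close>.\<close>
  have "S c * cnj (S c) = (1 + \<phi> c) / 2 * R\<^sup>2 + (1 - \<phi> c) / 2 * (S g * cnj (S g))" if c: "c \<noteq> 0" for c
  proof (cases "\<phi> c = 1")
    case True
    then obtain k where "c = 1 * k\<^sup>2" using phi_eq_1_iff[OF c] by auto
    then have "k \<noteq> 0" "S c * cnj (S c) = S 1 * cnj (S 1)" using sq[of k 1] c by auto
    then show ?thesis using True by (simp add: S_1 power2_eq_square)
  next
    case False
    then have phi: "\<phi> c = -1" using phi_cases[OF c] by simp
    then have "\<phi> (c / g) = 1" by (simp add: phi_divide phi_g)
    then obtain k where "c / g = k\<^sup>2" using phi_eq_1_iff[of "c / g"] c by auto
    then have ck: "c = g * k\<^sup>2" by (simp add: field_simps)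
    then have "k \<noteq> 0" using c by auto
    then have "S c * cnj (S c) = S g * cnj (S g)" unfolding ck by (rule sq)
    then show ?thesis by (simp add: phi)
  qed
  note nonzero = this
  have "S 0 = 0" by (simp add: S_def sum_chi)
  have "S c * cnj (S c) = (1 + \<phi> c) / 2 * R\<^sup>2 + (1 - \<phi> c) / 2 * (S g * cnj (S g))
      - (if c = 0 then (R\<^sup>2 + S g * cnj (S g)) / 2 else 0)" for c
  proof (cases "c = 0")
    case True
    then show ?thesis using \<open>S 0 = 0\<close> by (simp add: field_simps)
  next
    case False
    show ?thesis unfolding nonzero[OF False] using False by simp
  qed
  then have "(\<Sum>c\<in>UNIV. S c * cnj (S c)) = (\<Sum>c\<in>UNIV. (1 + \<phi> c) / 2 * R\<^sup>2 + (1 - \<phi> c) / 2 * (S g * cnj (S g))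
      - (if c = 0 then (R\<^sup>2 + S g * cnj (S g)) / 2 else 0))"
    by (intro sum.cong refl)
  also have "\<dots> = ?q / 2 * R\<^sup>2 + ?q / 2 * (S g * cnj (S g)) - (R\<^sup>2 + S g * cnj (S g)) / 2"
  proof -
    have "(\<Sum>c\<in>UNIV. (1 + \<phi> c) / 2 * z) = ?q / 2 * z"
      and "(\<Sum>c\<in>UNIV. (1 - \<phi> c) / 2 * z) = ?q / 2 * z" for z
      by (simp_all only: sum_distrib_right[symmetric] sum_divide_distrib[symmetric] sum.distrib sum_subtractf sum_phi)
        simp_all
    then show ?thesis by (simp only: sum_subtractf sum.distrib) simp
  qed
  also have "\<dots> = 2 * of_nat m * (R\<^sup>2 + S g * cnj (S g))"
    by (simp add: card_eq field_simps)
  finally have "2 * of_nat m * (R\<^sup>2 + S g * cnj (S g)) = 2 * of_nat m * (4 * ?q)"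
    unfolding 1 by (rule sym)
  moreover have "2 * of_nat m \<noteq> (0 :: complex)" using m_pos by simp
  ultimately show ?thesis by (metis mult_left_cancel)
qed

text \<open>By Frobenius the conjugate of S g is S (g^p), and g^p = g k^2 is in the square class of
  g. The resulting factor is \<i> or -\<i>, as (p - 1) / 2 is odd. So S g lies on a diagonal of the
  complex plane, and its norm is twice the square of its real part, an integer.\<close>

lemma norm_S_g: obtains a :: int where "S g * cnj (S g) = 2 * (of_int a)\<^sup>2"
proof -
  define k where "k = g ^ ((p - 1) div 2)"
  have "2 * ((p - 1) div 2) + 1 = p" using p_odd by presburger
  then have "g ^ p = g * k\<^sup>2" unfolding k_def by (metis mult.commute power_Suc Suc_eq_plus1 power_mult)
  have "cnj (S g) = (\<Sum>y\<in>UNIV. \<chi> (y ^ p) * cnj (\<chi> (1 + g ^ p * (y ^ p)\<^sup>2)))"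
  proof -
    have "1 + g ^ p * (y ^ p)\<^sup>2 = (1 + g * y\<^sup>2) ^ p" for y
      by (simp add: frob_add power_mult_distrib mult.commute flip: power_mult)
    then show ?thesis by (simp add: S_def chi_frob)
  qed
  also have "\<dots> = S (g ^ p)"
    unfolding S_def by (rule sum_frob)
  also have "\<dots> = cnj (\<chi> k) * S g"
    unfolding \<open>g ^ p = g * k\<^sup>2\<close> by (rule S_mult_square) (simp add: k_def)
  finally have cnj_S: "cnj (S g) = cnj (\<chi> k) * S g" .
  have "odd ((p - 1) div 2)" using p_mod_4 by presburger
  then have "\<phi> k = -1" by (simp add: k_def \<phi>_def chi_power mult.commute flip: power_mult)
      (simp add: power_mult phi_g[unfolded \<phi>_def])
  then have "\<chi> k = \<i> \<or> \<chi> k = -\<i>" using chi_cases[of k] by (auto simp: \<phi>_def k_def)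
  then have im: "Im (S g) = Re (S g) \<or> Im (S g) = - Re (S g)"
    using cnj_S by (auto simp: complex_eq_iff)
  have "Re (S g) \<in> \<int>"
  proof -
    have "Re (\<chi> y * cnj (\<chi> (1 + g * y\<^sup>2))) \<in> \<int>" for y
      using chi_cases[of "y / (1 + g * y\<^sup>2)"]
      by (cases "y / (1 + g * y\<^sup>2) = 0") (auto simp flip: chi_divide)
    then show ?thesis unfolding S_def Re_sum by (intro Ints_sum) auto
  qed
  then obtain a where a: "Re (S g) = of_int a" by (auto elim: Ints_cases)
  have "S g * cnj (S g) = of_real ((Re (S g))\<^sup>2 + (Im (S g))\<^sup>2)"
    by (simp add: complex_mult_cnj)
  also have "\<dots> = 2 * (of_int a)\<^sup>2" using im a by auto
  finally show ?thesis by (rule that)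
qed

section \<open>The form u^2 + 2 v^2 at inert primes, and the value of R\<close>

text \<open>For \<open>p \<equiv> 7 (mod 8)\<close> the sum of a primitive eighth root of unity and its inverse is a square
  root of 2 in the prime field, while \<open>-1\<close> is not a square there.\<close>

lemma prime_dvd_form:
  assumes "p mod 8 = 7" "int p dvd u\<^sup>2 + 2 * v\<^sup>2"
  shows "int p dvd u \<and> int p dvd v"
proof -
  obtain n where n: "m = 2 * n" using m_even by auto
  define z where "z = g ^ n"
  have zI: "z\<^sup>2 = I" by (simp add: z_def I_def n mult.commute flip: power_mult)
  have z4: "z ^ 4 = -1" using I_squared by (simp add: zI[symmetric] flip: power_mult)
  have z0: "z \<noteq> 0" by (simp add: z_def)
  define s where "s = z + inverse z"
  have "s\<^sup>2 = z\<^sup>2 + 2 + inverse (z\<^sup>2)" using z0 by (simp add: s_def power2_eq_square algebra_simps)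
  moreover have "inverse (z\<^sup>2) = - z\<^sup>2"
    using z4 by (intro inverse_unique) (simp flip: power_add)
  ultimately have s2: "s\<^sup>2 = 2" by simp
  have zp: "z ^ p = inverse z"
  proof -
    have "p + 1 = 8 * (p div 8 + 1)" using assms(1) by presburger
    then have "z ^ (p + 1) = z ^ (8 * (p div 8 + 1))" by (simp only:)
    then have "z ^ p * z = (z ^ 8) ^ (p div 8 + 1)" by (simp only: power_add power_one_right power_mult)
    also have "z ^ 8 = (z ^ 4)\<^sup>2" by (simp flip: power_mult)
    finally have "z ^ p * z = 1" by (simp add: z4)
    then show ?thesis using z0 by (metis mult.commute inverse_unique)
  qed
  have sp: "s ^ p = s" by (simp add: s_def frob_add power_inverse zp add.commute)
  have intp: "(of_int x :: 'a) ^ p = of_int x" for x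
  proof -
    have "(of_nat k :: 'a) ^ p = of_nat k" for k
      by (induction k) (use prime_gt_0_nat[OF prime_p] in \<open>simp_all add: frob_add\<close>)
    then show ?thesis by (cases x rule: int_cases2) (simp_all add: frob_minus)
  qed
  have dvd: "int p dvd x \<longleftrightarrow> (of_int x :: 'a) = 0" for x
    using of_int_eq_0_iff_char_dvd[where 'a = 'a, of x] by (simp add: CHAR_eq)
  have uv: "(of_int u)\<^sup>2 + 2 * (of_int v)\<^sup>2 = (0 :: 'a)"
    using assms(2) by (simp add: dvd)
  have "of_int v = (0 :: 'a)"
  proof (rule ccontr)
    assume v: "of_int v \<noteq> (0 :: 'a)"
    \<comment> \<open>w would be a square root of -1 that is fixed by Frobenius, hence in the prime
      field.\<close>
    define w where "w = of_int u / (s * of_int v)"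
    have "s \<noteq> 0" using s2 two_neq_0 by auto
    have "(of_int u)\<^sup>2 = - (2 * (of_int v)\<^sup>2 :: 'a)" using uv by (simp add: eq_neg_iff_add_eq_0)
    then have "w\<^sup>2 = I\<^sup>2"
      using v two_neq_0 by (simp add: w_def power_divide power_mult_distrib s2 I_squared)
    then have "w = I \<or> w = - I" by (simp add: power2_eq_iff)
    moreover have "w ^ p = w" by (simp add: w_def power_divide power_mult_distrib sp intp)
    ultimately have "I ^ p = I" by (auto simp: frob_minus)
    moreover have "I ^ p = - I"
    proof -
      have "I ^ p = (z ^ p)\<^sup>2" by (simp add: zI[symmetric] mult.commute flip: power_mult)
      then show ?thesis using \<open>inverse (z\<^sup>2) = - z\<^sup>2\<close> by (simp add: zp zI power_inverse)
    qed
    ultimately have "2 * I = 0" by simp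
    then show False using two_neq_0 by (simp add: I_def)
  qed
  then show ?thesis using uv by (simp add: dvd)
qed

text \<open>Descent: p divides both coordinates by \<open>prime_dvd_form\<close>, so p^2 can be
  cancelled until the form has value 1.\<close>

lemma form_inert:
  assumes "p mod 8 = 7"
  shows "u\<^sup>2 + 2 * v\<^sup>2 = int p ^ (2 * k) \<Longrightarrow> u\<^sup>2 = int p ^ (2 * k)"
proof (induction k arbitrary: u v)
  case 0
  have "v = 0"
  proof (rule ccontr)
    assume "v \<noteq> 0"
    then have "v\<^sup>2 \<ge> 1" by (metis int_one_le_iff_zero_less zero_less_power2)
    then show False using 0 zero_le_power2[of u] by simp
  qed
  then show ?case using 0 by simp
next
  case (Suc k)
  then have "int p dvd u\<^sup>2 + 2 * v\<^sup>2" by simp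
  then obtain u' v' where uv: "u = int p * u'" "v = int p * v'"
    using prime_dvd_form[OF assms] by (meson dvdE)
  have "(int p)\<^sup>2 * (u'\<^sup>2 + 2 * v'\<^sup>2) = u\<^sup>2 + 2 * v\<^sup>2"
    by (simp add: uv power_mult_distrib algebra_simps)
  also have "\<dots> = (int p)\<^sup>2 * int p ^ (2 * k)"
    using Suc.prems by (simp add: power2_eq_square)
  finally have "(int p)\<^sup>2 * (u'\<^sup>2 + 2 * v'\<^sup>2) = (int p)\<^sup>2 * int p ^ (2 * k)" .
  then have "u'\<^sup>2 + 2 * v'\<^sup>2 = int p ^ (2 * k)" using prime_gt_0_nat[OF prime_p] by simp
  then show ?case using Suc.IH by (simp add: uv power_mult_distrib power2_eq_square)
qed

text \<open>The norm equation makes w = r / 2 the first coordinate of a representation of q. For p =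
  3 (mod 8) uniqueness gives w^2 = u^2; for p = 7 (mod 8) both squares equal q. As both numbers are
  3 modulo 4, the signs agree.\<close>

lemma R_eq:
  assumes "int CARD('a) = u\<^sup>2 + 2 * v\<^sup>2" "u mod 4 = 3" "p mod 8 = 3 \<longrightarrow> \<not> int p dvd u"
  shows "R = 2 * of_int u"
proof -
  obtain r where r: "R = of_int r" "r mod 8 = 6" by (rule R_eq_of_int)
  obtain a :: int where a: "S g * cnj (S g) = 2 * (of_int a)\<^sup>2" by (rule norm_S_g)
  define w where "w = r div 2"
  have w: "r = 2 * w" "w mod 4 = 3" using r(2) unfolding w_def by presburger+
  have "of_int (r\<^sup>2 + 2 * a\<^sup>2) = (of_int (4 * int CARD('a)) :: complex)"
    using R_norm_S_norm by (simp add: r a)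
  then have "r\<^sup>2 + 2 * a\<^sup>2 = 4 * int CARD('a)" by (simp only: of_int_eq_iff)
  then have wa: "2 * w\<^sup>2 + a\<^sup>2 = 2 * int CARD('a)" by (simp add: w power_mult_distrib)
  then have "a\<^sup>2 = 2 * (int CARD('a) - w\<^sup>2)" by simp
  then have "even (a\<^sup>2)" by simp
  then obtain b where "a = 2 * b" by auto
  then have wb: "int CARD('a) = w\<^sup>2 + 2 * b\<^sup>2" using wa by (simp add: power_mult_distrib)
  have "w\<^sup>2 = u\<^sup>2"
  proof (cases "p mod 8 = 3")
    case True
    then have "\<not> int p dvd w" using p_not_dvd_R[OF r(1)] by (auto simp: w)
    then show ?thesis
      using two_squares_form_unique[of "int p" "int CARD('a)" "2 * t" w b u v] assms True wb prime_p p_odd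
      by (simp add: card_field)
  next
    case False
    then have "p mod 8 = 7" using p_mod_4 by presburger
    then show ?thesis using form_inert wb assms(1) by (metis card_field of_nat_power)
  qed
  then have "w = u \<or> w = - u" by (simp add: power2_eq_iff)
  then have "w = u" using w(2) assms(2) by presburger
  then show ?thesis by (simp add: r w)
qed

subsection \<open>The hypergeometric value\<close>

text \<open>Every (q - 1)-th root of unity is the value at g of a character, defined by the discrete
  logarithm; this serves both to count the characters and to separate points.\<close>

lemma mult_char_with_value:
  assumes "z ^ (CARD('a) - 1) = 1"
  obtains \<psi> :: "'a \<Rightarrow> complex" where "mult_char \<psi>" "\<And>k. \<psi> (g ^ k) = z ^ k"
proof -
  define \<psi> where "\<psi> x = (if x = 0 then 0 else z ^ (inv_into {..<CARD('a) - 1} (\<lambda>k. g ^ k) x))" for x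
  have psi: "\<psi> (g ^ k) = z ^ k" for k
  proof -
    define j where "j = inv_into {..<CARD('a) - 1} (\<lambda>k. g ^ k) (g ^ k)"
    have "g ^ k \<in> (\<lambda>k. g ^ k) ` {..<CARD('a) - 1}"
      using bij_betw_power_g by (simp add: bij_betw_def)
    then have j: "g ^ j = g ^ k" unfolding j_def by (rule f_inv_into_f)
    have mod: "x ^ i = x ^ (i mod (CARD('a) - 1))" if "x ^ (CARD('a) - 1) = 1" for x :: "'b::monoid_mult" and i
    proof -
      have "x ^ i = x ^ ((CARD('a) - 1) * (i div (CARD('a) - 1)) + i mod (CARD('a) - 1))"
        by (simp only: mult_div_mod_eq)
      then show ?thesis by (simp only: power_add power_mult that power_one mult_1_left)
    qed
    have less: "i mod (CARD('a) - 1) \<in> {..<CARD('a) - 1}" for i using card_gt_1 by simp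
    have "g ^ (j mod (CARD('a) - 1)) = g ^ (k mod (CARD('a) - 1))"
      using j mod[OF power_card_minus_1[OF g_nonzero]] by metis
    then have "j mod (CARD('a) - 1) = k mod (CARD('a) - 1)"
      using bij_betw_power_g less unfolding bij_betw_def inj_on_def by blast
    then have "z ^ j = z ^ k" using mod[OF assms] by metis
    then show ?thesis by (simp add: \<psi>_def j_def)
  qed
  have "\<psi> (x * y) = \<psi> x * \<psi> y" for x y
  proof (cases "x = 0 \<or> y = 0")
    case False
    then obtain i j where "x = g ^ i" "y = g ^ j" by (metis discrete_log)
    then show ?thesis by (simp add: psi flip: power_add)
  qed (auto simp: \<psi>_def)
  moreover have "\<psi> 1 = 1" using psi[of 0] by simp
  ultimately have "mult_char \<psi>" by (simp add: mult_char_def \<psi>_def)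
  then show ?thesis using psi by (rule that)
qed

lemma mult_char_cnj:
  fixes \<psi> :: "'a \<Rightarrow> complex"
  assumes "mult_char \<psi>"
  shows "\<psi> (inverse x) = cnj (\<psi> x)"
proof (cases "x = 0")
  case False
  have "\<psi> x ^ (CARD('a) - 1) = 1"
    using mult_char_power[OF assms, of x "CARD('a) - 1"] power_card_minus_1[OF False] assms
    by (simp add: mult_char_def)
  then have "norm (\<psi> x) = 1"
    using card_gt_1 by (metis norm_one norm_power power_eq_1_iff norm_ge_zero zero_less_diff less_not_refl)
  then have "\<psi> x * cnj (\<psi> x) = 1" by (simp add: complex_norm_square[symmetric])
  moreover have "\<psi> x * \<psi> (inverse x) = 1"
    using assms False unfolding mult_char_def by (metis right_inverse)
  ultimately show ?thesis by (metis mult.commute mult.left_commute mult.right_neutral)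
qed (use assms in \<open>simp add: mult_char_def\<close>)

lemma card_mult_chars: "card {\<psi> :: 'a \<Rightarrow> complex. mult_char \<psi>} = CARD('a) - 1"
proof -
  have "bij_betw (\<lambda>\<psi>. \<psi> g) {\<psi> :: 'a \<Rightarrow> complex. mult_char \<psi>} {z. z ^ (CARD('a) - 1) = 1}"
    unfolding bij_betw_def
  proof (intro conjI equalityI subsetI)
    show "inj_on (\<lambda>\<psi>. \<psi> g) {\<psi> :: 'a \<Rightarrow> complex. mult_char \<psi>}"
    proof (rule inj_onI, rule ext)
      fix \<psi> \<psi>' :: "'a \<Rightarrow> complex" and x
      assume *: "\<psi> \<in> {\<psi>. mult_char \<psi>}" "\<psi>' \<in> {\<psi>. mult_char \<psi>}" "\<psi> g = \<psi>' g"
      show "\<psi> x = \<psi>' x"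
      proof (cases "x = 0")
        case False
        then obtain k where "x = g ^ k" by (rule discrete_log)
        then show ?thesis using * by (simp add: mult_char_power)
      qed (use * in \<open>simp add: mult_char_def\<close>)
    qed
  next
    fix z assume "z \<in> (\<lambda>\<psi>. \<psi> g) ` {\<psi> :: 'a \<Rightarrow> complex. mult_char \<psi>}"
    then obtain \<psi> :: "'a \<Rightarrow> complex" where \<psi>: "mult_char \<psi>" "z = \<psi> g" by auto
    then show "z \<in> {z. z ^ (CARD('a) - 1) = 1}"
      using mult_char_power[OF \<psi>(1), of g "CARD('a) - 1"] power_card_minus_1[OF g_nonzero]
      by (simp add: mult_char_def)
  next
    fix z :: complex assume "z \<in> {z. z ^ (CARD('a) - 1) = 1}"
    then obtain \<psi> :: "'a \<Rightarrow> complex" where \<psi>: "mult_char \<psi>" "\<And>k. \<psi> (g ^ k) = z ^ k"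
      using mult_char_with_value[of z] by auto
    show "z \<in> (\<lambda>\<psi>. \<psi> g) ` {\<psi> :: 'a \<Rightarrow> complex. mult_char \<psi>}"
      by (rule image_eqI[of _ _ \<psi>]) (use \<psi>(1) \<psi>(2)[of 1] in simp_all)
  qed
  then have "card {\<psi> :: 'a \<Rightarrow> complex. mult_char \<psi>} = card {z :: complex. z ^ (CARD('a) - 1) = 1}"
    by (rule bij_betw_same_card)
  also have "\<dots> = CARD('a) - 1" using card_gt_1 by (intro card_roots_unity_eq) simp
  finally show ?thesis .
qed

lemma sum_mult_chars:
  "(\<Sum>\<psi> | mult_char \<psi>. \<psi> x) = (if x = 1 then of_nat CARD('a) - 1 else 0 :: complex)" for x :: 'a
proof -
  consider "x = 0" | "x = 1" | "x \<noteq> 0" "x \<noteq> 1" by blast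
  then show ?thesis
  proof cases
    case 1
    then show ?thesis by (simp add: mult_char_def)
  next
    case 2
    then have "(\<Sum>\<psi> | mult_char \<psi>. \<psi> x) = of_nat (card {\<psi> :: 'a \<Rightarrow> complex. mult_char \<psi>})"
      by (simp add: mult_char_def)
    then show ?thesis using 2 card_gt_1 by (simp add: card_mult_chars of_nat_diff)
  next
    case 3
    define n where "n = CARD('a) - 1"
    obtain k where k: "k < n" "x = g ^ k" using discrete_log[OF 3(1)] unfolding n_def by blast
    have n: "n > 0" using card_gt_1 by (simp add: n_def)
    \<comment> \<open>A primitive n-th root of unity, so that the character with value z at g is not
      1 at x.\<close>
    define z where "z = cis (2 * pi * real 1 / real n)"
    have inj: "inj_on (\<lambda>k. cis (2 * pi * real k / real n)) {..<n}"
      using bij_betw_roots_unity[OF n] by (simp add: bij_betw_def)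
    have zk: "z ^ j = cis (2 * pi * real j / real n)" for j
      by (simp add: z_def DeMoivre mult_ac)
    have "z ^ n = 1" using n by (simp add: zk)
    then obtain \<rho> :: "'a \<Rightarrow> complex" where \<rho>: "mult_char \<rho>" "\<And>k. \<rho> (g ^ k) = z ^ k"
      using mult_char_with_value[of z] by (auto simp: n_def)
    have "z ^ k \<noteq> z ^ 0"
      using inj_onD[OF inj, of k 0] k 3 n unfolding zk by (intro notI) auto
    then have neq: "\<rho> x \<noteq> 1" using \<rho>(2) k by simp
    have "(\<Sum>\<psi> | mult_char \<psi>. \<psi> x) = (\<Sum>\<psi> | mult_char \<psi>. \<rho> x * \<psi> x)"
    proof (rule sum.reindex_bij_witness[where i = "\<lambda>\<psi> y. \<rho> y * \<psi> y" and j = "\<lambda>\<psi> y. cnj (\<rho> y) * \<psi> y"])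
      have norm: "\<rho> y * cnj (\<rho> y) = (if y = 0 then 0 else 1)" for y
        using \<rho>(1) mult_char_cnj[OF \<rho>(1), of y] by (metis mult_char_def mult_zero_left right_inverse)
      then have norm': "\<rho> y * (cnj (\<rho> y) * s) = (if y = 0 then 0 else s)" "cnj (\<rho> y) * (\<rho> y * s) = (if y = 0 then 0 else s)" for y s
        using norm[of y] \<rho>(1) by (auto simp: mult_char_def simp flip: mult.assoc) (simp add: mult.commute)
      fix \<psi> :: "'a \<Rightarrow> complex" assume "\<psi> \<in> {\<psi>. mult_char \<psi>}"
      then have \<psi>: "mult_char \<psi>" by simp
      have \<psi>0: "\<psi> 0 = 0" using \<psi> by (simp add: mult_char_def)
      show "(\<lambda>y. \<rho> y * (cnj (\<rho> y) * \<psi> y)) = \<psi>" "(\<lambda>y. cnj (\<rho> y) * (\<rho> y * \<psi> y)) = \<psi>"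
        using \<psi>0 by (auto simp: norm')
      show "(\<lambda>y. cnj (\<rho> y) * \<psi> y) \<in> {\<psi>. mult_char \<psi>}" "(\<lambda>y. \<rho> y * \<psi> y) \<in> {\<psi>. mult_char \<psi>}"
        using \<rho>(1) \<psi> by (auto simp: mult_char_def)
      show "\<rho> x * (cnj (\<rho> x) * \<psi> x) = \<psi> x" using 3 by (simp add: norm')
    qed
    also have "\<dots> = \<rho> x * (\<Sum>\<psi> | mult_char \<psi>. \<psi> x)"
      by (simp only: sum_distrib_left)
    finally have "(\<Sum>\<psi> | mult_char \<psi>. \<psi> x) = 0" using neq by (metis mult_cancel_right1)
    then show ?thesis using 3 by simp
  qed
qed

text \<open>For vertices 0, 1, x, y: \<chi> along the path 0-x-y-1 and its conjugate along the
  complementary path y-0-1-x, whose middle edge contributes 1.\<close>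

definition P where
  "P = (\<Sum>x\<in>UNIV. \<Sum>y\<in>UNIV. \<chi> x * cnj (\<chi> y) * cnj (\<chi> (1 - x)) * \<chi> (1 - y) * \<chi> (x - y))"

lemma char_power_3: "char_power \<chi> 3 = (\<lambda>x. cnj (\<chi> x))"
  by (rule ext) (simp add: char_power_chi chi_cube)

lemma char_binom_eq:
  assumes "mult_char (\<psi> :: 'a \<Rightarrow> complex)"
  shows "char_binom (char_mult A \<psi>) \<psi> = \<psi> (-1) / of_nat CARD('a) * (\<Sum>x\<in>UNIV. A x * \<psi> (x / (1 - x)))"
proof -
  have "\<psi> x * cnj (\<psi> (1 - x)) = \<psi> (x / (1 - x))" for x
    using assms mult_char_cnj[OF assms, of "1 - x"] by (simp add: mult_char_def divide_inverse)
  then show ?thesis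
    by (simp add: char_binom_def jacobi_sum_def char_mult_def char_conj_def mult.assoc)
qed

text \<open>The three binomials give a triple sum over x, y, z. Summing over the characters first
  leaves, by orthogonality, the solutions of -(x/(1-x)) (y/(1-y)) (z/(1-z)) = 1, the sign coming
  from \<psi> (-1)^3. Solving for z and replacing y by 1 - y yields P; the factors q/(q-1) and
  (q-1)/q^3 combine to 1/q^2.\<close>

lemma greene_eq_P:
  "(of_nat CARD('a))\<^sup>2 * greene_3F2 \<chi> \<chi> (char_power \<chi> 3) trivial_char trivial_char 1 = P"
proof -
  let ?q = "of_nat CARD('a) :: complex"
  let ?r = "\<lambda>x :: 'a. x / (1 - x)"
  have triv: "char_mult trivial_char \<psi> = \<psi>" if "mult_char \<psi>" for \<psi> :: "'a \<Rightarrow> complex"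
    using that by (auto simp: char_mult_def trivial_char_def mult_char_def)
  have "(\<Sum>\<psi> | mult_char \<psi>. char_binom (char_mult \<chi> \<psi>) \<psi> *
        char_binom (char_mult \<chi> \<psi>) (char_mult trivial_char \<psi>) *
        char_binom (char_mult (char_power \<chi> 3) \<psi>) (char_mult trivial_char \<psi>) * \<psi> 1)
    = (\<Sum>\<psi> | mult_char \<psi>. (\<Sum>x\<in>UNIV. \<Sum>y\<in>UNIV. \<Sum>z\<in>UNIV.
        \<chi> x * \<chi> y * cnj (\<chi> z) * \<psi> (- (?r x * ?r y * ?r z)))) / ?q ^ 3"
  proof (subst sum_divide_distrib, rule sum.cong[OF refl])
    fix \<psi> :: "'a \<Rightarrow> complex" assume "\<psi> \<in> {\<psi>. mult_char \<psi>}"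
    then have \<psi>: "mult_char \<psi>" by simp
    have mult: "\<psi> (x * y) = \<psi> x * \<psi> y" for x y using \<psi> by (simp add: mult_char_def)
    have one: "\<psi> 1 = 1" using \<psi> by (simp add: mult_char_def)
    have neg: "\<psi> (- x) = \<psi> (-1) * \<psi> x" for x using mult[of "-1" x] by simp
    have "\<psi> (-1) * \<psi> (-1) = 1" using mult[of "-1" "-1"] one by simp
    then have sq: "\<psi> (-1) * (\<psi> (-1) * s) = s" for s by (metis mult.assoc mult_1)
    have "char_binom (char_mult \<chi> \<psi>) \<psi> *
        char_binom (char_mult \<chi> \<psi>) (char_mult trivial_char \<psi>) *
        char_binom (char_mult (char_power \<chi> 3) \<psi>) (char_mult trivial_char \<psi>) * \<psi> 1
      = \<psi> (-1) * ((\<Sum>x\<in>UNIV. \<chi> x * \<psi> (?r x)) * ((\<Sum>x\<in>UNIV. \<chi> x * \<psi> (?r x)) * (\<Sum>x\<in>UNIV. cnj (\<chi> x) * \<psi> (?r x)))) / ?q ^ 3"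
      by (simp add: triv[OF \<psi>] char_binom_eq[OF \<psi>] char_power_3 one power3_eq_cube sq mult_ac)
    also have "\<dots> = (\<Sum>x\<in>UNIV. \<Sum>y\<in>UNIV. \<Sum>z\<in>UNIV.
        \<chi> x * \<chi> y * cnj (\<chi> z) * \<psi> (- (?r x * ?r y * ?r z))) / ?q ^ 3"
    proof -
      have triple: "(\<Sum>x\<in>UNIV. f x) * ((\<Sum>x\<in>UNIV. f x) * (\<Sum>x\<in>UNIV. h x))
        = (\<Sum>x\<in>UNIV. \<Sum>y\<in>UNIV. \<Sum>z\<in>UNIV. f x * (f y * h z))" for f h :: "'a \<Rightarrow> complex"
        by (simp only: sum_distrib_left[symmetric] sum_distrib_right[symmetric])
      have prod: "\<psi> (- (a * b * c)) = \<psi> (-1) * (\<psi> a * (\<psi> b * \<psi> c))" for a b c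
        by (metis neg mult mult.assoc)
      show ?thesis
        unfolding triple unfolding sum_distrib_left
        by (intro arg_cong2[where f = "(/)"] sum.cong refl) (simp only: prod, simp only: mult_ac)
    qed
    finally show "char_binom (char_mult \<chi> \<psi>) \<psi> *
        char_binom (char_mult \<chi> \<psi>) (char_mult trivial_char \<psi>) *
        char_binom (char_mult (char_power \<chi> 3) \<psi>) (char_mult trivial_char \<psi>) * \<psi> 1
      = (\<Sum>x\<in>UNIV. \<Sum>y\<in>UNIV. \<Sum>z\<in>UNIV.
        \<chi> x * \<chi> y * cnj (\<chi> z) * \<psi> (- (?r x * ?r y * ?r z))) / ?q ^ 3" .
  qed
  also have "(\<Sum>\<psi> | mult_char \<psi>. (\<Sum>x\<in>UNIV. \<Sum>y\<in>UNIV. \<Sum>z\<in>UNIV.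
        \<chi> x * \<chi> y * cnj (\<chi> z) * \<psi> (- (?r x * ?r y * ?r z))))
    = (\<Sum>x\<in>UNIV. \<Sum>y\<in>UNIV. \<Sum>z\<in>UNIV. \<chi> x * \<chi> y * cnj (\<chi> z) * (\<Sum>\<psi> | mult_char \<psi>. \<psi> (- (?r x * ?r y * ?r z))))"
    unfolding sum_distrib_left
    by (subst sum.swap, rule sum.cong[OF refl], subst sum.swap, rule sum.cong[OF refl], rule sum.swap)
  also have "\<dots> = (\<Sum>x\<in>UNIV. \<Sum>y\<in>UNIV. (?q - 1) * (\<chi> x * cnj (\<chi> (1 - y)) * cnj (\<chi> (1 - x)) * \<chi> y * \<chi> (x - (1 - y))))"
  proof (intro sum.cong refl)
    fix x y
    show "(\<Sum>z\<in>UNIV. \<chi> x * \<chi> y * cnj (\<chi> z) * (\<Sum>\<psi> | mult_char \<psi>. \<psi> (- (?r x * ?r y * ?r z))))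
      = (?q - 1) * (\<chi> x * cnj (\<chi> (1 - y)) * cnj (\<chi> (1 - x)) * \<chi> y * \<chi> (x - (1 - y)))"
    proof (cases "x = 0 \<or> y = 0 \<or> x = 1 \<or> y = 1")
      case True
      then show ?thesis by (auto simp: sum_mult_chars)
    next
      case False
      \<comment> \<open>The solution z. If 1 - x - y = 0 there is none; then c = 0 by the convention
        for division, and \<chi> c = 0.\<close>
      define c where "c = (1 - x) * (1 - y) / (1 - x - y)"
      have nz: "(1 - x) * (1 - y) \<noteq> 0" using False by simp
      have iff: "- (?r x * ?r y * ?r z) = 1 \<longleftrightarrow> z = c" if "z \<noteq> 0" for z
      proof (cases "z = 1")
        case z: True
        have "c \<noteq> 1"
        proof
          assume "c = 1"
          then have "(1 - x) * (1 - y) = 1 - x - y" unfolding c_def by (metis divide_eq_1_iff)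
          then have "x * y = 0" by (simp add: algebra_simps)
          then show False using False by simp
        qed
        then show ?thesis using z by simp
      next
        case z: False
        have "- (?r x * ?r y * ?r z) = 1 \<longleftrightarrow> - (x * y * z) = (1 - x) * (1 - y) * (1 - z)"
        proof -
          have "?r x * ?r y * ?r z = x * y * z / ((1 - x) * (1 - y) * (1 - z))" by simp
          moreover have "(1 - x) * (1 - y) * (1 - z) \<noteq> 0" using nz z by simp
          ultimately show ?thesis by (simp only: minus_divide_left divide_eq_1_iff) simp
        qed
        also have "\<dots> \<longleftrightarrow> z * (1 - x - y) = (1 - x) * (1 - y)"
        proof -
          have "(1 - x) * (1 - y) * (1 - z) + x * y * z = (1 - x) * (1 - y) - z * (1 - x - y)"
            by (simp add: algebra_simps)
          moreover have "- (x * y * z) = (1 - x) * (1 - y) * (1 - z) \<longleftrightarrow>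
              (1 - x) * (1 - y) * (1 - z) + x * y * z = 0"
            by (auto simp: eq_neg_iff_add_eq_0[symmetric])
          ultimately show ?thesis by auto
        qed
        also have "\<dots> \<longleftrightarrow> z = c"
        proof (cases "1 - x - y = 0")
          case True
          then show ?thesis using nz that by (auto simp: c_def)
        next
          case False
          then show ?thesis by (simp add: c_def eq_divide_eq)
        qed
        finally show ?thesis .
      qed
      have "(\<Sum>z\<in>UNIV. \<chi> x * \<chi> y * cnj (\<chi> z) * (\<Sum>\<psi> | mult_char \<psi>. \<psi> (- (?r x * ?r y * ?r z))))
        = (\<Sum>z\<in>UNIV. if z = c then \<chi> x * \<chi> y * cnj (\<chi> z) * (?q - 1) else 0)"
      proof (rule sum.cong[OF refl])
        fix z
        show "\<chi> x * \<chi> y * cnj (\<chi> z) * (\<Sum>\<psi> | mult_char \<psi>. \<psi> (- (?r x * ?r y * ?r z)))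
          = (if z = c then \<chi> x * \<chi> y * cnj (\<chi> z) * (?q - 1) else 0)"
        proof (cases "z = 0")
          case False
          show ?thesis unfolding sum_mult_chars iff[OF False] by simp
        qed auto
      qed
      also have "\<dots> = \<chi> x * \<chi> y * cnj (\<chi> c) * (?q - 1)" by simp
      also have "cnj (\<chi> c) = cnj (\<chi> (1 - x)) * cnj (\<chi> (1 - y)) * \<chi> (1 - x - y)"
        by (simp add: c_def chi_divide chi_mult)
      also have "\<chi> (1 - x - y) = \<chi> (x - (1 - y))"
        using chi_minus[of "1 - x - y"] by (simp add: algebra_simps)
      finally show ?thesis by (simp only: mult_ac)
    qed
  qed
  also have "\<dots> = (?q - 1) * (\<Sum>x\<in>UNIV. \<Sum>y\<in>UNIV. \<chi> x * cnj (\<chi> (1 - y)) * cnj (\<chi> (1 - x)) * \<chi> y * \<chi> (x - (1 - y)))"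
    by (simp only: sum_distrib_left)
  also have "(\<Sum>x\<in>UNIV. \<Sum>y\<in>UNIV. \<chi> x * cnj (\<chi> (1 - y)) * cnj (\<chi> (1 - x)) * \<chi> y * \<chi> (x - (1 - y))) = P"
    unfolding P_def
  proof (rule sum.cong[OF refl])
    fix x
    show "(\<Sum>y\<in>UNIV. \<chi> x * cnj (\<chi> (1 - y)) * cnj (\<chi> (1 - x)) * \<chi> y * \<chi> (x - (1 - y)))
      = (\<Sum>y\<in>UNIV. \<chi> x * cnj (\<chi> y) * cnj (\<chi> (1 - x)) * \<chi> (1 - y) * \<chi> (x - y))"
      using sum_reflect[of "\<lambda>y. \<chi> x * cnj (\<chi> y) * cnj (\<chi> (1 - x)) * \<chi> (1 - y) * \<chi> (x - y)" 1] by simp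
  qed
  finally have "greene_3F2 \<chi> \<chi> (char_power \<chi> 3) trivial_char trivial_char 1
    = ?q / (?q - 1) * ((?q - 1) * P / ?q ^ 3)"
    unfolding greene_3F2_def by simp
  also have "\<dots> = P / ?q\<^sup>2"
  proof -
    have "?q - 1 \<noteq> 0" using card_gt_1 by (metis of_nat_eq_1_iff less_irrefl right_minus_eq)
    then show ?thesis by (simp add: power2_eq_square power3_eq_cube)
  qed
  finally show ?thesis by simp
qed

subsection \<open>Sign patterns on a tetrahedron\<close>

text \<open>Signs of edges are Booleans, so that sums over \<open>UNIV\<close> run over both signs;
  negation is conjugation.\<close>

definition \<kappa> where "\<kappa> e x = (if e then \<chi> x else cnj (\<chi> x))"

lemma kappa_simps [simp]: "\<kappa> True x = \<chi> x" "\<kappa> False x = cnj (\<chi> x)"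
  and kappa_0 [simp]: "\<kappa> e 0 = 0"
  and kappa_1 [simp]: "\<kappa> e 1 = 1"
  and kappa_minus [simp]: "\<kappa> e (- x) = \<kappa> e x"
  and kappa_mult: "\<kappa> e (x * y) = \<kappa> e x * \<kappa> e y"
  and kappa_Not: "\<kappa> (\<not> e) x = cnj (\<kappa> e x)"
  by (simp_all add: \<kappa>_def chi_mult)

lemma kappa_diff_commute: "\<kappa> e (x - y) = \<kappa> e (y - x)"
  using kappa_minus[of e "x - y"] by simp

text \<open>The arguments are the signs of the edges \<open>ab\<close>, \<open>ac\<close>, \<open>ad\<close>, \<open>bc\<close>, \<open>bd\<close>, \<open>cd\<close> of a
  tetrahedron.\<close>

definition tetra where
  "tetra e1 e2 e3 e4 e5 e6 = (\<Sum>a\<in>UNIV. \<Sum>b\<in>UNIV. \<Sum>c\<in>UNIV. \<Sum>d\<in>UNIV.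
     \<kappa> e1 (a - b) * \<kappa> e2 (a - c) * \<kappa> e3 (a - d) * \<kappa> e4 (b - c) * \<kappa> e5 (b - d) * \<kappa> e6 (c - d))"

text \<open>\<open>tetra\<close> with a = 0 and b = 1; \<open>e1\<close> is absent because its edge
  contributes 1.\<close>

definition tetra01 where
  "tetra01 e2 e3 e4 e5 e6 = (\<Sum>x\<in>UNIV. \<Sum>y\<in>UNIV.
     \<kappa> e2 x * \<kappa> e3 y * \<kappa> e4 (1 - x) * \<kappa> e5 (1 - y) * \<kappa> e6 (x - y))"

text \<open>This and the next two lemmas are the adjacent transpositions, which generate all
  relabellings of the vertices.\<close>

lemma tetra_swap_ab: "tetra e1 e2 e3 e4 e5 e6 = tetra e1 e4 e5 e2 e3 e6"
  unfolding tetra_def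
  by (subst sum.swap, intro sum.cong refl) (simp add: kappa_diff_commute[of e1] mult_ac)

lemma tetra_swap_bc: "tetra e1 e2 e3 e4 e5 e6 = tetra e2 e1 e3 e4 e6 e5"
  unfolding tetra_def
  by (rule sum.cong[OF refl], subst sum.swap, intro sum.cong refl)
    (simp add: kappa_diff_commute[of e4] mult_ac)

lemma tetra_swap_cd: "tetra e1 e2 e3 e4 e5 e6 = tetra e1 e3 e2 e5 e4 e6"
  unfolding tetra_def
  by (rule sum.cong[OF refl], rule sum.cong[OF refl], subst sum.swap, intro sum.cong refl)
    (simp add: kappa_diff_commute[of e6] mult_ac)

lemma tetra_Not: "tetra (\<not> e1) (\<not> e2) (\<not> e3) (\<not> e4) (\<not> e5) (\<not> e6) = cnj (tetra e1 e2 e3 e4 e5 e6)"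
  by (simp add: tetra_def kappa_Not)

text \<open>Translating a to 0 gives the factor q. Scaling by s = a - b moves two vertices to 0 and
  1 and splits off the product of the six characters at s.\<close>

lemma tetra_normalize:
  "tetra e1 e2 e3 e4 e5 e6 = of_nat CARD('a) *
     (\<Sum>s\<in>UNIV. \<kappa> e1 s * \<kappa> e2 s * \<kappa> e3 s * \<kappa> e4 s * \<kappa> e5 s * \<kappa> e6 s) * tetra01 e2 e3 e4 e5 e6"
proof -
  define h where "h s c d = \<kappa> e1 s * \<kappa> e2 c * \<kappa> e3 d * \<kappa> e4 (s - c) * \<kappa> e5 (s - d) * \<kappa> e6 (c - d)" for s c d
  have "(\<Sum>b\<in>UNIV. \<Sum>c\<in>UNIV. \<Sum>d\<in>UNIV. \<kappa> e1 (a - b) * \<kappa> e2 (a - c) * \<kappa> e3 (a - d) *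
      \<kappa> e4 (b - c) * \<kappa> e5 (b - d) * \<kappa> e6 (c - d)) = (\<Sum>s\<in>UNIV. \<Sum>c\<in>UNIV. \<Sum>d\<in>UNIV. h s c d)" for a
  proof -
    have "(\<Sum>b\<in>UNIV. \<Sum>c\<in>UNIV. \<Sum>d\<in>UNIV. h (a - b) (a - c) (a - d))
      = (\<Sum>s\<in>UNIV. \<Sum>c\<in>UNIV. \<Sum>d\<in>UNIV. h s (a - c) (a - d))"
      by (rule sum_reflect[of "\<lambda>s. \<Sum>c\<in>UNIV. \<Sum>d\<in>UNIV. h s (a - c) (a - d)"])
    also have "\<dots> = (\<Sum>s\<in>UNIV. \<Sum>c\<in>UNIV. \<Sum>d\<in>UNIV. h s c (a - d))"
      by (rule sum.cong[OF refl], rule sum_reflect[of "\<lambda>c. \<Sum>d\<in>UNIV. h _ c (a - d)"])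
    also have "\<dots> = (\<Sum>s\<in>UNIV. \<Sum>c\<in>UNIV. \<Sum>d\<in>UNIV. h s c d)"
      by (rule sum.cong[OF refl], rule sum.cong[OF refl], rule sum_reflect)
    finally have 1: "(\<Sum>b\<in>UNIV. \<Sum>c\<in>UNIV. \<Sum>d\<in>UNIV. h (a - b) (a - c) (a - d))
      = (\<Sum>s\<in>UNIV. \<Sum>c\<in>UNIV. \<Sum>d\<in>UNIV. h s c d)" .
    show ?thesis unfolding 1[symmetric]
      by (intro sum.cong refl)
        (simp add: h_def kappa_diff_commute[of e4] kappa_diff_commute[of e5] kappa_diff_commute[of e6])
  qed
  then have "tetra e1 e2 e3 e4 e5 e6 = of_nat CARD('a) * (\<Sum>s\<in>UNIV. \<Sum>c\<in>UNIV. \<Sum>d\<in>UNIV. h s c d)"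
    by (simp add: tetra_def)
  also have "(\<Sum>s\<in>UNIV. \<Sum>c\<in>UNIV. \<Sum>d\<in>UNIV. h s c d)
    = (\<Sum>s\<in>UNIV. \<kappa> e1 s * \<kappa> e2 s * \<kappa> e3 s * \<kappa> e4 s * \<kappa> e5 s * \<kappa> e6 s * tetra01 e2 e3 e4 e5 e6)"
  proof (rule sum.cong[OF refl])
    fix s
    show "(\<Sum>c\<in>UNIV. \<Sum>d\<in>UNIV. h s c d)
      = \<kappa> e1 s * \<kappa> e2 s * \<kappa> e3 s * \<kappa> e4 s * \<kappa> e5 s * \<kappa> e6 s * tetra01 e2 e3 e4 e5 e6"
    proof (cases "s = 0")
      case False
      have "(\<Sum>c\<in>UNIV. \<Sum>d\<in>UNIV. h s c d) = (\<Sum>x\<in>UNIV. \<Sum>y\<in>UNIV. h s (s * x) (s * y))"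
        using sum_scale2[OF False False, of "h s"] by simp
      also have "\<dots> = (\<Sum>x\<in>UNIV. \<Sum>y\<in>UNIV. \<kappa> e1 s * \<kappa> e2 s * \<kappa> e3 s * \<kappa> e4 s * \<kappa> e5 s * \<kappa> e6 s *
          (\<kappa> e2 x * \<kappa> e3 y * \<kappa> e4 (1 - x) * \<kappa> e5 (1 - y) * \<kappa> e6 (x - y)))"
      proof (intro sum.cong refl)
        fix x y
        have "s - s * x = s * (1 - x)" "s - s * y = s * (1 - y)" "s * x - s * y = s * (x - y)"
          by (simp_all add: algebra_simps)
        then show "h s (s * x) (s * y) = \<kappa> e1 s * \<kappa> e2 s * \<kappa> e3 s * \<kappa> e4 s * \<kappa> e5 s * \<kappa> e6 s *
          (\<kappa> e2 x * \<kappa> e3 y * \<kappa> e4 (1 - x) * \<kappa> e5 (1 - y) * \<kappa> e6 (x - y))"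
          by (simp only: h_def kappa_mult mult_ac)
      qed
      finally show ?thesis by (simp only: tetra01_def sum_distrib_left)
    qed (simp add: h_def)
  qed
  finally show ?thesis by (simp only: sum_distrib_right[symmetric] mult.assoc[symmetric])
qed

lemma tetra_eq:
  assumes "\<kappa> e1 g * \<kappa> e2 g * \<kappa> e3 g * \<kappa> e4 g * \<kappa> e5 g * \<kappa> e6 g = 1"
  shows "tetra e1 e2 e3 e4 e5 e6 = of_nat CARD('a) * (of_nat CARD('a) - 1) * tetra01 e2 e3 e4 e5 e6"
proof -
  have kappa_power: "\<kappa> e (g ^ k) = \<kappa> e g ^ k" for e k
    by (simp add: \<kappa>_def chi_power)
  have "\<kappa> e1 s * \<kappa> e2 s * \<kappa> e3 s * \<kappa> e4 s * \<kappa> e5 s * \<kappa> e6 s = 1" if s: "s \<noteq> 0" for s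
  proof -
    obtain k where "s = g ^ k" using s by (rule discrete_log)
    then show ?thesis using assms by (simp add: kappa_power flip: power_mult_distrib)
  qed
  then have "(\<Sum>s\<in>UNIV. \<kappa> e1 s * \<kappa> e2 s * \<kappa> e3 s * \<kappa> e4 s * \<kappa> e5 s * \<kappa> e6 s) = (\<Sum>s\<in>UNIV - {0 :: 'a}. 1)"
    by (intro sum.mono_neutral_cong_right) auto
  then show ?thesis using card_gt_1 unfolding tetra_normalize by (simp add: of_nat_diff)
qed

text \<open>The six factors multiply to a character of s. With j plus signs it is \<chi>^(2 j - 6),
  which is trivial exactly for odd j; hence half of the patterns vanish.\<close>

lemma tetra_eq_0:
  assumes "\<kappa> e1 g * \<kappa> e2 g * \<kappa> e3 g * \<kappa> e4 g * \<kappa> e5 g * \<kappa> e6 g \<noteq> 1"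
  shows "tetra e1 e2 e3 e4 e5 e6 = 0"
proof -
  have "(\<Sum>s\<in>UNIV. \<kappa> e1 s * \<kappa> e2 s * \<kappa> e3 s * \<kappa> e4 s * \<kappa> e5 s * \<kappa> e6 s) = 0"
    by (rule sum_eq_0_by_scaling[OF g_nonzero assms]) (simp add: kappa_mult mult_ac)
  then show ?thesis unfolding tetra_normalize by simp
qed

lemma cnj_F [simp]: "cnj F = F"
  by (simp add: F_eq)

lemma tetra01_path: "tetra01 True False False True True = P"
  by (simp add: tetra01_def P_def)

text \<open>The substitution x -> (1 + x) / 2, y -> (1 - y) / 2 moves the ends of the normalised
  edge to -1 and 1; \<chi> does not see the factors 1/2.\<close>

lemma tetra01_one_minus: "tetra01 True True True True True = F"
proof -
  have half: "(1 / 2 :: 'a) \<noteq> 0" using two_neq_0 by simp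
  have "tetra01 True True True True True
    = (\<Sum>x\<in>UNIV. \<Sum>y\<in>UNIV. \<chi> (x + 1 / 2) * \<chi> (y + 1 / 2) * \<chi> (1 - (x + 1 / 2)) * \<chi> (1 - (y + 1 / 2)) * \<chi> (x + 1 / 2 - (y + 1 / 2)))"
    unfolding tetra01_def kappa_simps
    by (rule sum_shift2[of "\<lambda>x y. \<chi> x * \<chi> y * \<chi> (1 - x) * \<chi> (1 - y) * \<chi> (x - y)", symmetric])
  also have "\<dots> = (\<Sum>x\<in>UNIV. \<Sum>y\<in>UNIV. \<chi> (1 / 2 * x + 1 / 2) * \<chi> (- (1 / 2) * y + 1 / 2) * \<chi> (1 - (1 / 2 * x + 1 / 2)) *
      \<chi> (1 - (- (1 / 2) * y + 1 / 2)) * \<chi> (1 / 2 * x + 1 / 2 - (- (1 / 2) * y + 1 / 2)))"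
    using sum_scale2[OF half, of "- (1 / 2)" "\<lambda>x y. \<chi> (x + 1 / 2) * \<chi> (y + 1 / 2) * \<chi> (1 - (x + 1 / 2)) *
      \<chi> (1 - (y + 1 / 2)) * \<chi> (x + 1 / 2 - (y + 1 / 2))"] half by simp
  also have "\<dots> = F"
    unfolding F_def
  proof (intro sum.cong refl)
    fix x y :: 'a
    have "(4 :: 'a) \<noteq> 0" using chi_numeral_4 by fastforce
    then
    have "1 / 2 * x + 1 / 2 = 1 / 2 * (1 + x)" "- (1 / 2) * y + 1 / 2 = 1 / 2 * (1 - y)"
      "1 - (1 / 2 * x + 1 / 2) = 1 / 2 * (1 - x)" "1 - (- (1 / 2) * y + 1 / 2) = 1 / 2 * (1 + y)"
      "1 / 2 * x + 1 / 2 - (- (1 / 2) * y + 1 / 2) = 1 / 2 * (x + y)"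
      using two_neq_0 by (simp_all add: field_simps)
    moreover have "\<chi> (1 / 2) = 1" by (simp add: chi_divide)
    moreover have "1 - x\<^sup>2 = (1 - x) * (1 + x)" "1 - y\<^sup>2 = (1 - y) * (1 + y)"
      by (simp_all add: power2_eq_square algebra_simps)
    ultimately show "\<chi> (1 / 2 * x + 1 / 2) * \<chi> (- (1 / 2) * y + 1 / 2) * \<chi> (1 - (1 / 2 * x + 1 / 2)) *
      \<chi> (1 - (- (1 / 2) * y + 1 / 2)) * \<chi> (1 / 2 * x + 1 / 2 - (- (1 / 2) * y + 1 / 2))
      = \<chi> (1 - x\<^sup>2) * \<chi> (1 - y\<^sup>2) * \<chi> (x + y)"
      by (simp only: chi_mult mult_1_left) (simp only: mult_ac)
  qed
  finally show ?thesis .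
qed

text \<open>Inverting both coordinates exchanges the fourth vertex of the triangle sum with the point at
  infinity.\<close>

lemma tetra01_triangle: "tetra01 False True False True True = tetra01 True True False True True"
proof -
  have "tetra01 False True False True True = (\<Sum>x\<in>UNIV. \<Sum>y\<in>UNIV.
      cnj (\<chi> (inverse x)) * \<chi> (inverse y) * cnj (\<chi> (1 - inverse x)) * \<chi> (1 - inverse y) * \<chi> (inverse x - inverse y))"
    using sum_inverse[of "\<lambda>x. \<Sum>y\<in>UNIV. cnj (\<chi> x) * \<chi> y * cnj (\<chi> (1 - x)) * \<chi> (1 - y) * \<chi> (x - y)"]
      sum_inverse[of "\<lambda>y. cnj (\<chi> (inverse _)) * \<chi> y * cnj (\<chi> (1 - inverse _)) * \<chi> (1 - y) * \<chi> (inverse _ - y)"]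
    by (simp add: tetra01_def)
  also have "\<dots> = tetra01 True True False True True"
    unfolding tetra01_def
  proof (intro sum.cong refl)
    fix x y
    show "cnj (\<chi> (inverse x)) * \<chi> (inverse y) * cnj (\<chi> (1 - inverse x)) * \<chi> (1 - inverse y) * \<chi> (inverse x - inverse y)
      = \<kappa> True x * \<kappa> True y * \<kappa> False (1 - x) * \<kappa> True (1 - y) * \<kappa> True (x - y)"
    proof (cases "x = 0 \<or> y = 0")
      case False
      have "1 - inverse x = - ((1 - x) / x)" "1 - inverse y = - ((1 - y) / y)"
        "inverse x - inverse y = - ((x - y) / (x * y))"
        using False by (simp_all add: field_simps)
      \<comment> \<open>y collects three conjugated factors, and their product is \<chi> y; of the
        three factors at x one \<chi> x survives.\<close>
      then have "cnj (\<chi> (inverse x)) * \<chi> (inverse y) * cnj (\<chi> (1 - inverse x)) * \<chi> (1 - inverse y) * \<chi> (inverse x - inverse y)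
        = (\<chi> x * cnj (\<chi> x)) * cnj (\<chi> y ^ 3) * (\<chi> x * cnj (\<chi> (1 - x)) * \<chi> (1 - y) * \<chi> (x - y))"
        by (simp only: chi_minus chi_divide chi_mult chi_inverse complex_cnj_mult complex_cnj_cnj power3_eq_cube mult_ac)
      also have "\<dots> = \<chi> y * (\<chi> x * cnj (\<chi> (1 - x)) * \<chi> (1 - y) * \<chi> (x - y))"
        using False by (simp only: chi_cube chi_cnj_mult) simp
      finally show ?thesis by (simp add: mult_ac)
    qed auto
  qed
  finally show ?thesis .
qed

text \<open>The plus edges form one of the twelve Hamiltonian paths, and so do the minus edges. The
  first pattern is the path a-c-d-b.\<close>

lemma tetra_path:
  shows "tetra False True False False True True = of_nat CARD('a) * (of_nat CARD('a) - 1) * P"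
  and "tetra False False True True False True = of_nat CARD('a) * (of_nat CARD('a) - 1) * P"
  and "tetra True False False False True True = of_nat CARD('a) * (of_nat CARD('a) - 1) * P"
  and "tetra False False True True True False = of_nat CARD('a) * (of_nat CARD('a) - 1) * P"
  and "tetra True False True False False True = of_nat CARD('a) * (of_nat CARD('a) - 1) * P"
  and "tetra True False False True False True = of_nat CARD('a) * (of_nat CARD('a) - 1) * P"
  and "tetra False True True False True False = of_nat CARD('a) * (of_nat CARD('a) - 1) * P"
  and "tetra False True False True True False = of_nat CARD('a) * (of_nat CARD('a) - 1) * P"
  and "tetra True True False False False True = of_nat CARD('a) * (of_nat CARD('a) - 1) * P"
  and "tetra False True True True False False = of_nat CARD('a) * (of_nat CARD('a) - 1) * P"
  and "tetra True True False False True False = of_nat CARD('a) * (of_nat CARD('a) - 1) * P"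
  and "tetra True False True True False False = of_nat CARD('a) * (of_nat CARD('a) - 1) * P"
proof -
  show 1: "tetra False True False False True True = of_nat CARD('a) * (of_nat CARD('a) - 1) * P"
    by (subst tetra_eq) (use chi_g_cases in \<open>auto simp: tetra01_path\<close>)
  show 2: "tetra False False True True False True = of_nat CARD('a) * (of_nat CARD('a) - 1) * P"
    by (subst tetra_swap_ab) (rule 1)
  show 3: "tetra True False False False True True = of_nat CARD('a) * (of_nat CARD('a) - 1) * P"
    by (subst tetra_swap_bc) (rule 1)
  show 4: "tetra False False True True True False = of_nat CARD('a) * (of_nat CARD('a) - 1) * P"
    by (subst tetra_swap_bc) (rule 2)
  show 5: "tetra True False True False False True = of_nat CARD('a) * (of_nat CARD('a) - 1) * P"
    by (subst tetra_swap_ab) (rule 3)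
  show 6: "tetra True False False True False True = of_nat CARD('a) * (of_nat CARD('a) - 1) * P"
    by (subst tetra_swap_cd) (rule 3)
  show 7: "tetra False True True False True False = of_nat CARD('a) * (of_nat CARD('a) - 1) * P"
    by (subst tetra_swap_ab) (rule 4)
  show 8: "tetra False True False True True False = of_nat CARD('a) * (of_nat CARD('a) - 1) * P"
    by (subst tetra_swap_cd) (rule 4)
  show 9: "tetra True True False False False True = of_nat CARD('a) * (of_nat CARD('a) - 1) * P"
    by (subst tetra_swap_cd) (rule 5)
  show 10: "tetra False True True True False False = of_nat CARD('a) * (of_nat CARD('a) - 1) * P"
    by (subst tetra_swap_cd) (rule 7)
  show 11: "tetra True True False False True False = of_nat CARD('a) * (of_nat CARD('a) - 1) * P"
    by (subst tetra_swap_bc) (rule 9)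
  show 12: "tetra True False True True False False = of_nat CARD('a) * (of_nat CARD('a) - 1) * P"
    by (subst tetra_swap_bc) (rule 10)
qed

text \<open>Placing the only minus edge at 0 and 1 removes the conjugation from the sum, which
  leaves F.\<close>

lemma tetra_one_minus:
  shows "tetra False True True True True True = of_nat CARD('a) * (of_nat CARD('a) - 1) * F"
  and "tetra True False True True True True = of_nat CARD('a) * (of_nat CARD('a) - 1) * F"
  and "tetra True True True False True True = of_nat CARD('a) * (of_nat CARD('a) - 1) * F"
  and "tetra True True False True True True = of_nat CARD('a) * (of_nat CARD('a) - 1) * F"
  and "tetra True True True True False True = of_nat CARD('a) * (of_nat CARD('a) - 1) * F"
  and "tetra True True True True True False = of_nat CARD('a) * (of_nat CARD('a) - 1) * F"
proof -
  show 1: "tetra False True True True True True = of_nat CARD('a) * (of_nat CARD('a) - 1) * F"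
    by (subst tetra_eq) (use chi_g_cases in \<open>auto simp: tetra01_one_minus\<close>)
  show 2: "tetra True False True True True True = of_nat CARD('a) * (of_nat CARD('a) - 1) * F"
    by (subst tetra_swap_bc) (rule 1)
  show 3: "tetra True True True False True True = of_nat CARD('a) * (of_nat CARD('a) - 1) * F"
    by (subst tetra_swap_ab) (rule 2)
  show 4: "tetra True True False True True True = of_nat CARD('a) * (of_nat CARD('a) - 1) * F"
    by (subst tetra_swap_cd) (rule 2)
  show 5: "tetra True True True True False True = of_nat CARD('a) * (of_nat CARD('a) - 1) * F"
    by (subst tetra_swap_cd) (rule 3)
  show 6: "tetra True True True True True False = of_nat CARD('a) * (of_nat CARD('a) - 1) * F"
    by (subst tetra_swap_bc) (rule 5)
qed

text \<open>The conjugates of the patterns with one minus edge; F is real.\<close>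

lemma tetra_one_plus:
  shows "tetra True False False False False False = of_nat CARD('a) * (of_nat CARD('a) - 1) * F"
  and "tetra False True False False False False = of_nat CARD('a) * (of_nat CARD('a) - 1) * F"
  and "tetra False False False True False False = of_nat CARD('a) * (of_nat CARD('a) - 1) * F"
  and "tetra False False True False False False = of_nat CARD('a) * (of_nat CARD('a) - 1) * F"
  and "tetra False False False False True False = of_nat CARD('a) * (of_nat CARD('a) - 1) * F"
  and "tetra False False False False False True = of_nat CARD('a) * (of_nat CARD('a) - 1) * F"
proof -
  show 1: "tetra True False False False False False = of_nat CARD('a) * (of_nat CARD('a) - 1) * F"
    using arg_cong[OF tetra_one_minus(1), of cnj] tetra_Not[of False True True True True True] by simp
  show 2: "tetra False True False False False False = of_nat CARD('a) * (of_nat CARD('a) - 1) * F"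
    by (subst tetra_swap_bc) (rule 1)
  show 3: "tetra False False False True False False = of_nat CARD('a) * (of_nat CARD('a) - 1) * F"
    by (subst tetra_swap_ab) (rule 2)
  show 4: "tetra False False True False False False = of_nat CARD('a) * (of_nat CARD('a) - 1) * F"
    by (subst tetra_swap_cd) (rule 2)
  show 5: "tetra False False False False True False = of_nat CARD('a) * (of_nat CARD('a) - 1) * F"
    by (subst tetra_swap_cd) (rule 3)
  show 6: "tetra False False False False False True = of_nat CARD('a) * (of_nat CARD('a) - 1) * F"
    by (subst tetra_swap_bc) (rule 5)
qed

text \<open>The plus edges form a star and the minus edges a triangle, which
  \<open>tetra01_triangle\<close> turns into a single minus edge.\<close>

lemma tetra_star:
  shows "tetra False False True False True True = of_nat CARD('a) * (of_nat CARD('a) - 1) * F"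
  and "tetra False True False True False True = of_nat CARD('a) * (of_nat CARD('a) - 1) * F"
  and "tetra True False False True True False = of_nat CARD('a) * (of_nat CARD('a) - 1) * F"
  and "tetra True True True False False False = of_nat CARD('a) * (of_nat CARD('a) - 1) * F"
proof -
  show 1: "tetra False False True False True True = of_nat CARD('a) * (of_nat CARD('a) - 1) * F"
  proof -
    have "tetra False False True False True True = of_nat CARD('a) * (of_nat CARD('a) - 1) * tetra01 False True False True True"
      by (rule tetra_eq) (use chi_g_cases in auto)
    also have "tetra01 False True False True True = tetra01 True True False True True"
      by (rule tetra01_triangle)
    also have "of_nat CARD('a) * (of_nat CARD('a) - 1) * tetra01 True True False True True = tetra True True True False True True"
      by (rule tetra_eq[symmetric]) (use chi_g_cases in auto)
    also have "\<dots> = of_nat CARD('a) * (of_nat CARD('a) - 1) * F" by (rule tetra_one_minus)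
    finally show ?thesis .
  qed
  show 2: "tetra False True False True False True = of_nat CARD('a) * (of_nat CARD('a) - 1) * F"
    by (subst tetra_swap_cd) (rule 1)
  show 3: "tetra True False False True True False = of_nat CARD('a) * (of_nat CARD('a) - 1) * F"
    by (subst tetra_swap_bc) (rule 2)
  show 4: "tetra True True True False False False = of_nat CARD('a) * (of_nat CARD('a) - 1) * F"
    by (subst tetra_swap_ab) (rule 3)
qed

text \<open>The conjugates of the stars. With 12 patterns for P and 6 + 6 + 4 + 4 for F, all 32 odd
  patterns are covered.\<close>

lemma tetra_triangle:
  shows "tetra True True False True False False = of_nat CARD('a) * (of_nat CARD('a) - 1) * F"
  and "tetra True False True False True False = of_nat CARD('a) * (of_nat CARD('a) - 1) * F"
  and "tetra False True True False False True = of_nat CARD('a) * (of_nat CARD('a) - 1) * F"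
  and "tetra False False False True True True = of_nat CARD('a) * (of_nat CARD('a) - 1) * F"
proof -
  show 1: "tetra True True False True False False = of_nat CARD('a) * (of_nat CARD('a) - 1) * F"
    using arg_cong[OF tetra_star(1), of cnj] tetra_Not[of False False True False True True] by simp
  show 2: "tetra True False True False True False = of_nat CARD('a) * (of_nat CARD('a) - 1) * F"
    by (subst tetra_swap_cd) (rule 1)
  show 3: "tetra False True True False False True = of_nat CARD('a) * (of_nat CARD('a) - 1) * F"
    by (subst tetra_swap_bc) (rule 2)
  show 4: "tetra False False False True True True = of_nat CARD('a) * (of_nat CARD('a) - 1) * F"
    by (subst tetra_swap_ab) (rule 3)
qed

lemma tetra_even:
  shows "tetra False False False False False False = 0"
  and "tetra False False False False True True = 0"
  and "tetra False False False True False True = 0"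
  and "tetra False False False True True False = 0"
  and "tetra False False True False False True = 0"
  and "tetra False False True False True False = 0"
  and "tetra False False True True False False = 0"
  and "tetra False False True True True True = 0"
  and "tetra False True False False False True = 0"
  and "tetra False True False False True False = 0"
  and "tetra False True False True False False = 0"
  and "tetra False True False True True True = 0"
  and "tetra False True True False False False = 0"
  and "tetra False True True False True True = 0"
  and "tetra False True True True False True = 0"
  and "tetra False True True True True False = 0"
  and "tetra True False False False False True = 0"
  and "tetra True False False False True False = 0"
  and "tetra True False False True False False = 0"
  and "tetra True False False True True True = 0"
  and "tetra True False True False False False = 0"
  and "tetra True False True False True True = 0"
  and "tetra True False True True False True = 0"
  and "tetra True False True True True False = 0"
  and "tetra True True False False False False = 0"
  and "tetra True True False False True True = 0"
  and "tetra True True False True False True = 0"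
  and "tetra True True False True True False = 0"
  and "tetra True True True False False True = 0"
  and "tetra True True True False True False = 0"
  and "tetra True True True True False False = 0"
  and "tetra True True True True True True = 0"
  by (rule tetra_eq_0, insert chi_g_cases, elim disjE; simp add: complex_eq_iff)+

section \<open>Expansion of the full tetrahedron sum\<close>

text \<open>Chosen so that the real part of \<alpha> z is 1 at z = 1 and z = \<chi> g, and -1 at
  their negatives; B x is this real part at z = \<chi> x.\<close>

definition \<alpha> where "\<alpha> = 1 + cnj (\<chi> g)"

definition B where "B x = (\<alpha> * \<chi> x + cnj \<alpha> * cnj (\<chi> x)) / 2"

definition K where
  "K = (\<Sum>a\<in>UNIV. \<Sum>b\<in>UNIV. \<Sum>c\<in>UNIV. \<Sum>d\<in>UNIV.
     B (a - b) * B (a - c) * B (a - d) * B (b - c) * B (b - d) * B (c - d))"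

lemma K_expand:
  "K = (\<Sum>e1\<in>UNIV. \<Sum>e2\<in>UNIV. \<Sum>e3\<in>UNIV. \<Sum>e4\<in>UNIV. \<Sum>e5\<in>UNIV. \<Sum>e6\<in>UNIV.
     w e1 * w e2 * w e3 * w e4 * w e5 * w e6 * tetra e1 e2 e3 e4 e5 e6)"
  if "w = (\<lambda>e. if e then \<alpha> / 2 else cnj \<alpha> / 2)"
proof -
  have sum_bool: "(\<Sum>e\<in>UNIV. f e) = f False + f True" for f :: "bool \<Rightarrow> complex"
    by (simp add: UNIV_bool)
  have "B x = (\<Sum>e\<in>UNIV. w e * \<kappa> e x)" for x
    by (simp add: B_def sum_bool that)
  note B = this
  have "B x1 * B x2 * B x3 * B x4 * B x5 * B x6
    = (\<Sum>e1\<in>UNIV. \<Sum>e2\<in>UNIV. \<Sum>e3\<in>UNIV. \<Sum>e4\<in>UNIV. \<Sum>e5\<in>UNIV. \<Sum>e6\<in>UNIV.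
        w e1 * w e2 * w e3 * w e4 * w e5 * w e6 *
        (\<kappa> e1 x1 * \<kappa> e2 x2 * \<kappa> e3 x3 * \<kappa> e4 x4 * \<kappa> e5 x5 * \<kappa> e6 x6))" for x1 x2 x3 x4 x5 x6
  proof -
    have "w e1 * w e2 * w e3 * w e4 * w e5 * w e6 *
        (\<kappa> e1 x1 * \<kappa> e2 x2 * \<kappa> e3 x3 * \<kappa> e4 x4 * \<kappa> e5 x5 * \<kappa> e6 x6)
      = (w e1 * \<kappa> e1 x1) * ((w e2 * \<kappa> e2 x2) * ((w e3 * \<kappa> e3 x3) *
        ((w e4 * \<kappa> e4 x4) * ((w e5 * \<kappa> e5 x5) * (w e6 * \<kappa> e6 x6)))))" for e1 e2 e3 e4 e5 e6
      by (simp only: mult_ac)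
    then show ?thesis
      by (simp only: sum_distrib_left[symmetric] sum_distrib_right[symmetric] B) (simp only: mult.assoc)
  qed
  then show ?thesis
    unfolding K_def tetra_def
    by (simp only: sum_bool sum.distrib sum_distrib_left)
qed

text \<open>The weights are (1 + z) / 2 and (1 - z) / 2 with z^2 = -1. Three plus signs have weight
  2^3 / 64 = 1/8; one or five have weight 2 * (-4) / 64 = -1/8. So 12 paths, 8 stars and triangles,
  and 12 patterns with a single deviating edge give (12 P + 8 F - 12 F) / 8.\<close>

lemma K_eq: "K = of_nat CARD('a) * (of_nat CARD('a) - 1) * (3 * P - F) / 2"
proof -
  define w where "w = (\<lambda>e. if e then \<alpha> / 2 else cnj \<alpha> / 2)"
  obtain z where z: "w True = (1 + z) / 2" "w False = (1 - z) / 2" "z * z = -1"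
    using chi_g_cases by (auto simp: w_def \<alpha>_def)
  have z2: "(1 - z) * (1 + z) = 2"
    using z(3) by (simp add: algebra_simps)
  have "(1 + z) * (1 + z) = 2 * z" "(1 - z) * (1 - z) = - 2 * z"
    using z(3) by (simp_all add: algebra_simps)
  then have "(1 + z) * (1 + z) * ((1 + z) * (1 + z)) = -4" "(1 - z) * (1 - z) * ((1 - z) * (1 - z)) = -4"
    using z(3) by simp_all
  then have z4: "(1 + z) * ((1 + z) * ((1 + z) * ((1 + z) * s))) = -4 * s"
      "(1 - z) * ((1 - z) * ((1 - z) * ((1 - z) * s))) = -4 * s" for s
    by (metis mult.assoc)+
  have "(1 - z) * ((1 - z) * ((1 - z) * ((1 + z) * ((1 + z) * ((1 + z) * s)))))
    = ((1 - z) * (1 + z)) * (((1 - z) * (1 + z)) * (((1 - z) * (1 + z)) * s))" for s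
    by (simp only: mult_ac)
  then have z3: "(1 - z) * ((1 - z) * ((1 - z) * ((1 + z) * ((1 + z) * ((1 + z) * s))))) = 8 * s" for s
    by (simp add: z2)
  have "(1 - z) * ((1 + z) * ((1 + z) * ((1 + z) * ((1 + z) * ((1 + z) * s)))))
    = ((1 - z) * (1 + z)) * ((1 + z) * ((1 + z) * ((1 + z) * ((1 + z) * s))))" for s
    by (simp only: mult_ac)
  then have z5: "(1 - z) * ((1 + z) * ((1 + z) * ((1 + z) * ((1 + z) * ((1 + z) * s))))) = - 8 * s" for s
    by (simp add: z2 z4)
  have "(1 - z) * ((1 - z) * ((1 - z) * ((1 - z) * ((1 - z) * ((1 + z) * s)))))
    = ((1 - z) * (1 + z)) * ((1 - z) * ((1 - z) * ((1 - z) * ((1 - z) * s))))" for s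
    by (simp only: mult_ac)
  then have z5': "(1 - z) * ((1 - z) * ((1 - z) * ((1 - z) * ((1 - z) * ((1 + z) * s))))) = - 8 * s" for s
    by (simp add: z2 z4)
  show ?thesis
    unfolding K_expand[OF w_def]
    by (simp add: UNIV_bool tetra_path tetra_one_minus tetra_one_plus tetra_star tetra_triangle tetra_even z(1,2))
      (simp only: z3 z5 z5', simp add: field_simps)
qed

end

subsection \<open>Counting cliques\<close>

text \<open>Each clique has 4! = 24 orderings, the lists in \<open>permutations_of_set\<close>;
  different cliques give disjoint sets of lists.\<close>

lemma card_ordered_4_cliques:
  fixes adj :: "'v::finite \<Rightarrow> 'v \<Rightarrow> bool"
  assumes "\<And>a b. {a, b} \<in> E \<and> a \<noteq> b \<longleftrightarrow> adj a b"
  shows "card {(a, b, c, d). adj a b \<and> adj a c \<and> adj a d \<and> adj b c \<and> adj b d \<and> adj c d}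
    = 24 * num_cliques UNIV E 4"
proof -
  define \<K> where "\<K> = {K :: 'v set. K \<subseteq> UNIV \<and> finite K \<and> card K = 4 \<and> clique K E}"
  let ?T = "{(a, b, c, d). adj a b \<and> adj a c \<and> adj a d \<and> adj b c \<and> adj b d \<and> adj c d}"
  have adj_sym: "adj a b \<longleftrightarrow> adj b a" for a b using assms by (metis insert_commute)
  have adj_irrefl: "\<not> adj a a" for a using assms by blast
  have union: "(\<Union>K\<in>\<K>. permutations_of_set K) = (\<lambda>(a, b, c, d). [a, b, c, d]) ` ?T"
  proof (intro equalityI subsetI)
    fix xs assume "xs \<in> (\<Union>K\<in>\<K>. permutations_of_set K)"
    then obtain K where K: "K \<in> \<K>" "set xs = K" "distinct xs"
      by (auto dest: permutations_of_setD)
    then have "length xs = 4" by (metis (mono_tags, lifting) \<K>_def distinct_card mem_Collect_eq)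
    then obtain a b c d where xs: "xs = [a, b, c, d]"
      by (auto simp: numeral_eq_Suc length_Suc_conv)
    have "adj x y" if "x \<in> set xs" "y \<in> set xs" "x \<noteq> y" for x y
      using K that assms unfolding \<K>_def clique_def by blast
    then have "(a, b, c, d) \<in> ?T" using K(3) by (auto simp: xs)
    then show "xs \<in> (\<lambda>(a, b, c, d). [a, b, c, d]) ` ?T"
      by (rule image_eqI[rotated]) (simp add: xs)
  next
    fix xs assume "xs \<in> (\<lambda>(a, b, c, d). [a, b, c, d]) ` ?T"
    then obtain a b c d where xs: "xs = [a, b, c, d]" and
      adj: "adj a b" "adj a c" "adj a d" "adj b c" "adj b d" "adj c d" by auto
    then have dist: "distinct xs" using adj_irrefl by auto
    have "{x, y} \<in> E" if "x \<in> set xs" "y \<in> set xs" "x \<noteq> y" for x y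
      using that adj adj_sym assms unfolding xs by auto
    then have "set xs \<in> \<K>" using distinct_card[OF dist] by (auto simp: \<K>_def clique_def xs)
    then show "xs \<in> (\<Union>K\<in>\<K>. permutations_of_set K)" using dist by blast
  qed
  have "card ?T = card ((\<lambda>(a, b, c, d). [a, b, c, d]) ` ?T)"
    by (rule card_image[symmetric]) (auto simp: inj_on_def)
  also have "\<dots> = (\<Sum>K\<in>\<K>. card (permutations_of_set K))"
    unfolding union[symmetric] by (rule card_UN_disjoint) (auto dest: permutations_of_setD)
  also have "\<dots> = (\<Sum>K\<in>\<K>. 24)"
    by (intro sum.cong refl) (auto simp: \<K>_def fact_numeral)
  finally show ?thesis by (simp add: num_cliques_def \<K>_def)
qed

section \<open>Weighted clique count in the Peisert graph\<close>

context quartic_character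
begin

lemma alpha_square: "\<alpha> * \<alpha> = 2 * cnj (\<chi> g)" and alpha_norm: "\<alpha> * cnj \<alpha> = 2"
  using chi_g_cases by (auto simp: \<alpha>_def algebra_simps)

lemma B_0 [simp]: "B 0 = 0" and B_minus [simp]: "B (- x) = B x"
  by (simp_all add: B_def)

lemma B_diff_commute: "B (x - y) = B (y - x)"
  using B_minus[of "x - y"] by simp

lemma B_eq:
  assumes "x \<noteq> 0"
  shows "B x = (if \<chi> x = 1 \<or> \<chi> x = \<chi> g then 1 else -1)"
  using chi_cases[OF assms] chi_g_cases
  by (elim disjE) (simp_all add: B_def \<alpha>_def complex_eq_iff)

lemma B_square: "x \<noteq> 0 \<Longrightarrow> B x * B x = 1"
  by (simp add: B_eq)

lemma B_square': "B x * (B x * z) = (if x = 0 then 0 else z)"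
  by (simp add: B_square flip: mult.assoc)

text \<open>\<chi> (g^2) = -1: multiplication by g^2 exchanges the connection set with the other
  nonzero elements, so the graph is self-complementary.\<close>

lemma B_scale: "B (g\<^sup>2 * x) = - B x"
  by (simp add: B_def chi_mult chi_power power2_eq_square[of "\<chi> g"])
    (use chi_g_cases in \<open>auto simp: B_def chi_mult chi_power power2_eq_square[of "\<chi> g"] field_simps\<close>)

lemma sum_B: "(\<Sum>x\<in>UNIV. B x) = 0"
  by (rule sum_eq_0_by_scaling[of "g\<^sup>2" "-1"]) (simp_all add: B_scale)

lemma sum_B_diff: "(\<Sum>x\<in>UNIV. B (a - x)) = 0"
  using sum_reflect[of B a] sum_B by simp

text \<open>The conference property. The two unmixed products have the same sum, with coefficients
  \<alpha>^2 and its conjugate; as \<alpha>^2 = 2 cnj (\<chi> g) is purely imaginary, they cancel.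
  The mixed products contribute -(\<alpha> * cnj \<alpha>) / 2 = -1.\<close>

lemma sum_B_B:
  assumes "a \<noteq> b"
  shows "(\<Sum>d\<in>UNIV. B (a - d) * B (b - d)) = -1"
proof -
  define s where "s = b - a"
  have s: "s \<noteq> 0" using assms by (simp add: s_def)
  have S1: "(\<Sum>z\<in>UNIV. \<chi> z * \<chi> (z + s)) = \<phi> s * J"
  proof -
    have "\<chi> (- s - z) = \<chi> (z + s)" for z using chi_minus[of "z + s"] by (simp add: algebra_simps)
    then show ?thesis using sum_chi_chi[of "- s"] by simp
  qed
  have S2: "(\<Sum>z\<in>UNIV. cnj (\<chi> z) * cnj (\<chi> (z + s))) = \<phi> s * J"
    using arg_cong[OF S1, of cnj] by simp
  have S3: "(\<Sum>z\<in>UNIV. \<chi> z * cnj (\<chi> (z + s))) = -1" by (rule sum_chi_cnj_shift[OF s])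
  have S4: "(\<Sum>z\<in>UNIV. cnj (\<chi> z) * \<chi> (z + s)) = -1"
    using arg_cong[OF S3, of cnj] by simp
  have "(\<Sum>d\<in>UNIV. B (a - d) * B (b - d)) = (\<Sum>z\<in>UNIV. B z * B (z + s))"
    using sum_reflect[of "\<lambda>z. B z * B (z + s)" a] by (simp add: s_def)
  also have "\<dots> = (\<Sum>z\<in>UNIV. (\<alpha> * \<alpha>) / 4 * (\<chi> z * \<chi> (z + s)) + (cnj \<alpha> * cnj \<alpha>) / 4 * (cnj (\<chi> z) * cnj (\<chi> (z + s)))
      + (\<alpha> * cnj \<alpha>) / 4 * (\<chi> z * cnj (\<chi> (z + s)) + cnj (\<chi> z) * \<chi> (z + s)))"
    by (intro sum.cong refl) (simp add: B_def field_simps)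
  also have "\<dots> = (\<alpha> * \<alpha> + cnj (\<alpha> * \<alpha>)) / 4 * (\<phi> s * J) - (\<alpha> * cnj \<alpha>) / 2"
    by (simp only: sum.distrib sum_distrib_left[symmetric] S1 S2 S3 S4) (simp add: field_simps)
  also have "\<dots> = -1"
    using chi_g_cases by (auto simp: alpha_square alpha_norm)
  finally show ?thesis .
qed

lemma cyclic_subgroup_power_4: "x \<in> cyclic_subgroup (g ^ 4) \<longleftrightarrow> x \<noteq> 0 \<and> \<chi> x = 1"
proof
  assume "x \<in> cyclic_subgroup (g ^ 4)"
  then obtain k where "x = (g ^ 4) powi k" by (auto simp: cyclic_subgroup_def)
  then obtain n where "x = (g ^ 4) ^ n" using powi_eq_power_mod[of "g ^ 4" k] by auto
  then show "x \<noteq> 0 \<and> \<chi> x = 1"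
    by (simp add: chi_power chi_power_4)
next
  assume x: "x \<noteq> 0 \<and> \<chi> x = 1"
  then obtain k where k: "x = g ^ k" using discrete_log by blast
  then have "g ^ (k * m) = 1" using x chi_eq_1_iff[of x] by (simp add: power_mult)
  then have "4 * m dvd k * m" unfolding power_g_eq_1_iff by (simp add: card_eq)
  then obtain j where "k = 4 * j" using m_pos by auto
  then have "x = (g ^ 4) powi (int j)" using k by (simp add: power_mult)
  then show "x \<in> cyclic_subgroup (g ^ 4)" by (auto simp only: cyclic_subgroup_def)
qed

lemma peisert_connection_set_iff: "x \<in> peisert_connection_set g \<longleftrightarrow> x \<noteq> 0 \<and> B x = 1"
proof -
  have "x \<in> (\<lambda>y. g * y) ` cyclic_subgroup (g ^ 4) \<longleftrightarrow> x \<noteq> 0 \<and> \<chi> x = \<chi> g"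
  proof
    assume "x \<noteq> 0 \<and> \<chi> x = \<chi> g"
    then have "x = g * (x / g)" "x / g \<in> cyclic_subgroup (g ^ 4)"
      by (simp_all add: cyclic_subgroup_power_4 chi_divide)
    then show "x \<in> (\<lambda>y. g * y) ` cyclic_subgroup (g ^ 4)" by blast
  qed (auto simp: cyclic_subgroup_power_4 chi_mult)
  then show ?thesis
    using B_eq[of x] by (auto simp: peisert_connection_set_def cyclic_subgroup_power_4)
qed

text \<open>Twice the indicator of the connection set, which avoids denominators in expansions in
  B.\<close>

definition A where "A x = (if x = 0 then 0 else 1 + B x)"

lemma A_alt: "A x = 1 + B x - (if x = 0 then 1 else 0)"
  by (simp add: A_def)

lemma A_0 [simp]: "A 0 = 0"
  by (simp add: A_def)

lemma A_eq_connection: "A x = (if x \<in> peisert_connection_set g then 2 else 0)"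
  by (simp add: A_def peisert_connection_set_iff B_eq)

lemma A_nonzero: "A x \<noteq> 0 \<Longrightarrow> x \<noteq> 0 \<and> B x = 1"
  using peisert_connection_set_iff[of x] by (auto simp: A_eq_connection split: if_splits)

text \<open>An ordered clique contributes 2^6 = 64, and 64 * 24 = 1536.\<close>

lemma num_cliques_eq_sum:
  "1536 * of_nat (num_cliques UNIV (peisert_edges g) 4) = (\<Sum>a\<in>UNIV. \<Sum>b\<in>UNIV. \<Sum>c\<in>UNIV. \<Sum>d\<in>UNIV.
     A (a - b) * A (a - c) * A (b - c) * (A (a - d) * A (b - d) * A (c - d)))"
proof -
  define adj where "adj a b \<longleftrightarrow> a - b \<in> peisert_connection_set g" for a b
  have adj_sym: "adj a b \<longleftrightarrow> adj b a" for a b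
    by (auto simp: adj_def peisert_connection_set_iff B_diff_commute[of a b])
  have adj_irrefl: "\<not> adj a a" for a by (simp add: adj_def peisert_connection_set_iff)
  have edges: "{a, b} \<in> peisert_edges g \<and> a \<noteq> b \<longleftrightarrow> adj a b" for a b
  proof
    assume "{a, b} \<in> peisert_edges g \<and> a \<noteq> b"
    then obtain c d where "{a, b} = {c, d}" "c - d \<in> peisert_connection_set g"
      by (auto simp: peisert_edges_def)
    then show "adj a b" using adj_sym by (auto simp: doubleton_eq_iff adj_def)
  next
    assume "adj a b"
    then show "{a, b} \<in> peisert_edges g \<and> a \<noteq> b"
      using adj_irrefl unfolding adj_def peisert_edges_def by blast
  qed
  have "(\<Sum>a\<in>UNIV. \<Sum>b\<in>UNIV. \<Sum>c\<in>UNIV. \<Sum>d\<in>UNIV.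
      A (a - b) * A (a - c) * A (b - c) * (A (a - d) * A (b - d) * A (c - d)))
    = (\<Sum>(a, b, c, d)\<in>UNIV. if adj a b \<and> adj a c \<and> adj a d \<and> adj b c \<and> adj b d \<and> adj c d then 64 else 0)"
    unfolding UNIV_Times_UNIV[symmetric] sum.cartesian_product[symmetric]
    by (intro sum.cong refl) (simp add: A_eq_connection adj_def)
  also have "\<dots> = (\<Sum>x\<in>{(a, b, c, d). adj a b \<and> adj a c \<and> adj a d \<and> adj b c \<and> adj b d \<and> adj c d}. 64)"
    by (rule sum.mono_neutral_cong_right) (auto split: if_splits)
  also have "\<dots> = 64 * of_nat (24 * num_cliques UNIV (peisert_edges g) 4)"
    unfolding card_ordered_4_cliques[OF edges, symmetric] by simp
  finally show ?thesis by simp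
qed

definition T3 where "T3 a b c = (\<Sum>d\<in>UNIV. B (a - d) * B (b - d) * B (c - d))"

lemma sum_A: "(\<Sum>b\<in>UNIV. A (a - b)) = of_nat CARD('a) - 1"
  by (simp add: A_alt sum.distrib sum_subtractf sum_B_diff)

text \<open>The product of the two 1 + B sums to q - 1; at c = a and c = b, where the left side is
  0, it has the value 2, which is removed.\<close>

lemma sum_A_A:
  assumes "A (a - b) \<noteq> 0"
  shows "(\<Sum>c\<in>UNIV. A (a - c) * A (b - c)) = of_nat CARD('a) - 5"
proof -
  have ab: "a \<noteq> b" "B (a - b) = 1" "B (b - a) = 1"
    using A_nonzero[OF assms] B_diff_commute[of a b] by auto
  have "A (a - c) * A (b - c) = 1 + B (a - c) + B (b - c) + B (a - c) * B (b - c)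
      - (if c = a then 2 else 0) - (if c = b then 2 else 0)" for c
    using ab by (cases "c = a"; cases "c = b") (simp_all add: A_def algebra_simps)
  then show ?thesis
    by (simp add: sum.distrib sum_subtractf sum_B_diff sum_B_B[OF ab(1)])
qed

text \<open>The expansion gives q, -1 for each of three pairs, and T3. At each of the three vertices
  it has the value 1 * 2 * 2 instead of 0, whence q - 3 - 12.\<close>

lemma sum_A_A_A:
  assumes "A (a - b) \<noteq> 0" "A (a - c) \<noteq> 0" "A (b - c) \<noteq> 0"
  shows "(\<Sum>d\<in>UNIV. A (a - d) * A (b - d) * A (c - d)) = of_nat CARD('a) - 15 + T3 a b c"
proof -
  have dist: "a \<noteq> b" "a \<noteq> c" "b \<noteq> c" using assms by auto
  have B: "B (a - b) = 1" "B (b - a) = 1" "B (a - c) = 1" "B (c - a) = 1" "B (b - c) = 1" "B (c - b) = 1"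
    using A_nonzero assms B_diff_commute by metis+
  have "A (a - d) * A (b - d) * A (c - d) = 1 + B (a - d) + B (b - d) + B (c - d)
      + B (a - d) * B (b - d) + B (a - d) * B (c - d) + B (b - d) * B (c - d) + B (a - d) * B (b - d) * B (c - d)
      - (if d = a then 4 else 0) - (if d = b then 4 else 0) - (if d = c then 4 else 0)" for d
  proof -
    consider "d = a" | "d = b" | "d = c" | "d \<noteq> a" "d \<noteq> b" "d \<noteq> c" by blast
    then show ?thesis
      using dist B by cases (simp_all add: A_def algebra_simps)
  qed
  then show ?thesis
    by (simp add: sum.distrib sum_subtractf sum_B_diff sum_B_B dist T3_def)
qed

text \<open>For a different from b the inner sum is 2. Summing over c first, the full sum of B (c -
  d) is 0, so excluding c = a and c = b leaves -B (a - d) - B (b - d). One factor then occurs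
  squared, and the sum over d becomes linear in B.\<close>

lemma sum_B_T3:
  "(\<Sum>a\<in>UNIV. \<Sum>b\<in>UNIV. \<Sum>c\<in>UNIV. if c = a \<or> c = b then 0 else B (a - b) * T3 a b c)
    = 2 * of_nat CARD('a) * (of_nat CARD('a) - 1)"
proof -
  have "(\<Sum>c\<in>UNIV. if c = a \<or> c = b then 0 else B (a - b) * T3 a b c) = (if a = b then 0 else 2)" for a b
  proof (cases "a = b")
    case False
    have 1: "(\<Sum>c\<in>UNIV. if c = a \<or> c = b then 0 else B (c - d)) = - B (a - d) - B (b - d)" for d
    proof -
      have "(\<Sum>c\<in>UNIV. if c = a \<or> c = b then 0 else B (c - d))
        = (\<Sum>c\<in>UNIV. B (d - c) - (if c = a then B (a - d) else 0) - (if c = b then B (b - d) else 0))"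
        using False by (intro sum.cong refl) (auto simp: B_diff_commute)
      then show ?thesis by (simp add: sum_subtractf sum_B_diff)
    qed
    have 2: "(\<Sum>d\<in>UNIV. B (x - d) * (B (x - d) * B (y - d))) = - B (y - x)" for x y
    proof -
      have "(\<Sum>d\<in>UNIV. B (x - d) * (B (x - d) * B (y - d))) = (\<Sum>d\<in>UNIV. B (y - d) - (if d = x then B (y - x) else 0))"
        by (intro sum.cong refl) (auto simp: B_square')
      then show ?thesis by (simp add: sum_subtractf sum_B_diff)
    qed
    have "(\<Sum>c\<in>UNIV. if c = a \<or> c = b then 0 else B (a - b) * T3 a b c)
      = (\<Sum>c\<in>UNIV. \<Sum>d\<in>UNIV. B (a - b) * (B (a - d) * B (b - d)) * (if c = a \<or> c = b then 0 else B (c - d)))"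
      unfolding T3_def sum_distrib_left by (intro sum.cong refl) (simp add: mult.assoc sum_distrib_left)
    also have "\<dots> = (\<Sum>d\<in>UNIV. B (a - b) * (B (a - d) * B (b - d)) * (- B (a - d) - B (b - d)))"
      by (subst sum.swap) (simp only: 1 sum_distrib_left[symmetric])
    also have "\<dots> = - (B (a - b) * ((\<Sum>d\<in>UNIV. B (a - d) * (B (a - d) * B (b - d))) + (\<Sum>d\<in>UNIV. B (b - d) * (B (b - d) * B (a - d)))))"
      by (simp only: sum.distrib[symmetric] sum_distrib_left sum_negf[symmetric]) (simp add: algebra_simps)
    also have "\<dots> = 2"
      unfolding 2 using False B_square[of "a - b"] B_diff_commute[of b a] by (simp add: algebra_simps)
    finally show ?thesis using False by simp
  qed (auto intro: sum.neutral)
  moreover have "(\<Sum>b\<in>UNIV. if a = b then 0 else 2 :: complex) = 2 * (of_nat CARD('a) - 1)" for a :: 'a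
  proof -
    have "(\<Sum>b\<in>UNIV. if a = b then 0 else 2 :: complex) = (\<Sum>b\<in>UNIV. 2 - (if b = a then 2 else 0))"
      by (intro sum.cong refl) auto
    then show ?thesis by (simp add: sum_subtractf)
  qed
  ultimately show ?thesis by simp
qed

text \<open>Scaling by g^2 replaces 1 + B by 1 - B and T3 by its negative. Averaging both forms
  keeps only odd terms of the product over the triangle: the three single B, each giving 2 q (q -
  1), and the product of all three, giving K.\<close>

lemma sum_A_T3:
  "(\<Sum>a\<in>UNIV. \<Sum>b\<in>UNIV. \<Sum>c\<in>UNIV. A (a - b) * A (a - c) * A (b - c) * T3 a b c)
    = 6 * of_nat CARD('a) * (of_nat CARD('a) - 1) + K"
  (is "?X = _")
proof -
  define A' where "A' x = (if x = 0 then 0 else 1 - B x)" for x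
  define g2 where "g2 = g\<^sup>2"
  have g2: "g2 \<noteq> 0" by (simp add: g2_def)
  have diff: "g2 * x - g2 * y = g2 * (x - y)" for x y by (simp add: algebra_simps)
  have B_g2: "B (g2 * x) = - B x" for x by (simp only: g2_def B_scale)
  have A_g2: "A (g2 * x - g2 * y) = A' (x - y)" for x y
    using g2 by (simp add: diff B_g2 A_def A'_def)
  have T3_g2: "T3 (g2 * a) (g2 * b) (g2 * c) = - T3 a b c" for a b c
  proof -
    have "T3 (g2 * a) (g2 * b) (g2 * c) = (\<Sum>d\<in>UNIV. B (g2 * a - g2 * d) * B (g2 * b - g2 * d) * B (g2 * c - g2 * d))"
      unfolding T3_def by (rule sum_scale[OF g2, symmetric])
    then show ?thesis unfolding diff B_g2 by (simp add: T3_def sum_negf)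
  qed
  have "?X = (\<Sum>a\<in>UNIV. \<Sum>b\<in>UNIV. \<Sum>c\<in>UNIV. A (g2 * a - g2 * b) * A (g2 * a - g2 * c) * A (g2 * b - g2 * c)
      * T3 (g2 * a) (g2 * b) (g2 * c))"
    using sum_scale2[OF g2 g2, of "\<lambda>a b. \<Sum>c\<in>UNIV. A (a - b) * A (a - c) * A (b - c) * T3 a b c"]
    by (simp only: sum_scale[OF g2, of "\<lambda>c. A (g2 * _ - g2 * _) * A (g2 * _ - c) * A (g2 * _ - c) * T3 (g2 * _) (g2 * _) c"])
  also have "\<dots> = - (\<Sum>a\<in>UNIV. \<Sum>b\<in>UNIV. \<Sum>c\<in>UNIV. A' (a - b) * A' (a - c) * A' (b - c) * T3 a b c)"
    unfolding A_g2 T3_g2 by (simp add: sum_negf)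
  finally have "2 * ?X = (\<Sum>a\<in>UNIV. \<Sum>b\<in>UNIV. \<Sum>c\<in>UNIV. (A (a - b) * A (a - c) * A (b - c)
      - A' (a - b) * A' (a - c) * A' (b - c)) * T3 a b c)"
    by (simp add: left_diff_distrib sum_subtractf)
  also have "\<dots> = (\<Sum>a\<in>UNIV. \<Sum>b\<in>UNIV. \<Sum>c\<in>UNIV. 2 * ((if c = a \<or> c = b then 0 else B (a - b) * T3 a b c)
      + (if b = a \<or> b = c then 0 else B (a - c) * T3 a c b) + (if a = b \<or> a = c then 0 else B (b - c) * T3 b c a)
      + B (a - b) * B (a - c) * B (b - c) * T3 a b c))"
  proof (intro sum.cong refl)
    fix a b c
    have T: "T3 a c b = T3 a b c" "T3 b c a = T3 a b c" by (simp_all add: T3_def mult_ac)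
    show "(A (a - b) * A (a - c) * A (b - c) - A' (a - b) * A' (a - c) * A' (b - c)) * T3 a b c
      = 2 * ((if c = a \<or> c = b then 0 else B (a - b) * T3 a b c)
      + (if b = a \<or> b = c then 0 else B (a - c) * T3 a c b) + (if a = b \<or> a = c then 0 else B (b - c) * T3 b c a)
      + B (a - b) * B (a - c) * B (b - c) * T3 a b c)"
    proof (cases "a = b \<or> a = c \<or> b = c")
      case True
      then show ?thesis by (auto simp: A_def A'_def)
    next
      case False
      then have "A (a - b) * A (a - c) * A (b - c) - A' (a - b) * A' (a - c) * A' (b - c)
        = 2 * (B (a - b) + B (a - c) + B (b - c) + B (a - b) * B (a - c) * B (b - c))"
        by (simp add: A_def A'_def algebra_simps)
      then show ?thesis using False unfolding T by (auto simp: ring_distribs mult.assoc)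
    qed
  qed
  also have "\<dots> = 2 * ((\<Sum>a\<in>UNIV. \<Sum>b\<in>UNIV. \<Sum>c\<in>UNIV. if c = a \<or> c = b then 0 else B (a - b) * T3 a b c)
      + (\<Sum>a\<in>UNIV. \<Sum>b\<in>UNIV. \<Sum>c\<in>UNIV. if b = a \<or> b = c then 0 else B (a - c) * T3 a c b)
      + (\<Sum>a\<in>UNIV. \<Sum>b\<in>UNIV. \<Sum>c\<in>UNIV. if a = b \<or> a = c then 0 else B (b - c) * T3 b c a)
      + (\<Sum>a\<in>UNIV. \<Sum>b\<in>UNIV. \<Sum>c\<in>UNIV. B (a - b) * B (a - c) * B (b - c) * T3 a b c))"
    by (simp only: sum_distrib_left[symmetric] sum.distrib)
  also have "(\<Sum>a\<in>UNIV. \<Sum>b\<in>UNIV. \<Sum>c\<in>UNIV. if b = a \<or> b = c then 0 else B (a - c) * T3 a c b)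
    = (\<Sum>a\<in>UNIV. \<Sum>b\<in>UNIV. \<Sum>c\<in>UNIV. if c = a \<or> c = b then 0 else B (a - b) * T3 a b c)"
    by (rule sum.cong[OF refl], rule sum.swap)
  also have "(\<Sum>a\<in>UNIV. \<Sum>b\<in>UNIV. \<Sum>c\<in>UNIV. if a = b \<or> a = c then 0 else B (b - c) * T3 b c a)
    = (\<Sum>a\<in>UNIV. \<Sum>b\<in>UNIV. \<Sum>c\<in>UNIV. if c = a \<or> c = b then 0 else B (a - b) * T3 a b c)"
    by (subst sum.swap, rule sum.cong[OF refl], rule sum.swap)
  also have "(\<Sum>a\<in>UNIV. \<Sum>b\<in>UNIV. \<Sum>c\<in>UNIV. B (a - b) * B (a - c) * B (b - c) * T3 a b c) = K"
    unfolding K_def T3_def sum_distrib_left by (intro sum.cong refl) (simp only: mult_ac)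
  finally have "2 * ?X = 2 * (6 * of_nat CARD('a) * (of_nat CARD('a) - 1) + K)"
    unfolding sum_B_T3 by simp
  then show ?thesis by (simp only: mult_cancel_left) simp
qed

text \<open>The vertices d, c, b, a are summed out in this order. The edge conditions in
  \<open>sum_A_A\<close> and \<open>sum_A_A_A\<close> cost nothing, because the outer factors are 0
  when they fail.\<close>

lemma num_cliques_eq_K:
  "1536 * of_nat (num_cliques UNIV (peisert_edges g) 4) =
    of_nat CARD('a) * (of_nat CARD('a) - 1) * ((of_nat CARD('a))\<^sup>2 - 20 * of_nat CARD('a) + 81) + K"
proof -
  let ?q = "of_nat CARD('a) :: complex"
  have "(\<Sum>d\<in>UNIV. A (a - b) * A (a - c) * A (b - c) * (A (a - d) * A (b - d) * A (c - d)))
    = A (a - b) * (A (a - c) * A (b - c)) * (?q - 15) + A (a - b) * A (a - c) * A (b - c) * T3 a b c" for a b c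
    using sum_A_A_A[of a b c]
    by (cases "A (a - b) * A (a - c) * A (b - c) = 0") (auto simp: ring_distribs simp flip: sum_distrib_left)
  then have "1536 * of_nat (num_cliques UNIV (peisert_edges g) 4)
    = (\<Sum>a\<in>UNIV. \<Sum>b\<in>UNIV. \<Sum>c\<in>UNIV. A (a - b) * (A (a - c) * A (b - c)) * (?q - 15)) + (6 * ?q * (?q - 1) + K)"
    unfolding num_cliques_eq_sum by (simp only: sum.distrib sum_A_T3)
  also have "(\<Sum>a\<in>UNIV. \<Sum>b\<in>UNIV. \<Sum>c\<in>UNIV. A (a - b) * (A (a - c) * A (b - c)) * (?q - 15))
    = (\<Sum>a\<in>UNIV. \<Sum>b\<in>UNIV. A (a - b) * ((?q - 5) * (?q - 15)))"
  proof (rule sum.cong[OF refl], rule sum.cong[OF refl])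
    fix a b
    show "(\<Sum>c\<in>UNIV. A (a - b) * (A (a - c) * A (b - c)) * (?q - 15)) = A (a - b) * ((?q - 5) * (?q - 15))"
      using sum_A_A[of a b] by (cases "A (a - b) = 0") (simp_all flip: sum_distrib_left sum_distrib_right)
  qed
  also have "\<dots> = ?q * (?q - 1) * ((?q - 5) * (?q - 15))"
    by (simp add: sum_A flip: sum_distrib_right)
  finally show ?thesis by (simp add: power2_eq_square algebra_simps)
qed

end

theorem theorem1p2:
  fixes p t q :: nat and u v :: int
    and g :: "'a::{field,finite}" and \<chi>4 :: "'a \<Rightarrow> complex"
  assumes "prime p" and "p mod 4 = 3"
    and "t > 0"
    and "q = p ^ (2 * t)" and "CARD('a) = q"
    and "int q = u\<^sup>2 + 2 * v\<^sup>2"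
    and "u mod 4 = 3"
    and "p mod 8 = 3 \<longrightarrow> \<not> int p dvd u"
    and "primitive_element g"
    and "mult_char_of_order 4 \<chi>4"
  shows "of_nat (num_cliques UNIV (peisert_edges g) 4) =
    of_nat q * (of_nat q - 1) / 3072 *
      (2 * ((of_nat q)\<^sup>2 - 20 * of_nat q + 81) + 2 * of_int u * (- of_nat p) ^ t +
       3 * (of_nat q)\<^sup>2 *
         greene_3F2 \<chi>4 \<chi>4 (char_power \<chi>4 3) trivial_char trivial_char 1)"
proof -
  interpret quartic_character \<chi>4 g p t
    using assms by unfold_locales simp_all
  let ?q = "of_nat q :: complex"
  let ?H = "greene_3F2 \<chi>4 \<chi>4 (char_power \<chi>4 3) trivial_char trivial_char 1"
  have "R = 2 * of_int u"
    using assms by (intro R_eq) simp_all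
  \<comment> \<open>The minus sign of J meets that of -F in \<open>K_eq\<close>; hence the plus sign
    in the formula.\<close>
  then have F: "F = - (2 * of_int u * (- of_nat p) ^ t)"
    by (simp add: F_eq J_eq)
  have P: "P = ?q\<^sup>2 * ?H"
    using greene_eq_P assms by simp
  have "1536 * of_nat (num_cliques UNIV (peisert_edges g) 4)
    = ?q * (?q - 1) * (?q\<^sup>2 - 20 * ?q + 81) + ?q * (?q - 1) * (3 * P - F) / 2"
    using num_cliques_eq_K assms by (simp add: K_eq)
  then have "of_nat (num_cliques UNIV (peisert_edges g) 4)
    = ?q * (?q - 1) / 3072 * (2 * (?q\<^sup>2 - 20 * ?q + 81) - F + 3 * P)"
    by (simp add: field_simps)
  then show ?thesis by (simp add: F P mult.assoc)
qed

end
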